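(* Let $w(\mu)\in\Theta^0_0+\mathscr{S}$ be a non-degenerate multi-parameter nonconservative perturbation of a vector field $v=\Theta^0_0+f(x,y^2+z^2)E$, where $f$ is a formal power series without constant term whose coefficient of $x$ is nonzero. Then there exist a natural number $r\ge2$ and a sequence of permissible transformations transforming the system generated by $w(\mu)$ into the infinite level parametric normal form system $$\dot x=x\,g(x,\rho,\mu),\qquad \dot\rho=\tfrac12\rho\,g(x,\rho,\mu),\qquad \dot\theta=1,$$ in cylindrical coordinates $y=\rho\sin\theta$, $z=\rho\cos\theta$, where $$g(x,\rho,\mu)=x+\beta_1\rho^2+\sum_{k=0}^r\rho^{2k}\mu_{k+1}+\beta_r\rho^{2r},\qquad \beta_r\ne0.$$
   Context: $\mathbb{F}$ is a field of characteristic zero. Let $E:=x\frac{\partial}{\partial x}+\frac12 y\frac{\partial}{\partial y}+\frac12 z\frac{\partial}{\partial z}$, $E^l_k:=x^l(y^2+z^2)^{k-l}E$ and $Z^l_k:=x^l(y^2+z^2)^{k-l}$ for $0\le l\le k$, and $\Theta^0_0:=z\frac{\partial}{\partial y}-y\frac{\partial}{\partial z}$. Parameters: $\mu=(\mu_1,\ldots,\mu_q)$; for $\mathbf m\in\mathbb{N}_0^q$, $\mu^{\mathbf m}=\mu_1^{m_1}\cdots\mu_q^{m_q}$ and $|\mathbf m|=\sum m_j$. $\mathscr{S}$ is the space of formal sums $\sum\beta^l_{k,\mathbf m}E^l_k\mu^{\mathbf m}$ over $k\ge l\ge0$, $\mathbf m\in\mathbb{N}_0^q$, with $\beta^l_{k,\mathbf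 m}\in\mathbb{F}$ and $\beta^0_{0,\mathbf 0}=0$. $\mathscr{T}$ is the space of formal sums of $Z^l_k\mu^{\mathbf m}$ without constant term. $\mathscr{P}$ is the space of $q$-tuples of formal power series in $\mu$ without constant term. Elements $(S,P,T)\in\mathscr{S}\times\mathscr{P}\times\mathscr{T}$ act by $(S,P,T)*w:=D_\mu(w)P+Tw+[S,w]$. Permissible transformations: $\Theta^0_0$ is first removed by the time-dependent rotation of the $(y,z)$-variables given by its flow. One then uses formal parameter-dependent changes of state variables generated by $S\in\mathscr{S}$, formal time rescalings (multiplication by a unit $1+T$, $T\in\mathscr{T}$, and by nonzero constants), and formal invertible reparametrizations of $\mu$ fixing $0$ (including invertible linear ones). Finally $\Theta^0_0$ is put back by the inverse rotation. Coefficients are updated throughout. Perturbation: $w(\mu)\in\Theta^0_0+\mathscr{S}$ is a multi-parameter nonconservative perturbation of $v$ if $w(\mathbf 0)=v$. Under the standing assumption that the coefficient of $E^1_1$ in $v$ is nonzero, $w$ (with $\Theta^0_0$ removed) can be transformed by permissible transformations into $$w^{(2)}=E^1_1+\sum_{k\ge0,|\mathbf m|\ge0}\beta^0_{k,\mathbf m}E^0_k\mu^{\mathbf m}\quad(\beta^0_{0,\mathbf 0}=0).$$ It is assumed that $\beta^0_{k,\mathbf 0}\neq0$ for some $k>1$, and $r:=\min\{k>1:\beta^0_{k,\mathbf 0}\ne0\}$. The perturbation $w$ is non-degenerate if the $(r+1)\times q$ matrix $(a_{ij})$, $a_{ij}:=\beta^0_{i-1,e_j}$ ($e_j$ the $j$-th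 standard basis vector), has rank $r+1$. Infinite level: grade by $\delta_\alpha(E^l_k\mu^{\mathbf m})=\delta_\alpha(Z^l_k\mu^{\mathbf m})=2k-l+\alpha\cdot\mathbf m$, $\delta_\alpha(\mu^{\mathbf m})=\alpha\cdot\mathbf m$, where $\alpha\cdot\mathbf m=\sum\alpha_jm_j$ and $\alpha_i=2(r-i+1)$ for $i\le r+1$ ($\alpha_i=0$ for $i>r+1$). Put $A_i:=\mathscr{S}_i\times\mathscr{P}_i\times\mathscr{T}_i$ for $i\ge1$. For $w=\sum_{i\ge1}w_i$ (grade decomposition, $\Theta^0_0$ removed, $w_0:=0$), define inductively $d^{n,1}(Y_n):=Y_n*w_0$ for $Y_n\in A_n$, and for $2\le k\le n$, $d^{n,k}(Y_n,\ldots,Y_{n-k+1}):=\sum_{i=0}^{k-1}Y_{n-i}*w_i$ on $A_n\times\ker(d^{n-1,k-1})$. Set $d^{n,k}:=d^{n,n}$ for $k>n$. A normal form style fixes complements $\mathcal{C}^{n,k}$ of $\operatorname{im}d^{n,k}$ in $\mathscr{S}_n$. $w$ is in infinite level parametric normal form if $w_n\in\mathcal{C}^{n,n}$ for all $n\in\mathbb{N}$, for such a choice.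
   Formalization: In the infinite level definition, a term μ^m in the j-th component of P is given grade α·m − α_j instead of α·m; with grade α·m the maps d^{n,k} do not take values in S_n, so complements in S_n would not exist. *)

theory Defs
  imports
    "HOL-Library.Poly_Mapping"
    "HOL-Library.Function_Algebras"
    "HOL-Computational_Algebra.Formal_Power_Series"
    "Jordan_Normal_Form.DL_Rank"
begin

section \<open>Formal power series in several variables\<close>

text \<open>The monomial with exponents \<open>n\<close> is represented by \<open>n :: 'v \<Rightarrow>\<^sub>0 nat\<close>.\<close>

typedef ('v, 'a) mfps = "UNIV :: (('v \<Rightarrow>\<^sub>0 nat) \<Rightarrow> 'a) set"
  morphisms mcoeff Abs_mfps
  by simp

setup_lifting type_definition_mfps

lemma mfps_eqI: "(\<And>n. mcoeff f n = mcoeff g n) \<Longrightarrow> f = g"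
  by (metis mcoeff_inject ext)

lemma finite_decompositions: "finite {(a, b). a + b = (n :: 'v \<Rightarrow>\<^sub>0 nat)}"
proof -
  let ?N = "Poly_Mapping.keys n"
  let ?M = "Max (Poly_Mapping.lookup n ` ?N)"
  let ?F = "{f. \<forall>v. (v \<in> ?N \<longrightarrow> f v \<in> {..?M}) \<and> (v \<notin> ?N \<longrightarrow> f v = (0 :: nat))}"
  have "finite ?F"
    by (rule finite_set_of_finite_funs) auto
  moreover have "inj (Poly_Mapping.lookup :: ('v \<Rightarrow>\<^sub>0 nat) \<Rightarrow> _)"
    by (meson injI lookup_inject)
  ultimately have fin: "finite (Poly_Mapping.lookup -` ?F)"
    by (rule finite_vimageI)
  have below: "a \<in> Poly_Mapping.lookup -` ?F" if "a + b = n" for a b :: "'v \<Rightarrow>\<^sub>0 nat"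
  proof -
    have le: "Poly_Mapping.lookup a v \<le> Poly_Mapping.lookup n v" for v
      using that by (auto simp: lookup_add)
    have "Poly_Mapping.lookup a v \<le> ?M" if "v \<in> ?N" for v
      using le[of v] that by (meson Max_ge finite_imageI finite_keys image_eqI le_trans)
    moreover have "Poly_Mapping.lookup a v = 0" if "v \<notin> ?N" for v
      using le[of v] that by (simp add: in_keys_iff)
    ultimately show ?thesis by auto
  qed
  define A where "A = Poly_Mapping.lookup -` ?F"
  have "a \<in> A \<and> b \<in> A" if "a + b = n" for a b
    using below[of a b] below[of b a] that unfolding A_def[symmetric] by (simp add: add.commute)
  then have "{(a, b). a + b = n} \<subseteq> A \<times> A"
    by auto
  then show ?thesis
    using fin unfolding A_def[symmetric] by (meson finite_SigmaI finite_subset)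
qed

instantiation mfps :: (type, comm_ring_1) comm_ring_1
begin

lift_definition zero_mfps :: "('a, 'b) mfps" is "\<lambda>n. 0" .
lift_definition one_mfps :: "('a, 'b) mfps" is "\<lambda>n. if n = 0 then 1 else 0" .
lift_definition plus_mfps :: "('a, 'b) mfps \<Rightarrow> ('a, 'b) mfps \<Rightarrow> ('a, 'b) mfps"
  is "\<lambda>f g n. f n + g n" .
lift_definition minus_mfps :: "('a, 'b) mfps \<Rightarrow> ('a, 'b) mfps \<Rightarrow> ('a, 'b) mfps"
  is "\<lambda>f g n. f n - g n" .
lift_definition uminus_mfps :: "('a, 'b) mfps \<Rightarrow> ('a, 'b) mfps"
  is "\<lambda>f n. - f n" .
lift_definition times_mfps :: "('a, 'b) mfps \<Rightarrow> ('a, 'b) mfps \<Rightarrow> ('a, 'b) mfps"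
  is "\<lambda>f g n. \<Sum>(a, b) \<in> {(a, b). a + b = n}. f a * g b" .

instance
proof
  fix f g h :: "('a, 'b) mfps"
  show "f + g + h = f + (g + h)" "f + g = g + f" "0 + f = f" "- f + f = 0" "f - g = f + - g"
    by (transfer, simp add: fun_eq_iff algebra_simps)+
  show "(0 :: ('a, 'b) mfps) \<noteq> 1"
    by transfer (metis one_neq_zero)
  show "f * g = g * f"
    by transfer (auto simp: fun_eq_iff algebra_simps
        intro!: sum.reindex_bij_witness[of _ "\<lambda>(a, b). (b, a)" "\<lambda>(a, b). (b, a)"])
  show "(f + g) * h = f * h + g * h"
    by transfer (simp add: fun_eq_iff distrib_right sum.distrib case_prod_unfold)
  show "1 * f = f"
  proof (transfer, rule ext)
    fix f :: "('a \<Rightarrow>\<^sub>0 nat) \<Rightarrow> 'b" and n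
    have "(\<Sum>(a, b) \<in> {(a, b). a + b = n}. (if a = 0 then 1 else 0) * f b)
        = (\<Sum>(a, b) \<in> {(0 :: 'a \<Rightarrow>\<^sub>0 nat, n)}. (if a = 0 then 1 else 0) * f b)"
      by (rule sum.mono_neutral_right) (auto simp: finite_decompositions split: if_splits)
    then show "(\<Sum>(a, b) \<in> {(a, b). a + b = n}. (if a = 0 then 1 else 0) * f b) = f n"
      by simp
  qed
  show "f * g * h = f * (g * h)"
  proof (transfer, rule ext)
    fix f g h :: "('a \<Rightarrow>\<^sub>0 nat) \<Rightarrow> 'b" and n
    let ?D = "\<lambda>n. {(a, b). a + b = (n :: 'a \<Rightarrow>\<^sub>0 nat)}"
    have "(\<Sum>(a, b) \<in> ?D n. (\<Sum>(c, d) \<in> ?D a. f c * g d) * h b)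
        = (\<Sum>p \<in> ?D n. \<Sum>q \<in> ?D (fst p). f (fst q) * g (snd q) * h (snd p))"
      by (simp add: case_prod_unfold sum_distrib_right)
    also have "\<dots> = (\<Sum>(p, q) \<in> (SIGMA p : ?D n. ?D (fst p)). f (fst q) * g (snd q) * h (snd p))"
      by (rule sum.Sigma) (auto simp: finite_decompositions)
    also have "\<dots> = (\<Sum>(p, q) \<in> (SIGMA p : ?D n. ?D (snd p)). f (fst p) * (g (fst q) * h (snd q)))"
      by (rule sum.reindex_bij_witness[of _
            "\<lambda>((c, _), (d, b)). ((c + d, b), (c, d))" "\<lambda>((_, b), (c, d)). ((c, d + b), (d, b))"])
         (auto simp: algebra_simps)
    also have "\<dots> = (\<Sum>p \<in> ?D n. \<Sum>q \<in> ?D (snd p). f (fst p) * (g (fst q) * h (snd q)))"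
      by (rule sum.Sigma[symmetric]) (auto simp: finite_decompositions)
    also have "\<dots> = (\<Sum>(a, b) \<in> ?D n. f a * (\<Sum>(c, d) \<in> ?D b. g c * h d))"
      by (simp add: case_prod_unfold sum_distrib_left)
    finally show "(\<Sum>(a, b) \<in> ?D n. (\<Sum>(c, d) \<in> ?D a. f c * g d) * h b)
        = (\<Sum>(a, b) \<in> ?D n. f a * (\<Sum>(c, d) \<in> ?D b. g c * h d))" .
  qed
qed

end

lift_definition mconst :: "'a \<Rightarrow> ('v, 'a :: zero) mfps" is "\<lambda>c n. if n = 0 then c else 0" .

lift_definition mvar :: "'v \<Rightarrow> ('v, 'a :: zero_neq_one) mfps"
  is "\<lambda>v n. if n = Poly_Mapping.single v 1 then 1 else 0" .

lift_definition pdiff :: "'v \<Rightarrow> ('v, 'a :: comm_ring_1) mfps \<Rightarrow> ('v, 'a) mfps"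
  is "\<lambda>v f n. of_nat (Poly_Mapping.lookup n v + 1) * f (n + Poly_Mapping.single v 1)" .

text \<open>
  A formal (possibly infinite) sum of power series is taken coefficientwise. It is used below only
  for families in which every monomial occurs in finitely many members.
\<close>

lift_definition formal_sum :: "('i \<Rightarrow> ('v, 'a :: comm_ring_1) mfps) \<Rightarrow> ('v, 'a) mfps"
  is "\<lambda>F n. Sum_any (\<lambda>i. F i n)" .

definition msubst :: "('v \<Rightarrow> ('v, 'a) mfps) \<Rightarrow> ('v, 'a :: comm_ring_1) mfps \<Rightarrow> ('v, 'a) mfps" where
  "msubst \<phi> f = formal_sum (\<lambda>n. mconst (mcoeff f n) * (\<Prod>v\<in>Poly_Mapping.keys n. \<phi> v ^ Poly_Mapping.lookup n v))"

section \<open>Formal vector fields with parameters\<close>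

text \<open>
  All power series live in one ring, in the state variables \<open>x, y, z\<close>, the time \<open>t\<close> and the
  parameters \<open>\<mu>\<^sub>j = mvar (Param j)\<close>. Only \<open>\<mu>\<^sub>1, \<dots>, \<mu>\<^sub>q\<close> are used, where \<open>q\<close> is an argument of the
  relevant definitions; \<open>t\<close> is needed only for the time-dependent rotation.
\<close>

datatype state = X | Y | Z
datatype var = State state | Time | Param nat

type_synonym 'a series = "(var, 'a) mfps"
type_synonym 'a vfield = "state \<Rightarrow> 'a series"

abbreviation xv :: "'a :: comm_ring_1 series" where "xv \<equiv> mvar (State X)"
abbreviation yv :: "'a :: comm_ring_1 series" where "yv \<equiv> mvar (State Y)"
abbreviation zv :: "'a :: comm_ring_1 series" where "zv \<equiv> mvar (State Z)"
abbreviation tv :: "'a :: comm_ring_1 series" where "tv \<equiv> mvar Time"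
abbreviation mu :: "nat \<Rightarrow> 'a :: comm_ring_1 series" where "mu j \<equiv> mvar (Param j)"

definition smult_fun :: "'a series \<Rightarrow> 'a vfield \<Rightarrow> 'a :: comm_ring_1 vfield" (infixr \<open>\<cdot>\<^sub>v\<close> 70) where
  "f \<cdot>\<^sub>v w = (\<lambda>s. f * w s)"

definition lie_deriv :: "'a vfield \<Rightarrow> 'a series \<Rightarrow> 'a :: comm_ring_1 series" where
  "lie_deriv w f = (\<Sum>s\<in>{X, Y, Z}. w s * pdiff (State s) f)"

definition lie_bracket :: "'a vfield \<Rightarrow> 'a vfield \<Rightarrow> 'a :: comm_ring_1 vfield" where
  "lie_bracket v w = (\<lambda>s. lie_deriv v (w s) - lie_deriv w (v s))"

definition Theta :: "'a :: comm_ring_1 vfield" where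
  "Theta s = (case s of X \<Rightarrow> 0 | Y \<Rightarrow> zv | Z \<Rightarrow> - yv)"

definition Euler :: "'a :: field_char_0 vfield" where
  "Euler s = (case s of X \<Rightarrow> xv | Y \<Rightarrow> mconst (1 / 2) * yv | Z \<Rightarrow> mconst (1 / 2) * zv)"

definition mu_power :: "(nat \<Rightarrow>\<^sub>0 nat) \<Rightarrow> 'a :: comm_ring_1 series" where
  "mu_power m = (\<Prod>j\<in>Poly_Mapping.keys m. mu j ^ Poly_Mapping.lookup m j)"

text \<open>\<open>Zterm k l m\<close> and \<open>Eterm k l m\<close> are \<open>Z\<^sup>l\<^sub>k \<mu>\<^sup>m\<close> and \<open>E\<^sup>l\<^sub>k \<mu>\<^sup>m\<close>, for \<open>l \<le> k\<close>.\<close>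

definition Zterm :: "nat \<Rightarrow> nat \<Rightarrow> (nat \<Rightarrow>\<^sub>0 nat) \<Rightarrow> 'a :: comm_ring_1 series" where
  "Zterm k l m = xv ^ l * (yv\<^sup>2 + zv\<^sup>2) ^ (k - l) * mu_power m"

definition Eterm :: "nat \<Rightarrow> nat \<Rightarrow> (nat \<Rightarrow>\<^sub>0 nat) \<Rightarrow> 'a :: field_char_0 vfield" where
  "Eterm k l m = Zterm k l m \<cdot>\<^sub>v Euler"

type_synonym 'a coeffs = "nat \<Rightarrow> nat \<Rightarrow> (nat \<Rightarrow>\<^sub>0 nat) \<Rightarrow> 'a"

definition Zsum :: "'a coeffs \<Rightarrow> 'a :: comm_ring_1 series" where
  "Zsum \<tau> = formal_sum (\<lambda>(k, l, m). mconst (\<tau> k l m) * Zterm k l m)"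

definition Esum :: "'a coeffs \<Rightarrow> 'a :: field_char_0 vfield" where
  "Esum \<beta> = (\<lambda>s. formal_sum (\<lambda>(k, l, m). mconst (\<beta> k l m) * Eterm k l m s))"

definition admissible :: "nat \<Rightarrow> 'a :: zero coeffs set" where
  "admissible q = {\<beta>. \<beta> 0 0 0 = 0 \<and> (\<forall>k l m. \<beta> k l m \<noteq> 0 \<longrightarrow> l \<le> k \<and> Poly_Mapping.keys m \<subseteq> {1..q})}"

definition Sspace :: "nat \<Rightarrow> 'a :: field_char_0 vfield set" where
  "Sspace q = Esum ` admissible q"

definition Tspace :: "nat \<Rightarrow> 'a :: comm_ring_1 series set" where
  "Tspace q = Zsum ` admissible q"

text \<open>A \<open>q\<close>-tuple is indexed by \<open>1, \<dots>, q\<close> and padded with zeros.\<close>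

definition Pspace :: "nat \<Rightarrow> (nat \<Rightarrow> 'a :: comm_ring_1 series) set" where
  "Pspace q = {P. \<forall>j. (j \<notin> {1..q} \<longrightarrow> P j = 0) \<and> mcoeff (P j) 0 = 0
                    \<and> (\<forall>n. mcoeff (P j) n \<noteq> 0 \<longrightarrow> Poly_Mapping.keys n \<subseteq> Param ` {1..q})}"

fun act :: "nat \<Rightarrow> 'a vfield \<times> (nat \<Rightarrow> 'a series) \<times> 'a series \<Rightarrow> 'a vfield \<Rightarrow> 'a :: field_char_0 vfield" where
  "act q (S, P, T) w = (\<lambda>s. \<Sum>j=1..q. pdiff (Param j) (w s) * P j) + T \<cdot>\<^sub>v w + lie_bracket S w"

section \<open>Permissible transformations\<close>

definition state_subst :: "'a vfield \<Rightarrow> var \<Rightarrow> 'a :: comm_ring_1 series" where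
  "state_subst \<phi> v = (case v of State s \<Rightarrow> \<phi> s | _ \<Rightarrow> mvar v)"

definition param_subst :: "(nat \<Rightarrow> 'a series) \<Rightarrow> var \<Rightarrow> 'a :: comm_ring_1 series" where
  "param_subst \<psi> v = (case v of Param j \<Rightarrow> \<psi> j | _ \<Rightarrow> mvar v)"

text \<open>
  \<open>change_of_coords \<phi> w w'\<close>: the possibly time-dependent substitution \<open>\<xi> = \<phi>(\<eta>, t, \<mu>)\<close> of the state
  variables turns the system \<open>d\<xi>/dt = w(\<xi>, \<mu>)\<close> into \<open>d\<eta>/dt = w'(\<eta>, \<mu>)\<close>, that is,
  \<open>\<partial>\<phi>/\<partial>t + D\<^sub>\<eta>\<phi> w' = w \<circ> \<phi>\<close>.
\<close>

definition change_of_coords :: "'a vfield \<Rightarrow> 'a vfield \<Rightarrow> 'a :: comm_ring_1 vfield \<Rightarrow> bool" where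
  "change_of_coords \<phi> w w' \<longleftrightarrow>
     (\<forall>s. pdiff Time (\<phi> s) + lie_deriv w' (\<phi> s) = msubst (state_subst \<phi>) (w s))"

text \<open>
  The formal flow of \<open>V\<close> at time \<open>\<tau>\<close>, as a map: its components are \<open>exp (\<tau> V)\<close> applied to the
  coordinate functions.
\<close>

definition flow :: "'a series \<Rightarrow> 'a vfield \<Rightarrow> 'a :: field_char_0 vfield" where
  "flow \<tau> V = (\<lambda>s. formal_sum (\<lambda>n. mconst (1 / fact n) * \<tau> ^ n * (lie_deriv V ^^ n) (mvar (State s))))"

definition remove_rotation :: "'a vfield \<Rightarrow> 'a :: field_char_0 vfield \<Rightarrow> bool" where
  "remove_rotation = change_of_coords (flow tv Theta)"

definition restore_rotation :: "'a vfield \<Rightarrow> 'a :: field_char_0 vfield \<Rightarrow> bool" where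
  "restore_rotation = change_of_coords (flow (- tv) Theta)"

definition reparametrization :: "nat \<Rightarrow> (nat \<Rightarrow> 'a :: comm_ring_1 series) \<Rightarrow> bool" where
  "reparametrization q \<psi> \<longleftrightarrow> \<psi> \<in> Pspace q \<and>
     (\<exists>\<chi>\<in>Pspace q. \<forall>j\<in>{1..q}. msubst (param_subst \<chi>) (\<psi> j) = mu j \<and> msubst (param_subst \<psi>) (\<chi> j) = mu j)"

inductive elementary_step :: "nat \<Rightarrow> 'a vfield \<Rightarrow> 'a :: field_char_0 vfield \<Rightarrow> bool" for q where
  state_change: "S \<in> Sspace q \<Longrightarrow> w' \<in> Sspace q \<Longrightarrow> change_of_coords (flow 1 S) w w'
    \<Longrightarrow> elementary_step q w w'"
| time_rescaling: "T \<in> Tspace q \<Longrightarrow> elementary_step q w ((1 + T) \<cdot>\<^sub>v w)"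
| time_constant: "c \<noteq> 0 \<Longrightarrow> elementary_step q w (mconst c \<cdot>\<^sub>v w)"
| reparametrize: "reparametrization q \<psi> \<Longrightarrow> elementary_step q w (\<lambda>s. msubst (param_subst \<psi>) (w s))"

definition permissible :: "nat \<Rightarrow> 'a vfield \<Rightarrow> 'a :: field_char_0 vfield \<Rightarrow> bool" where
  "permissible q w w' \<longleftrightarrow> (\<exists>u\<in>Sspace q. \<exists>u'\<in>Sspace q.
     remove_rotation w u \<and> (elementary_step q)\<^sup>*\<^sup>* u u' \<and> restore_rotation u' w')"

section \<open>Perturbations and non-degeneracy\<close>

text \<open>\<open>param_subst (\<lambda>_. 0)\<close> sets all parameters to zero.\<close>

definition perturbation :: "nat \<Rightarrow> 'a vfield \<Rightarrow> 'a :: field_char_0 vfield \<Rightarrow> bool" where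
  "perturbation q w v \<longleftrightarrow> (\<exists>S\<in>Sspace q. w = Theta + S) \<and> (\<lambda>s. msubst (param_subst (\<lambda>_. 0)) (w s)) = v"

text \<open>
  \<open>second_level q \<beta>\<close>: \<open>Esum \<beta>\<close> has the form \<open>w\<^sup>(\<^sup>2\<^sup>)\<close>, i.e. \<open>E\<^sup>1\<^sub>1\<close> plus terms \<open>\<beta>\<^sup>0\<^sub>k\<^sub>,\<^sub>m E\<^sup>0\<^sub>k \<mu>\<^sup>m\<close>.
  The 0-based matrix entry \<open>(i, j)\<close> below is \<open>a\<^sub>i\<^sub>+\<^sub>1\<^sub>,\<^sub>j\<^sub>+\<^sub>1\<close>, the coefficient of \<open>E\<^sup>0\<^sub>i \<mu>\<^sub>j\<^sub>+\<^sub>1\<close>.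
\<close>

definition second_level :: "nat \<Rightarrow> 'a :: field_char_0 coeffs \<Rightarrow> bool" where
  "second_level q \<beta> \<longleftrightarrow> \<beta> \<in> admissible q \<and> \<beta> 1 1 0 = 1 \<and>
     (\<forall>k l m. l \<noteq> 0 \<longrightarrow> (k, l, m) \<noteq> (1, 1, 0) \<longrightarrow> \<beta> k l m = 0)"

definition linear_part :: "nat \<Rightarrow> nat \<Rightarrow> 'a coeffs \<Rightarrow> 'a mat" where
  "linear_part q r \<beta> = mat (r + 1) q (\<lambda>(i, j). \<beta> i 0 (Poly_Mapping.single (j + 1) 1))"

definition nondegenerate_of_order :: "nat \<Rightarrow> nat \<Rightarrow> 'a :: field_char_0 vfield \<Rightarrow> bool" where
  "nondegenerate_of_order q r w \<longleftrightarrow> (\<exists>u\<in>Sspace q. \<exists>\<beta>.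
     remove_rotation w u \<and> (elementary_step q)\<^sup>*\<^sup>* u (Esum \<beta>) \<and> second_level q \<beta> \<and>
     (\<exists>k>1. \<beta> k 0 0 \<noteq> 0) \<and> r = (LEAST k. k > 1 \<and> \<beta> k 0 0 \<noteq> 0) \<and>
     vec_space.rank (r + 1) (linear_part q r \<beta>) = r + 1)"

definition nondegenerate :: "nat \<Rightarrow> 'a :: field_char_0 vfield \<Rightarrow> bool" where
  "nondegenerate q w \<longleftrightarrow> (\<exists>r. nondegenerate_of_order q r w)"

section \<open>Infinite level parametric normal form\<close>

definition alpha :: "nat \<Rightarrow> nat \<Rightarrow> nat" where
  "alpha r i = (if i \<le> r + 1 then 2 * (r + 1 - i) else 0)"

definition grade :: "nat \<Rightarrow> nat \<Rightarrow> nat \<Rightarrow> (nat \<Rightarrow>\<^sub>0 nat) \<Rightarrow> nat" where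
  "grade r k l m = 2 * k - l + (\<Sum>j\<in>Poly_Mapping.keys m. alpha r j * Poly_Mapping.lookup m j)"

definition admissible_grade :: "nat \<Rightarrow> nat \<Rightarrow> nat \<Rightarrow> 'a :: zero coeffs set" where
  "admissible_grade q r i = {\<beta> \<in> admissible q. \<forall>k l m. \<beta> k l m \<noteq> 0 \<longrightarrow> grade r k l m = i}"

definition Sgrade :: "nat \<Rightarrow> nat \<Rightarrow> nat \<Rightarrow> 'a :: field_char_0 vfield set" where
  "Sgrade q r i = Esum ` admissible_grade q r i"

definition Tgrade :: "nat \<Rightarrow> nat \<Rightarrow> nat \<Rightarrow> 'a :: comm_ring_1 series set" where
  "Tgrade q r i = Zsum ` admissible_grade q r i"

text \<open>
  The term \<open>\<mu>\<^sup>m\<close> in the \<open>j\<close>-th component of a tuple \<open>P\<close> stands for \<open>\<mu>\<^sup>m \<partial>/\<partial>\<mu>\<^sub>j\<close> and is homogeneous of grade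
  \<open>\<alpha>\<cdot>m - \<alpha>\<^sub>j\<close>. With this convention \<open>(w, P) \<mapsto> D\<^sub>\<mu>(w) P\<close> is additive in the grades, so that the maps
  \<open>d\<^sup>n\<^sup>,\<^sup>k\<close> take values in grade \<open>n\<close>.
\<close>

definition Pgrade :: "nat \<Rightarrow> nat \<Rightarrow> nat \<Rightarrow> (nat \<Rightarrow> 'a :: comm_ring_1 series) set" where
  "Pgrade q r i = {P \<in> Pspace q. \<forall>j n. mcoeff (P j) n \<noteq> 0 \<longrightarrow>
     (\<Sum>p=1..q. alpha r p * Poly_Mapping.lookup n (Param p)) = i + alpha r j}"

definition Agrade :: "nat \<Rightarrow> nat \<Rightarrow> nat \<Rightarrow> ('a :: field_char_0 vfield \<times> (nat \<Rightarrow> 'a series) \<times> 'a series) set" where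
  "Agrade q r i = Sgrade q r i \<times> Pgrade q r i \<times> Tgrade q r i"

text \<open>
  \<open>dmap q ws\<close> is \<open>d\<^sup>n\<^sup>,\<^sup>k\<close> on the list \<open>[Y\<^sub>n, \<dots>, Y\<^sub>n\<^sub>-\<^sub>k\<^sub>+\<^sub>1]\<close>, where \<open>ws i\<close> is the component \<open>w\<^sub>i\<close>, and
  \<open>ddom q r ws k n\<close> is its domain \<open>A\<^sub>n \<times> ker d\<^sup>n\<^sup>-\<^sup>1\<^sup>,\<^sup>k\<^sup>-\<^sup>1\<close>. For \<open>k = 0\<close> the only list is empty and the
  sum is \<open>0\<close>, so the domain for \<open>k = 1\<close> is \<open>A\<^sub>n\<close>.
\<close>

definition dmap :: "nat \<Rightarrow> (nat \<Rightarrow> 'a vfield)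
    \<Rightarrow> ('a vfield \<times> (nat \<Rightarrow> 'a series) \<times> 'a series) list \<Rightarrow> 'a :: field_char_0 vfield" where
  "dmap q ws Ys = (\<Sum>i<length Ys. act q (Ys ! i) (ws i))"

fun ddom :: "nat \<Rightarrow> nat \<Rightarrow> (nat \<Rightarrow> 'a vfield) \<Rightarrow> nat \<Rightarrow> nat
    \<Rightarrow> ('a :: field_char_0 vfield \<times> (nat \<Rightarrow> 'a series) \<times> 'a series) list set" where
  "ddom q r ws 0 n = {[]}"
| "ddom q r ws (Suc k) n =
     {V # Ys | V Ys. V \<in> Agrade q r n \<and> Ys \<in> ddom q r ws k (n - 1) \<and> dmap q ws Ys = 0}"

definition dimage :: "nat \<Rightarrow> nat \<Rightarrow> (nat \<Rightarrow> 'a vfield) \<Rightarrow> nat \<Rightarrow> nat \<Rightarrow> 'a :: field_char_0 vfield set" where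
  "dimage q r ws n k = dmap q ws ` ddom q r ws (min k n) n"

definition complement_in :: "'a vfield set \<Rightarrow> 'a vfield set \<Rightarrow> 'a :: field_char_0 vfield set \<Rightarrow> bool" where
  "complement_in V B C \<longleftrightarrow> Modules.module.subspace (\<lambda>c w. mconst c \<cdot>\<^sub>v w) C \<and>
     B \<inter> C = {0} \<and> {b + c | b c. b \<in> B \<and> c \<in> C} = V"

text \<open>\<open>w\<close> is the vector field with \<open>\<Theta>\<^sup>0\<^sub>0\<close> removed, and \<open>C\<close> is the normal form style.\<close>

definition infinite_level_nf :: "nat \<Rightarrow> nat \<Rightarrow> 'a :: field_char_0 vfield \<Rightarrow> bool" where
  "infinite_level_nf q r w \<longleftrightarrow> (\<exists>ws C.
     ws 0 = 0 \<and> (\<forall>i\<ge>1. ws i \<in> Sgrade q r i) \<and> w = (\<lambda>s. formal_sum (\<lambda>i. ws i s)) \<and>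
     (\<forall>n\<ge>1. \<forall>k\<ge>1. complement_in (Sgrade q r n) (dimage q r ws n k) (C n k)) \<and>
     (\<forall>n\<ge>1. ws n \<in> C n n))"

section \<open>Cylindrical coordinates\<close>

text \<open>
  In cylindrical coordinates the state variables \<open>Y\<close> and \<open>Z\<close> of the ring play the roles of \<open>\<rho>\<close> and
  \<open>\<theta>\<close>; sine and cosine are the formal series in \<open>\<theta>\<close>.
\<close>

definition rho :: "'a :: comm_ring_1 series" where "rho = mvar (State Y)"
definition theta :: "'a :: comm_ring_1 series" where "theta = mvar (State Z)"

definition sin_theta :: "'a :: field_char_0 series" where
  "sin_theta = formal_sum (\<lambda>n. mconst (fps_nth (fps_sin 1) n) * theta ^ n)"

definition cos_theta :: "'a :: field_char_0 series" where
  "cos_theta = formal_sum (\<lambda>n. mconst (fps_nth (fps_cos 1) n) * theta ^ n)"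

definition cylindrical :: "'a :: field_char_0 vfield" where
  "cylindrical s = (case s of X \<Rightarrow> xv | Y \<Rightarrow> rho * sin_theta | Z \<Rightarrow> rho * cos_theta)"

definition cylindrical_system :: "'a :: field_char_0 series \<Rightarrow> 'a vfield" where
  "cylindrical_system g s = (case s of X \<Rightarrow> xv * g | Y \<Rightarrow> mconst (1 / 2) * rho * g | Z \<Rightarrow> 1)"

end

theory Submission
  imports Defs
begin

text \<open>
  Every field in \<open>\<S>\<close> is a multiple \<open>g E\<close> of \<open>E\<close>, where \<open>g\<close> is a power series in \<open>x\<close>, \<open>R = y\<^sup>2 + z\<^sup>2\<close> and the
  parameters, and \<open>E x = x\<close>, \<open>E R = R\<close>. So the classification of the fields is one of the series \<open>g\<close>
  (\<open>Sspace_eq\<close>). Non-degeneracy provides \<open>g = x + h(R, \<mu>)\<close>; the theorem asserts that \<open>h\<close> can be turned into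
  \<open>\<beta>\<^sub>1 R + \<beta>\<^sub>r R\<^sup>r + \<Sum>\<^sub>k R\<^sup>k \<mu>\<^sub>k\<^sub>+\<^sub>1\<close> with \<open>k \<le> r\<close>.

  The flow of \<open>f E\<close> preserves the orbits of \<open>E\<close>: it multiplies \<open>x\<close> and \<open>R\<close> by a common unit \<open>U\<close>, and \<open>y\<close> and \<open>z\<close>
  by its square root. The conjugated field is again a multiple of \<open>E\<close>, and a time rescaling multiplies its
  coefficient by an arbitrary unit. Hence only the zero set \<open>x = - h\<close> of the coefficient matters, and
  the pair of steps replaces \<open>h\<close> by \<open>h(R U, \<mu>) / U\<close> (\<open>scaling_step\<close>). Here \<open>\<beta>\<^sub>1 R\<close> is invariant, whereas
  \<open>\<beta>\<^sub>r R\<^sup>r\<close> becomes \<open>\<beta>\<^sub>r R\<^sup>r U\<^sup>r\<^sup>-\<^sup>1\<close>. Since \<open>(r - 1) \<beta>\<^sub>r \<noteq> 0\<close>, the unit can be chosen, coefficient by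
  coefficient, such that \<open>h(R U, \<mu>) / U\<close> contains no power \<open>R\<^sup>k\<close> with \<open>k > r\<close> (\<open>exists_scaling\<close>). The order of
  the recursion comes from the weights \<open>1\<close> of \<open>R\<close> and \<open>r + 1\<close> of each \<open>\<mu>\<^sub>j\<close>: with them all terms of \<open>h\<close> besides
  \<open>\<beta>\<^sub>1 R\<close> and \<open>\<beta>\<^sub>r R\<^sup>r\<close> are of weight greater than \<open>r\<close>.

  What remains is \<open>\<beta>\<^sub>1 R + \<beta>\<^sub>r R\<^sup>r + \<Sum>\<^sub>k R\<^sup>k p\<^sub>k(\<mu>)\<close> with \<open>k \<le> r\<close> and \<open>p\<^sub>k(0) = 0\<close>. Since \<open>U = 1 + O(R)\<close>, the linear
  parts of the \<open>p\<^sub>k\<close> arise from the rows of the given matrix by a unipotent triangular transformation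
  (\<open>scaled_coefficients\<close>), so they are linearly independent. After an invertible linear change of the
  parameters they are \<open>\<mu>\<^sub>1, \<dots>, \<mu>\<^sub>r\<^sub>+\<^sub>1\<close>, and the inverse of a map tangent to the identity removes the
  terms of higher order (\<open>parameters_from_coefficients\<close>).

  For the infinite level, it is enough that no nonzero component \<open>w\<^sub>n\<close> lies in the image of
  \<open>d\<^sup>n\<^sup>,\<^sup>n\<close>, because then a complement can be chosen to contain it (\<open>infinite_level_nfI\<close>). The components have
  the grades \<open>1\<close>, \<open>2\<close> and \<open>2 r\<close>. In grades up to \<open>2 r\<close> the maps involve only \<open>w\<^sub>1 = x E\<close> and \<open>w\<^sub>2 = \<beta>\<^sub>1 R E\<close>, and
  each element of \<open>A\<^sub>i\<close> multiplies both of them by one and the same series. The kernel conditions make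
  these series vanish, except for that of \<open>Y\<^sub>n\<^sub>-\<^sub>1\<close>, which acts on \<open>w\<^sub>1\<close>. So the image consists of
  multiples of \<open>x E\<close>, and it is zero for \<open>n = 1\<close>, while \<open>\<beta>\<^sub>1 R\<close> and \<open>\<beta>\<^sub>r R\<^sup>r\<close> do not contain \<open>x\<close> (\<open>normal_form_image\<close>).

  The rotation \<open>\<Theta>\<close> commutes with all of \<open>\<S>\<close>, so removing and restoring it amounts to subtracting and adding
  it. Identities between substitutions, flows and derivations are checked on the variables and extended
  to all series by multiplicativity and continuity.
\<close>

section \<open>Coefficients and monomials\<close>

lemma mcoeff_simps [simp]:
  "mcoeff 0 n = 0" "mcoeff (f + g) n = mcoeff f n + mcoeff g n"
  "mcoeff (f - g) n = mcoeff f n - mcoeff g n" "mcoeff (- f) n = - mcoeff f n"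
  by (simp_all add: zero_mfps.rep_eq plus_mfps.rep_eq minus_mfps.rep_eq uminus_mfps.rep_eq)

lemma mcoeff_sum [simp]: "mcoeff (\<Sum>i\<in>I. F i) n = (\<Sum>i\<in>I. mcoeff (F i) n)"
  by (induction I rule: infinite_finite_induct) auto

lemma mcoeff_mult: "mcoeff (f * g) n = (\<Sum>(a, b) \<in> {(a, b). a + b = n}. mcoeff f a * mcoeff g b)"
  by (simp add: times_mfps.rep_eq)

definition monomial :: "('v \<Rightarrow>\<^sub>0 nat) \<Rightarrow> ('v, 'a :: zero_neq_one) mfps" where
  "monomial n = Abs_mfps (\<lambda>k. if k = n then 1 else 0)"

lemma mcoeff_monomial: "mcoeff (monomial n) k = (if k = n then 1 else 0)"
  by (auto simp: monomial_def Abs_mfps_inverse)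

lemma mvar_eq_monomial: "mvar v = monomial (Poly_Mapping.single v 1)"
  by (rule mfps_eqI) (simp add: mcoeff_monomial mvar.rep_eq)

lemma one_eq_monomial: "(1 :: ('v, 'a :: comm_ring_1) mfps) = monomial 0"
  by (rule mfps_eqI) (simp add: mcoeff_monomial one_mfps.rep_eq)

lemma mcoeff_monomial_mult:
  "mcoeff (monomial a * f) n = (if \<exists>b. n = a + b then mcoeff f (n - a) else 0)"
  for f :: "('v, 'a :: comm_ring_1) mfps"
proof -
  let ?g = "\<lambda>(c, d). mcoeff (monomial a :: ('v, 'a) mfps) c * mcoeff f d"
  have "mcoeff (monomial a * f) n = sum ?g {(c, d). c + d = n}"
    by (simp add: mcoeff_mult)
  also have "\<dots> = sum ?g {(c, d). c + d = n \<and> c = a}"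
    by (rule sum.mono_neutral_right)
       (auto simp: finite_decompositions mcoeff_monomial split: if_splits)
  also have "\<dots> = (if \<exists>b. n = a + b then mcoeff f (n - a) else 0)"
  proof (cases "\<exists>b. n = a + b")
    case True
    then have "{(c, d). c + d = n \<and> c = a} = {(a, n - a)}"
      by auto
    with True show ?thesis
      by (simp add: mcoeff_monomial)
  next
    case False
    then have "{(c, d). c + d = n \<and> c = a} = {}"
      by auto
    then have "sum ?g {(c, d). c + d = n \<and> c = a} = 0"
      by (simp only: sum.empty)
    with False show ?thesis
      by simp
  qed
  finally show ?thesis .
qed

lemma mcoeff_monomial_mult_shift [simp]:
  "mcoeff (monomial a * f) (a + b) = mcoeff f b" "mcoeff (monomial a * f) (b + a) = mcoeff f b"
  for f :: "('v, 'a :: comm_ring_1) mfps"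
  by (auto simp: mcoeff_monomial_mult add.commute)

lemma monomial_mult: "monomial a * monomial b = (monomial (a + b) :: ('v, 'a :: comm_ring_1) mfps)"
  by (rule mfps_eqI) (auto simp: mcoeff_monomial_mult mcoeff_monomial)

lemma monomial_mult_cancel: "monomial a * f = monomial a * g \<Longrightarrow> f = g"
  for f :: "('v, 'a :: comm_ring_1) mfps"
  by (metis mcoeff_monomial_mult_shift(1) mfps_eqI)

lemma mvar_mult_cancel: "mvar v * f = mvar v * g \<Longrightarrow> f = g"
  for f :: "('v, 'a :: comm_ring_1) mfps"
  unfolding mvar_eq_monomial by (rule monomial_mult_cancel)

lemma monomial_single: "monomial (Poly_Mapping.single v k) = (mvar v ^ k :: ('v, 'a :: comm_ring_1) mfps)"
proof (induction k)
  case (Suc k)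
  have "Poly_Mapping.single v (Suc k) = Poly_Mapping.single v 1 + Poly_Mapping.single v k"
    by (simp flip: single_add)
  then show ?case
    by (simp add: Suc[symmetric] mvar_eq_monomial[symmetric] monomial_mult[symmetric])
       (simp add: mvar_eq_monomial)
qed (simp add: one_eq_monomial)

lemma monomial_sum: "finite I \<Longrightarrow> monomial (\<Sum>i\<in>I. F i) = (\<Prod>i\<in>I. monomial (F i) :: ('v, 'a :: comm_ring_1) mfps)"
  by (induction I rule: finite_induct) (auto simp: one_eq_monomial simp flip: monomial_mult)

lemma mcoeff_mconst: "mcoeff (mconst c) n = (if n = 0 then c else 0)"
  by (simp add: mconst.rep_eq)

lemma mcoeff_mconst_mult [simp]: "mcoeff (mconst c * f) n = c * mcoeff f n"
  for f :: "('v, 'a :: comm_ring_1) mfps"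
proof -
  let ?g = "\<lambda>(a, b). mcoeff (mconst c :: ('v, 'a) mfps) a * mcoeff f b"
  have "mcoeff (mconst c * f) n = sum ?g {(a, b). a + b = n}"
    by (simp add: mcoeff_mult)
  also have "\<dots> = sum ?g {(0, n)}"
    by (rule sum.mono_neutral_right) (auto simp: finite_decompositions mcoeff_mconst split: if_splits)
  finally show ?thesis
    by (simp add: mcoeff_mconst)
qed

lemma mconst_simps:
  "mconst 0 = (0 :: ('v, 'a :: comm_ring_1) mfps)" "mconst 1 = (1 :: ('v, 'a) mfps)"
  "mconst (c + d) = (mconst c + mconst d :: ('v, 'a) mfps)"
  "mconst (c - d) = (mconst c - mconst d :: ('v, 'a) mfps)"
  "mconst (- c) = (- mconst c :: ('v, 'a) mfps)"
  by (transfer, simp add: fun_eq_iff)+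

lemma mconst_mult: "mconst (c * d) = (mconst c * mconst d :: ('v, 'a :: comm_ring_1) mfps)"
  by (rule mfps_eqI) (simp add: mcoeff_mconst)

lemma mconst_of_nat: "mconst (of_nat k) = (of_nat k :: ('v, 'a :: comm_ring_1) mfps)"
  by (induction k) (simp_all add: mconst_simps)

lemma mconst_mult_eq_0_iff: "mconst c * f = 0 \<longleftrightarrow> c = 0 \<or> f = 0"
  for f :: "('v, 'a :: idom) mfps"
  by (metis mcoeff_mconst_mult mcoeff_simps(1) mfps_eqI mult_eq_0_iff)

text \<open>
  Induction on the degree, peeling off one variable at a time. It reduces multiplicative identities to
  the single variables.
\<close>

lemma monomial_induct [case_names zero add]:
  fixes n :: "'v \<Rightarrow>\<^sub>0 nat"
  assumes "P 0" "\<And>n v. P n \<Longrightarrow> P (Poly_Mapping.single v 1 + n)"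
  shows "P n"
proof (induction "\<Sum>v\<in>Poly_Mapping.keys n. Poly_Mapping.lookup n v" arbitrary: n rule: less_induct)
  case less
  show ?case
  proof (cases "n = 0")
    case False
    then obtain v where v: "v \<in> Poly_Mapping.keys n"
      by fastforce
    define m where "m = n - Poly_Mapping.single v 1"
    have lm: "Poly_Mapping.lookup m u = Poly_Mapping.lookup n u - (if u = v then 1 else 0)" for u
      by (auto simp: m_def lookup_minus lookup_single)
    have n: "n = Poly_Mapping.single v 1 + m"
      using v by (intro poly_mapping_eqI) (auto simp: lookup_add lm lookup_single in_keys_iff when_def)
    have "(\<Sum>u\<in>Poly_Mapping.keys m. Poly_Mapping.lookup m u) \<le> (\<Sum>u\<in>Poly_Mapping.keys n. Poly_Mapping.lookup m u)"
      by (rule sum_mono2) (auto simp: in_keys_iff lm split: if_splits)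
    also have "\<dots> < (\<Sum>u\<in>Poly_Mapping.keys n. Poly_Mapping.lookup n u)"
      by (rule sum_strict_mono_ex1) (use v in \<open>auto simp: lm in_keys_iff\<close>)
    finally show ?thesis
      using less assms(2) n by metis
  qed (simp add: assms(1))
qed

lemma pdiff_coeff: "mcoeff (pdiff v f) n
    = of_nat (Poly_Mapping.lookup n v + 1) * mcoeff f (n + Poly_Mapping.single v 1)"
  by (simp add: pdiff.rep_eq)

section \<open>Supports and weights\<close>

definition supp :: "('v, 'a :: zero) mfps \<Rightarrow> ('v \<Rightarrow>\<^sub>0 nat) set" where
  "supp f = {n. mcoeff f n \<noteq> 0}"

lemma supp_subsetI: "(\<And>n. mcoeff f n \<noteq> 0 \<Longrightarrow> n \<in> M) \<Longrightarrow> supp f \<subseteq> M"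
  by (auto simp: supp_def)

lemma supp_subsetD: "supp f \<subseteq> M \<Longrightarrow> n \<notin> M \<Longrightarrow> mcoeff f n = 0"
  by (auto simp: supp_def)

lemma supp_0 [simp]: "supp (0 :: ('v, 'a :: comm_ring_1) mfps) \<subseteq> M"
  by (auto simp: supp_def)

lemma supp_add: "supp f \<subseteq> M \<Longrightarrow> supp g \<subseteq> M \<Longrightarrow> supp (f + g) \<subseteq> M"
  for f g :: "('v, 'a :: comm_ring_1) mfps"
  unfolding supp_def by (force simp: subset_iff)

lemma supp_uminus: "supp f \<subseteq> M \<Longrightarrow> supp (- f) \<subseteq> M"
  for f :: "('v, 'a :: comm_ring_1) mfps"
  by (auto simp: supp_def)

lemma supp_diff: "supp f \<subseteq> M \<Longrightarrow> supp g \<subseteq> M \<Longrightarrow> supp (f - g) \<subseteq> M"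
  for f g :: "('v, 'a :: comm_ring_1) mfps"
  using supp_add[of f M "- g"] supp_uminus[of g M] by simp

lemma supp_sum: "(\<And>i. i \<in> I \<Longrightarrow> supp (F i) \<subseteq> M) \<Longrightarrow> supp (\<Sum>i\<in>I. F i) \<subseteq> M"
  for F :: "'i \<Rightarrow> ('v, 'a :: comm_ring_1) mfps"
  by (induction I rule: infinite_finite_induct) (simp_all add: supp_add)

lemma supp_mconst_mult: "supp f \<subseteq> M \<Longrightarrow> supp (mconst c * f) \<subseteq> M"
  for f :: "('v, 'a :: comm_ring_1) mfps"
  by (auto simp: supp_def)

lemma supp_mult:
  fixes f g :: "('v, 'a :: comm_ring_1) mfps"
  assumes "supp f \<subseteq> M" "supp g \<subseteq> N" "\<And>a b. a \<in> M \<Longrightarrow> b \<in> N \<Longrightarrow> a + b \<in> K"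
  shows "supp (f * g) \<subseteq> K"
proof (rule supp_subsetI)
  fix n assume "mcoeff (f * g) n \<noteq> 0"
  then obtain a b where "a + b = n" "mcoeff f a \<noteq> 0" "mcoeff g b \<noteq> 0"
    unfolding mcoeff_mult by (auto elim!: sum.not_neutral_contains_not_neutral dest: mult_not_zero)
  then show "n \<in> K"
    using assms by (auto simp: supp_def)
qed

definition wt :: "('v \<Rightarrow> nat) \<Rightarrow> ('v \<Rightarrow>\<^sub>0 nat) \<Rightarrow> nat" where
  "wt c n = (\<Sum>v\<in>Poly_Mapping.keys n. c v * Poly_Mapping.lookup n v)"

lemma wt_superset:
  "finite A \<Longrightarrow> Poly_Mapping.keys n \<subseteq> A \<Longrightarrow> wt c n = (\<Sum>v\<in>A. c v * Poly_Mapping.lookup n v)"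
  unfolding wt_def by (rule sum.mono_neutral_left) (auto simp: in_keys_iff)

lemma wt_0 [simp]: "wt c 0 = 0"
  by (simp add: wt_def)

lemma wt_single [simp]: "wt c (Poly_Mapping.single v k) = c v * k"
  by (simp add: wt_def)

lemma wt_add [simp]: "wt c (a + b) = wt c a + wt c b"
proof -
  let ?A = "Poly_Mapping.keys a \<union> Poly_Mapping.keys b"
  have "wt c x = (\<Sum>v\<in>?A. c v * Poly_Mapping.lookup x v)" if "x \<in> {a, b, a + b}" for x
    using that keys_add[of a b] by (intro wt_superset) auto
  then show ?thesis
    by (simp add: lookup_add algebra_simps sum.distrib)
qed

text \<open>
  Every grading and filtration used below comes from an additive weight of monomials: the total
  degree, the exponent of \<open>R\<close>, the weight that orders the recursion, and the grade \<open>\<delta>\<^sub>\<alpha>\<close>.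
\<close>

definition ge_wt :: "('v \<Rightarrow> nat) \<Rightarrow> nat \<Rightarrow> ('v \<Rightarrow>\<^sub>0 nat) set" where
  "ge_wt c d = {n. d \<le> wt c n}"

definition eq_wt :: "('v \<Rightarrow> nat) \<Rightarrow> nat \<Rightarrow> ('v \<Rightarrow>\<^sub>0 nat) set" where
  "eq_wt c d = {n. wt c n = d}"

definition over :: "'v set \<Rightarrow> ('v \<Rightarrow>\<^sub>0 nat) set" where
  "over A = {n. Poly_Mapping.keys n \<subseteq> A}"

definition deg_wt :: "'v \<Rightarrow> nat" where
  [simp]: "deg_wt v = 1"

abbreviation mdeg :: "('v \<Rightarrow>\<^sub>0 nat) \<Rightarrow> nat" where
  "mdeg \<equiv> wt deg_wt"

abbreviation ge_deg :: "nat \<Rightarrow> ('v \<Rightarrow>\<^sub>0 nat) set" where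
  "ge_deg \<equiv> ge_wt deg_wt"

lemma ge_wt_0 [simp]: "ge_wt c 0 = UNIV"
  by (simp add: ge_wt_def)

lemma ge_wt_mono: "supp f \<subseteq> ge_wt c d \<Longrightarrow> e \<le> d \<Longrightarrow> supp f \<subseteq> ge_wt c e"
  by (auto simp: ge_wt_def)

lemma supp_mult_ge:
  "supp f \<subseteq> ge_wt c d \<Longrightarrow> supp g \<subseteq> ge_wt c e \<Longrightarrow> supp (f * g) \<subseteq> ge_wt c (d + e)"
  for f g :: "('v, 'a :: comm_ring_1) mfps"
  by (rule supp_mult) (auto simp: ge_wt_def)

lemma supp_mult_ge_left:
  "supp g \<subseteq> ge_wt c e \<Longrightarrow> supp (f * g) \<subseteq> ge_wt c e"
  for f g :: "('v, 'a :: comm_ring_1) mfps"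
  using supp_mult_ge[of f c 0 g e] by simp

lemma supp_mult_eq:
  "supp f \<subseteq> eq_wt c d \<Longrightarrow> supp g \<subseteq> eq_wt c e \<Longrightarrow> supp (f * g) \<subseteq> eq_wt c (d + e)"
  for f g :: "('v, 'a :: comm_ring_1) mfps"
  by (rule supp_mult) (auto simp: eq_wt_def)

lemma supp_mult_over:
  "supp f \<subseteq> over A \<Longrightarrow> supp g \<subseteq> over A \<Longrightarrow> supp (f * g) \<subseteq> over A"
  for f g :: "('v, 'a :: comm_ring_1) mfps"
  by (rule supp_mult) (use keys_add in \<open>fastforce simp: over_def\<close>)+

lemma supp_one_over [simp]: "supp (1 :: ('v, 'a :: comm_ring_1) mfps) \<subseteq> over A"
  by (auto simp: supp_def one_eq_monomial mcoeff_monomial over_def split: if_splits)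

lemma supp_mconst_over [simp]: "supp (mconst c :: ('v, 'a :: comm_ring_1) mfps) \<subseteq> over A"
  by (auto simp: supp_def mcoeff_mconst over_def split: if_splits)

lemma supp_monomial: "n \<in> M \<Longrightarrow> supp (monomial n) \<subseteq> M"
  by (auto simp: supp_def mcoeff_monomial split: if_splits)

lemma supp_mvar_over: "v \<in> A \<Longrightarrow> supp (mvar v) \<subseteq> over A"
  unfolding mvar_eq_monomial by (rule supp_monomial) (simp add: over_def)

lemma supp_mvar_ge: "d \<le> c v \<Longrightarrow> supp (mvar v) \<subseteq> ge_wt c d"
  unfolding mvar_eq_monomial by (rule supp_monomial) (simp add: ge_wt_def)

lemma supp_mvar_eq: "d = c v \<Longrightarrow> supp (mvar v) \<subseteq> eq_wt c d"
  unfolding mvar_eq_monomial by (rule supp_monomial) (simp add: eq_wt_def)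

lemma supp_power_over: "supp f \<subseteq> over A \<Longrightarrow> supp (f ^ k) \<subseteq> over A"
  for f :: "('v, 'a :: comm_ring_1) mfps"
  by (induction k) (simp_all add: supp_mult_over)

lemma supp_prod_over: "(\<And>i. i \<in> I \<Longrightarrow> supp (F i) \<subseteq> over A) \<Longrightarrow> supp (\<Prod>i\<in>I. F i) \<subseteq> over A"
  for F :: "'i \<Rightarrow> ('v, 'a :: comm_ring_1) mfps"
  by (induction I rule: infinite_finite_induct) (simp_all add: supp_mult_over)

lemma supp_power_ge: "supp f \<subseteq> ge_wt c d \<Longrightarrow> supp (f ^ k) \<subseteq> ge_wt c (k * d)"
  for f :: "('v, 'a :: comm_ring_1) mfps"
  by (induction k) (simp_all add: supp_mult_ge)

lemma supp_power_eq: "supp f \<subseteq> eq_wt c d \<Longrightarrow> supp (f ^ k) \<subseteq> eq_wt c (k * d)"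
  for f :: "('v, 'a :: comm_ring_1) mfps"
  by (induction k) (simp_all add: one_eq_monomial supp_mult_eq supp_monomial eq_wt_def[of c 0])

lemma keys_subset_add: "Poly_Mapping.keys a \<subseteq> Poly_Mapping.keys (a + b :: 'v \<Rightarrow>\<^sub>0 nat)"
proof
  fix v assume "v \<in> Poly_Mapping.keys a"
  then have "Poly_Mapping.lookup a v \<noteq> 0"
    by (simp add: in_keys_iff)
  then have "Poly_Mapping.lookup (a + b) v \<noteq> 0"
    unfolding lookup_add by simp
  then show "v \<in> Poly_Mapping.keys (a + b)"
    by (simp add: in_keys_iff)
qed

lemma mcoeff_pdiff_neq_0D: "mcoeff (pdiff v f) n \<noteq> 0 \<Longrightarrow> n + Poly_Mapping.single v 1 \<in> supp f"
  for f :: "('v, 'a :: comm_ring_1) mfps"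
  unfolding supp_def pdiff_coeff by (auto dest: mult_not_zero)

lemma supp_pdiff:
  fixes f :: "('v, 'a :: comm_ring_1) mfps"
  assumes "supp f \<subseteq> M" "\<And>n. n + Poly_Mapping.single v 1 \<in> M \<Longrightarrow> n \<in> K"
  shows "supp (pdiff v f) \<subseteq> K"
proof (rule supp_subsetI)
  fix n assume "mcoeff (pdiff v f) n \<noteq> 0"
  from subsetD[OF assms(1) mcoeff_pdiff_neq_0D[OF this]] show "n \<in> K"
    by (rule assms(2))
qed

lemma supp_pdiff_over: "supp f \<subseteq> over A \<Longrightarrow> supp (pdiff v f) \<subseteq> over A"
  for f :: "('v, 'a :: comm_ring_1) mfps"
  by (erule supp_pdiff) (unfold over_def mem_Collect_eq, rule subset_trans[OF keys_subset_add])

lemma supp_pdiff_ge: "supp f \<subseteq> ge_wt c d \<Longrightarrow> supp (pdiff v f) \<subseteq> ge_wt c (d - c v)"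
  for f :: "('v, 'a :: comm_ring_1) mfps"
  by (erule supp_pdiff) (auto simp: ge_wt_def)

lemma mdeg_eq_0_iff: "mdeg n = 0 \<longleftrightarrow> n = 0"
  by (auto simp: wt_def) (metis all_not_in_conv in_keys_iff keys_eq_empty)

lemma mdeg_ge_1_iff: "n \<in> ge_deg (Suc 0) \<longleftrightarrow> n \<noteq> 0"
  using mdeg_eq_0_iff[of n] by (auto simp: ge_wt_def Suc_le_eq)

lemma supp_ge_deg_1_iff: "supp f \<subseteq> ge_deg (Suc 0) \<longleftrightarrow> mcoeff f 0 = 0"
  for f :: "('v, 'a :: comm_ring_1) mfps"
proof -
  have "ge_deg (Suc 0) = - {0 :: 'v \<Rightarrow>\<^sub>0 nat}"
    using mdeg_ge_1_iff by auto
  then show ?thesis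
    by (auto simp: supp_def)
qed

lemma mcoeff_mult_0: "mcoeff (f * g) 0 = mcoeff f 0 * mcoeff g 0"
  for f g :: "('v, 'a :: comm_ring_1) mfps"
proof -
  have *: "a = 0" if "a + b = 0" for a b :: "'v \<Rightarrow>\<^sub>0 nat"
    using that mdeg_eq_0_iff[of a] wt_add[of deg_wt a b] by simp
  then have "a + b = 0 \<longleftrightarrow> a = 0 \<and> b = 0" for a b :: "'v \<Rightarrow>\<^sub>0 nat"
    by (metis add.commute add_0)
  then have "{(a, b). a + b = (0 :: 'v \<Rightarrow>\<^sub>0 nat)} = {(0, 0)}"
    by simp
  then show ?thesis
    by (simp add: mcoeff_mult)
qed

lemma finite_bounded_monomials:
  assumes "finite A"
  shows "finite {n \<in> over A. mdeg n \<le> (d :: nat)}"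
proof -
  let ?F = "{f. \<forall>v. (v \<in> A \<longrightarrow> f v \<in> {..d}) \<and> (v \<notin> A \<longrightarrow> f v = (0 :: nat))}"
  have "finite (Poly_Mapping.lookup -` ?F :: ('a \<Rightarrow>\<^sub>0 nat) set)"
    by (intro finite_vimageI finite_set_of_finite_funs assms) (auto intro: injI)
  moreover have "Poly_Mapping.lookup n v \<le> mdeg n" for n :: "'a \<Rightarrow>\<^sub>0 nat" and v
    using member_le_sum[of v "Poly_Mapping.keys n" "Poly_Mapping.lookup n"]
    by (cases "v \<in> Poly_Mapping.keys n") (auto simp: wt_def in_keys_iff)
  then have "{n \<in> over A. mdeg n \<le> d} \<subseteq> Poly_Mapping.lookup -` ?F"
    by (auto simp: over_def in_keys_iff intro: le_trans)
  ultimately show ?thesis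
    by (rule rev_finite_subset)
qed

section \<open>Locally finite sums and continuous linear maps\<close>

definition locally_finite :: "('i \<Rightarrow> ('v, 'a :: zero) mfps) \<Rightarrow> bool" where
  "locally_finite F \<longleftrightarrow> (\<forall>n. finite {i. mcoeff (F i) n \<noteq> 0})"

lemma mcoeff_formal_sum: "mcoeff (formal_sum F) n = Sum_any (\<lambda>i. mcoeff (F i) n)"
  by (simp add: formal_sum.rep_eq)

lemma mcoeff_formal_sum_superset:
  assumes "finite I" "\<And>i. i \<notin> I \<Longrightarrow> mcoeff (F i) n = 0"
  shows "mcoeff (formal_sum F) n = (\<Sum>i\<in>I. mcoeff (F i) n)"
  unfolding mcoeff_formal_sum by (rule Sum_any.expand_superset) (use assms in auto)

lemma formal_sum_finite:
  assumes "finite I" "\<And>i. i \<notin> I \<Longrightarrow> F i = 0"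
  shows "formal_sum F = (\<Sum>i\<in>I. F i)"
  by (rule mfps_eqI) (use assms in \<open>simp add: mcoeff_formal_sum_superset\<close>)

lemma supp_formal_sum: "(\<And>i. supp (F i) \<subseteq> M) \<Longrightarrow> supp (formal_sum F) \<subseteq> M"
  by (rule supp_subsetI) (auto simp: mcoeff_formal_sum supp_def elim!: Sum_any.not_neutral_obtains_not_neutral)

lemma locally_finite_deg:
  fixes F :: "nat \<Rightarrow> ('v, 'a :: comm_ring_1) mfps"
  assumes "\<And>k. supp (F k) \<subseteq> ge_deg k"
  shows "locally_finite F"
  unfolding locally_finite_def
proof
  fix n
  have "{k. mcoeff (F k) n \<noteq> 0} \<subseteq> {..mdeg n}"
    using assms by (force simp: supp_def ge_wt_def)
  then show "finite {k. mcoeff (F k) n \<noteq> 0}"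
    by (rule finite_subset) simp
qed

lemma formal_sum_Suc:
  fixes F :: "nat \<Rightarrow> ('v, 'a :: comm_ring_1) mfps"
  assumes "locally_finite F"
  shows "formal_sum F = F 0 + formal_sum (\<lambda>k. F (Suc k))"
proof (rule mfps_eqI)
  fix n
  have "finite {k. mcoeff (F k) n \<noteq> 0}"
    using assms by (simp add: locally_finite_def)
  then obtain N where N: "\<And>k. mcoeff (F k) n \<noteq> 0 \<Longrightarrow> k \<le> N"
    by (auto simp: finite_nat_set_iff_bounded_le)
  have "mcoeff (formal_sum F) n = (\<Sum>k\<le>Suc N. mcoeff (F k) n)"
    by (rule mcoeff_formal_sum_superset) (use N in force)+
  also have "\<dots> = mcoeff (F 0) n + (\<Sum>k\<le>N. mcoeff (F (Suc k)) n)"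
    by (rule sum.atMost_Suc_shift)
  also have "(\<Sum>k\<le>N. mcoeff (F (Suc k)) n) = mcoeff (formal_sum (\<lambda>k. F (Suc k))) n"
    by (rule mcoeff_formal_sum_superset[symmetric]) (use N in force)+
  finally show "mcoeff (formal_sum F) n = mcoeff (F 0 + formal_sum (\<lambda>k. F (Suc k))) n"
    by simp
qed

text \<open>
  Continuity refers to the product topology with discrete coefficients: each coefficient of the value
  depends on finitely many coefficients of the argument. This is what is needed to interchange \<open>L\<close>
  with infinite formal sums.
\<close>

definition cont_linear :: "(('v, 'a :: comm_ring_1) mfps \<Rightarrow> ('w, 'a) mfps) \<Rightarrow> bool" where
  "cont_linear L \<longleftrightarrow> (\<forall>f g. L (f + g) = L f + L g) \<and> (\<forall>c f. L (mconst c * f) = mconst c * L f) \<and>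
     (\<forall>p. \<exists>N. finite N \<and> (\<forall>f. (\<forall>n\<in>N. mcoeff f n = 0) \<longrightarrow> mcoeff (L f) p = 0))"

lemma cont_linearI:
  assumes "\<And>f g. L (f + g) = L f + L g" "\<And>c f. L (mconst c * f) = mconst c * L f"
    and "\<And>p. finite (N p)" "\<And>p f. (\<And>n. n \<in> N p \<Longrightarrow> mcoeff f n = 0) \<Longrightarrow> mcoeff (L f) p = 0"
  shows "cont_linear L"
  unfolding cont_linear_def using assms by (metis (no_types, lifting))

context
  fixes L :: "('v, 'a :: comm_ring_1) mfps \<Rightarrow> ('w, 'a) mfps"
  assumes L: "cont_linear L"
begin

lemma cont_linear_add: "L (f + g) = L f + L g"
  and cont_linear_mconst: "L (mconst c * f) = mconst c * L f"
  using L by (simp_all add: cont_linear_def)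

lemma cont_linear_0: "L 0 = 0"
  using cont_linear_add[of 0 0] by simp

lemma cont_linear_uminus: "L (- f) = - L f"
  using cont_linear_add[of f "- f"] by (simp add: cont_linear_0 eq_neg_iff_add_eq_0 add.commute)

lemma cont_linear_diff: "L (f - g) = L f - L g"
  using cont_linear_add[of f "- g"] by (simp add: cont_linear_uminus)

lemma cont_linear_sum: "L (\<Sum>i\<in>I. F i) = (\<Sum>i\<in>I. L (F i))"
  by (induction I rule: infinite_finite_induct) (simp_all add: cont_linear_0 cont_linear_add)

lemma cont_linear_formal_sum:
  assumes F: "locally_finite F"
  shows "locally_finite (\<lambda>i. L (F i))" and "L (formal_sum F) = formal_sum (\<lambda>i. L (F i))"
proof -
  have *: "finite {i. mcoeff (L (F i)) p \<noteq> 0} \<and>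
    mcoeff (L (formal_sum F)) p = mcoeff (formal_sum (\<lambda>i. L (F i))) p" for p
  proof -
    obtain N where N: "finite N" "\<And>f. (\<And>n. n \<in> N \<Longrightarrow> mcoeff f n = 0) \<Longrightarrow> mcoeff (L f) p = 0"
      using L unfolding cont_linear_def by metis
    define J where "J = (\<Union>n\<in>N. {i. mcoeff (F i) n \<noteq> 0})"
    have J: "finite J"
      using F N(1) by (auto simp: J_def locally_finite_def)
    have out: "mcoeff (L (F i)) p = 0" if "i \<notin> J" for i
      using that by (intro N(2)) (auto simp: J_def)
    then have "{i. mcoeff (L (F i)) p \<noteq> 0} \<subseteq> J"
      by auto
    moreover have "mcoeff (L (formal_sum F - (\<Sum>i\<in>J. F i))) p = 0"
    proof (rule N(2))
      fix n assume "n \<in> N"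
      then have "mcoeff (formal_sum F) n = (\<Sum>i\<in>J. mcoeff (F i) n)"
        by (intro mcoeff_formal_sum_superset J) (auto simp: J_def)
      then show "mcoeff (formal_sum F - (\<Sum>i\<in>J. F i)) n = 0"
        by simp
    qed
    moreover have "mcoeff (formal_sum (\<lambda>i. L (F i))) p = (\<Sum>i\<in>J. mcoeff (L (F i)) p)"
      by (rule mcoeff_formal_sum_superset[OF J out])
    ultimately show ?thesis
      using finite_subset[OF _ J] by (simp add: cont_linear_diff cont_linear_sum)
  qed
  show "locally_finite (\<lambda>i. L (F i))"
    using * by (simp add: locally_finite_def)
  show "L (formal_sum F) = formal_sum (\<lambda>i. L (F i))"
    using * by (intro mfps_eqI) simp
qed

end

lemma monomial_expansion:
  fixes f :: "('v, 'a :: comm_ring_1) mfps"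
  shows "locally_finite (\<lambda>n. mconst (mcoeff f n) * monomial n)"
    and "f = formal_sum (\<lambda>n. mconst (mcoeff f n) * monomial n)"
proof -
  have "{n. mcoeff f n * (if m = n then 1 else 0) \<noteq> 0} \<subseteq> {m}" for m
    by auto
  then show "locally_finite (\<lambda>n. mconst (mcoeff f n) * monomial n)"
    unfolding locally_finite_def by (auto simp: mcoeff_monomial intro: finite_subset)
  show "f = formal_sum (\<lambda>n. mconst (mcoeff f n) * monomial n)"
  proof (rule mfps_eqI)
    fix m
    have "mcoeff (formal_sum (\<lambda>n. mconst (mcoeff f n) * monomial n)) m
        = (\<Sum>n\<in>{m}. mcoeff (mconst (mcoeff f n) * monomial n) m)"
      by (rule mcoeff_formal_sum_superset) (auto simp: mcoeff_monomial)
    then show "mcoeff f m = mcoeff (formal_sum (\<lambda>n. mconst (mcoeff f n) * monomial n)) m"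
      by (simp add: mcoeff_monomial)
  qed
qed

text \<open>
  Continuity turns identities between linear maps on power series into identities on monomials; all
  identities about substitutions, flows and derivations below are proved in this way.
\<close>

lemma cont_linear_eq_on:
  assumes "cont_linear L" "cont_linear M" "\<And>n. n \<in> supp f \<Longrightarrow> L (monomial n) = M (monomial n)"
  shows "L f = M f"
proof -
  have "L (mconst (mcoeff f n) * monomial n) = M (mconst (mcoeff f n) * monomial n)" for n
    using assms by (cases "mcoeff f n = 0") (simp_all add: cont_linear_mconst cont_linear_0 mconst_simps supp_def)
  then show ?thesis
    using cont_linear_formal_sum(2)[OF assms(1) monomial_expansion(1)[of f]]
      cont_linear_formal_sum(2)[OF assms(2) monomial_expansion(1)[of f]] monomial_expansion(2)[of f]
    by simp
qed

lemma cont_linear_id: "cont_linear (\<lambda>f. f)"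
  by (rule cont_linearI[where N = "\<lambda>p. {p}"]) auto

lemma cont_linear_zero: "cont_linear (\<lambda>f. 0)"
  by (rule cont_linearI[where N = "\<lambda>p. {}"]) auto

lemma cont_linear_compose:
  assumes L: "cont_linear L" and M: "cont_linear M"
  shows "cont_linear (\<lambda>f. L (M f))"
  unfolding cont_linear_def
proof (intro conjI allI)
  fix p
  obtain N where N: "finite N" "\<And>f. (\<And>n. n \<in> N \<Longrightarrow> mcoeff f n = 0) \<Longrightarrow> mcoeff (L f) p = 0"
    using L unfolding cont_linear_def by metis
  obtain K where K: "\<And>p. finite (K p)" "\<And>p f. (\<And>n. n \<in> K p \<Longrightarrow> mcoeff f n = 0) \<Longrightarrow> mcoeff (M f) p = 0"
    using M unfolding cont_linear_def by metis
  show "\<exists>N. finite N \<and> (\<forall>f. (\<forall>n\<in>N. mcoeff f n = 0) \<longrightarrow> mcoeff (L (M f)) p = 0)"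
    by (rule exI[of _ "\<Union>n\<in>N. K n"]) (use N K in auto)
qed (simp_all add: cont_linear_add[OF L] cont_linear_add[OF M] cont_linear_mconst[OF L] cont_linear_mconst[OF M])

lemma cont_linear_plus:
  assumes L: "cont_linear L" and M: "cont_linear M"
  shows "cont_linear (\<lambda>f. L f + M f)"
  unfolding cont_linear_def
proof (intro conjI allI)
  fix p
  obtain N where N: "finite N" "\<And>f. (\<And>n. n \<in> N \<Longrightarrow> mcoeff f n = 0) \<Longrightarrow> mcoeff (L f) p = 0"
    using L unfolding cont_linear_def by metis
  obtain K where K: "finite K" "\<And>f. (\<And>n. n \<in> K \<Longrightarrow> mcoeff f n = 0) \<Longrightarrow> mcoeff (M f) p = 0"
    using M unfolding cont_linear_def by metis
  show "\<exists>N. finite N \<and> (\<forall>f. (\<forall>n\<in>N. mcoeff f n = 0) \<longrightarrow> mcoeff (L f + M f) p = 0)"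
    by (rule exI[of _ "N \<union> K"]) (use N K in auto)
qed (simp_all add: cont_linear_add[OF L] cont_linear_add[OF M] cont_linear_mconst[OF L]
      cont_linear_mconst[OF M] distrib_left add_ac)

lemma cont_linear_mult_left: "cont_linear (\<lambda>f. g * f)"
  for g :: "('v, 'a :: comm_ring_1) mfps"
proof (rule cont_linearI[where N = "\<lambda>p. snd ` {(a, b). a + b = p}"])
  show "mcoeff (g * f) p = 0" if "\<And>n. n \<in> snd ` {(a, b). a + b = p} \<Longrightarrow> mcoeff f n = 0" for f p
    unfolding mcoeff_mult using that by (intro sum.neutral) force
qed (auto simp: algebra_simps finite_decompositions)

lemma cont_linear_mult:
  "cont_linear L \<Longrightarrow> cont_linear (\<lambda>f. g * L f)" "cont_linear L \<Longrightarrow> cont_linear (\<lambda>f. L f * g)"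
  using cont_linear_compose[OF cont_linear_mult_left] by (simp_all add: mult.commute)

lemma cont_linear_minus: "cont_linear L \<Longrightarrow> cont_linear M \<Longrightarrow> cont_linear (\<lambda>f. L f - M f)"
  using cont_linear_plus[of L "\<lambda>f. (- 1) * M f"] cont_linear_mult(1)[of M "- 1"] by simp

lemma cont_linear_Sum: "(\<And>i. i \<in> I \<Longrightarrow> cont_linear (L i)) \<Longrightarrow> cont_linear (\<lambda>f. \<Sum>i\<in>I. L i f)"
  by (induction I rule: infinite_finite_induct) (simp_all add: cont_linear_zero cont_linear_plus)

lemma cont_linear_pdiff: "cont_linear (pdiff v :: ('v, 'a :: comm_ring_1) mfps \<Rightarrow> _)"
proof (rule cont_linearI[where N = "\<lambda>p. {p + Poly_Mapping.single v 1}"])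
  show "pdiff v (f + g) = pdiff v f + pdiff v g" for f g :: "('v, 'a) mfps"
    by (rule mfps_eqI) (simp add: pdiff_coeff distrib_left)
  show "pdiff v (mconst c * f) = mconst c * pdiff v f" for c and f :: "('v, 'a) mfps"
    by (rule mfps_eqI) (simp only: pdiff_coeff mcoeff_mconst_mult mult.left_commute)
qed (simp_all add: pdiff_coeff)

lemma cont_linear_family:
  assumes L: "\<And>i. cont_linear (L i)" and fin: "\<And>p. finite (I p)"
    and I: "\<And>p i f. i \<notin> I p \<Longrightarrow> mcoeff (L i f) p = 0"
  shows "cont_linear (\<lambda>f. formal_sum (\<lambda>i. L i f))"
proof -
  have co: "mcoeff (formal_sum (\<lambda>i. L i f)) p = (\<Sum>i\<in>I p. mcoeff (L i f) p)" for f p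
    by (rule mcoeff_formal_sum_superset) (use fin I in auto)
  obtain K where K: "\<And>i p. finite (K i p)"
    "\<And>i p f. (\<And>n. n \<in> K i p \<Longrightarrow> mcoeff f n = 0) \<Longrightarrow> mcoeff (L i f) p = 0"
    using L unfolding cont_linear_def by metis
  show ?thesis
  proof (rule cont_linearI[where N = "\<lambda>p. \<Union>i\<in>I p. K i p"])
    show "finite (\<Union>i\<in>I p. K i p)" for p
      using fin K by auto
    show "mcoeff (formal_sum (\<lambda>i. L i f)) p = 0"
      if "\<And>n. n \<in> (\<Union>i\<in>I p. K i p) \<Longrightarrow> mcoeff f n = 0" for p f
      unfolding co by (intro sum.neutral ballI K(2) that) auto
    show "formal_sum (\<lambda>i. L i (f + g)) = formal_sum (\<lambda>i. L i f) + formal_sum (\<lambda>i. L i g)" for f g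
      by (rule mfps_eqI) (simp only: co mcoeff_simps, simp add: cont_linear_add[OF L] sum.distrib)
    show "formal_sum (\<lambda>i. L i (mconst c * f)) = mconst c * formal_sum (\<lambda>i. L i f)" for c f
      by (rule mfps_eqI) (simp only: co mcoeff_mconst_mult, simp add: cont_linear_mconst[OF L] sum_distrib_left)
  qed
qed

section \<open>Continuous homomorphisms, derivations and substitutions\<close>

definition cont_hom :: "(('v, 'a :: comm_ring_1) mfps \<Rightarrow> ('w, 'a) mfps) \<Rightarrow> bool" where
  "cont_hom L \<longleftrightarrow> cont_linear L \<and> L 1 = 1 \<and> (\<forall>f g. L (f * g) = L f * L g)"

text \<open>
  Derivations along a homomorphism \<open>L\<close> cover both \<open>D \<circ> L\<close> and \<open>L \<circ> D'\<close>, so that a relation \<open>D \<circ> L = L \<circ> D'\<close> can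
  be checked on the variables.
\<close>

definition derivation_along ::
  "(('v, 'a :: comm_ring_1) mfps \<Rightarrow> ('w, 'a) mfps) \<Rightarrow> (('v, 'a) mfps \<Rightarrow> ('w, 'a) mfps) \<Rightarrow> bool" where
  "derivation_along L D \<longleftrightarrow> cont_linear D \<and> (\<forall>f g. D (f * g) = D f * L g + L f * D g)"

abbreviation derivation :: "(('v, 'a :: comm_ring_1) mfps \<Rightarrow> ('v, 'a) mfps) \<Rightarrow> bool" where
  "derivation \<equiv> derivation_along (\<lambda>f. f)"

lemma cont_hom_linear: "cont_hom L \<Longrightarrow> cont_linear L"
  and cont_hom_1: "cont_hom L \<Longrightarrow> L 1 = 1"
  and cont_hom_mult: "cont_hom L \<Longrightarrow> L (f * g) = L f * L g"
  by (simp_all add: cont_hom_def)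

lemma cont_hom_0: "cont_hom L \<Longrightarrow> L 0 = 0"
  and cont_hom_add: "cont_hom L \<Longrightarrow> L (f + g) = L f + L g"
  and cont_hom_diff: "cont_hom L \<Longrightarrow> L (f - g) = L f - L g"
  and cont_hom_uminus: "cont_hom L \<Longrightarrow> L (- f) = - L f"
  and cont_hom_sum: "cont_hom L \<Longrightarrow> L (\<Sum>i\<in>I. F i) = (\<Sum>i\<in>I. L (F i))"
  by (simp_all add: cont_hom_def cont_linear_0 cont_linear_add cont_linear_diff cont_linear_uminus cont_linear_sum)

lemma cont_hom_mconst: "cont_hom L \<Longrightarrow> L (mconst c) = mconst c"
  using cont_linear_mconst[of L c 1] by (simp add: cont_hom_def)

lemma cont_hom_power: "cont_hom L \<Longrightarrow> L (f ^ k) = L f ^ k"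
  by (induction k) (simp_all add: cont_hom_1 cont_hom_mult)

lemma cont_hom_prod: "cont_hom L \<Longrightarrow> L (\<Prod>i\<in>I. F i) = (\<Prod>i\<in>I. L (F i))"
  by (induction I rule: infinite_finite_induct) (simp_all add: cont_hom_1 cont_hom_mult)

lemmas cont_hom_simps = cont_hom_0 cont_hom_1 cont_hom_add cont_hom_diff cont_hom_uminus cont_hom_sum
  cont_hom_mult cont_hom_power cont_hom_prod cont_hom_mconst

lemma cont_hom_id: "cont_hom (\<lambda>f. f)"
  by (simp add: cont_hom_def cont_linear_id)

lemma cont_hom_compose: "cont_hom L \<Longrightarrow> cont_hom M \<Longrightarrow> cont_hom (\<lambda>f. L (M f))"
  by (simp add: cont_hom_def cont_linear_compose)

lemma cont_hom_eq_on:
  assumes L: "cont_hom L" and M: "cont_hom M" and f: "supp f \<subseteq> over A"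
    and eq: "\<And>v. v \<in> A \<Longrightarrow> L (mvar v) = M (mvar v)"
  shows "L f = M f"
proof (rule cont_linear_eq_on[OF cont_hom_linear[OF L] cont_hom_linear[OF M]])
  fix n assume "n \<in> supp f"
  with f have "Poly_Mapping.keys n \<subseteq> A"
    by (auto simp: over_def)
  then show "L (monomial n) = M (monomial n)"
  proof (induction n rule: monomial_induct)
    case (add n v)
    have "v \<in> A" "Poly_Mapping.keys n \<subseteq> A"
      using add.prems keys_subset_add[of "Poly_Mapping.single v 1" n] keys_subset_add[of n "Poly_Mapping.single v 1"]
      by (auto simp: add.commute)
    then show ?case
      using add.IH eq by (simp add: monomial_mult[symmetric] mvar_eq_monomial[symmetric] cont_hom_mult[OF L] cont_hom_mult[OF M]
          del: One_nat_def)
  qed (simp add: one_eq_monomial[symmetric] cont_hom_1[OF L] cont_hom_1[OF M])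
qed

lemma over_UNIV [simp]: "over UNIV = UNIV"
  by (simp add: over_def)

lemma cont_hom_eq:
  assumes "cont_hom L" "cont_hom M" "\<And>v. L (mvar v) = M (mvar v)"
  shows "L f = M f"
  by (rule cont_hom_eq_on[where A = UNIV]) (use assms in simp_all)

lemma derivation_along_linear: "derivation_along L D \<Longrightarrow> cont_linear D"
  and derivation_along_mult: "derivation_along L D \<Longrightarrow> D (f * g) = D f * L g + L f * D g"
  by (simp_all add: derivation_along_def)

lemma derivation_along_1: "cont_hom L \<Longrightarrow> derivation_along L D \<Longrightarrow> D 1 = 0"
  using derivation_along_mult[of L D 1 1] by (simp add: cont_hom_1)

lemma derivation_mconst: "derivation D \<Longrightarrow> D (mconst c) = 0"
  using cont_linear_mconst[OF derivation_along_linear, of "\<lambda>f. f" D c 1]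
    derivation_along_1[OF cont_hom_id, of D] by simp

lemma derivation_power: "derivation D \<Longrightarrow> D (f ^ k) = of_nat k * f ^ (k - 1) * D f"
proof (induction k)
  case (Suc k)
  then show ?case
    by (cases k) (simp_all add: derivation_along_mult algebra_simps)
qed (simp add: derivation_along_1[OF cont_hom_id])

lemma derivation_along_eq:
  assumes L: "cont_hom L" and D: "derivation_along L D" and D': "derivation_along L D'"
    and eq: "\<And>v. D (mvar v) = D' (mvar v)"
  shows "D f = D' f"
proof (rule cont_linear_eq_on[OF derivation_along_linear[OF D] derivation_along_linear[OF D']])
  fix n
  show "D (monomial n) = D' (monomial n)"
  proof (induction n rule: monomial_induct)
    case (add n v)
    then show ?case
      using eq by (simp add: monomial_mult[symmetric] mvar_eq_monomial[symmetric] derivation_along_mult[OF D]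
          derivation_along_mult[OF D'] del: One_nat_def)
  qed (simp add: one_eq_monomial[symmetric] derivation_along_1[OF L D] derivation_along_1[OF L D'])
qed

lemma derivation_along_compose_left:
  "cont_hom L \<Longrightarrow> derivation D \<Longrightarrow> derivation_along L (\<lambda>f. D (L f))"
  and derivation_along_compose_right:
  "cont_hom L \<Longrightarrow> derivation D \<Longrightarrow> derivation_along L (\<lambda>f. L (D f))"
  by (simp_all add: derivation_along_def cont_hom_def cont_linear_compose cont_linear_add)

lemma derivation_along_scale: "derivation_along L D \<Longrightarrow> derivation_along L (\<lambda>f. g * D f)"
  by (simp add: derivation_along_def cont_linear_mult algebra_simps)

lemma derivation_along_sum:
  "(\<And>i. i \<in> I \<Longrightarrow> derivation_along L (D i)) \<Longrightarrow> derivation_along L (\<lambda>f. \<Sum>i\<in>I. D i f)"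
  by (simp add: derivation_along_def cont_linear_Sum sum.distrib sum_distrib_left sum_distrib_right)

lemma derivation_along_zero: "derivation_along L (\<lambda>f. 0)"
  by (simp add: derivation_along_def cont_linear_zero)

lemma derivation_commutator:
  "derivation D \<Longrightarrow> derivation D' \<Longrightarrow> derivation (\<lambda>f. D (D' f) - D' (D f))"
  by (simp add: derivation_along_def cont_linear_minus cont_linear_compose cont_linear_add algebra_simps)

lemma pdiff_mvar: "pdiff u (mvar v) = (if u = v then 1 else 0 :: ('v, 'a :: comm_ring_1) mfps)"
proof (rule mfps_eqI)
  fix n :: "'v \<Rightarrow>\<^sub>0 nat"
  let ?s = "\<lambda>v. Poly_Mapping.single v (1 :: nat)"
  have "n + ?s u = ?s v \<longleftrightarrow> u = v \<and> n = 0"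
  proof
    assume h: "n + ?s u = ?s v"
    then have "mdeg n + 1 = 1"
      by (metis wt_add wt_single deg_wt_def mult_1)
    then have "n = 0"
      using mdeg_eq_0_iff by auto
    with h have "Poly_Mapping.lookup (?s u) u = Poly_Mapping.lookup (?s v) u"
      by simp
    then show "u = v \<and> n = 0"
      using \<open>n = 0\<close> by (auto simp: lookup_single when_def split: if_splits)
  qed auto
  then show "mcoeff (pdiff u (mvar v)) n = mcoeff (if u = v then 1 else 0 :: ('v, 'a) mfps) n"
    by (auto simp: pdiff_coeff mvar_eq_monomial one_eq_monomial mcoeff_monomial simp del: One_nat_def)
qed

text \<open>
  The product rule is first verified for one variable times a series, then for a monomial times a
  series by induction, and extended by continuity.
\<close>

lemma derivation_pdiff: "derivation (pdiff v :: ('v, 'a :: comm_ring_1) mfps \<Rightarrow> _)"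
proof -
  let ?D = "pdiff v :: ('v, 'a) mfps \<Rightarrow> _" and ?s = "Poly_Mapping.single v (1 :: nat)"
  have var: "?D (mvar u * g) = ?D (mvar u) * g + mvar u * ?D g" for u g
  proof (rule mfps_eqI)
    fix n
    let ?u = "Poly_Mapping.single u (1 :: nat)"
    show "mcoeff (?D (mvar u * g)) n = mcoeff (?D (mvar u) * g + mvar u * ?D g) n"
    proof (cases "\<exists>b. n = ?u + b")
      case True
      then obtain b where n: "n = ?u + b" by blast
      have 1: "mcoeff (mvar u * g) (n + ?s) = mcoeff g (b + ?s)"
        unfolding n mvar_eq_monomial add.assoc by simp
      have 2: "mcoeff (mvar u * ?D g) n = mcoeff (?D g) b"
        unfolding n mvar_eq_monomial by simp
      show ?thesis
        unfolding pdiff_coeff 1 mcoeff_simps 2 pdiff_mvar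
        by (auto simp: n lookup_add lookup_single when_def algebra_simps pdiff_coeff)
    next
      case False
      have "mcoeff (mvar u * ?D g) n = 0"
        using False unfolding mvar_eq_monomial mcoeff_monomial_mult by simp
      moreover have "mcoeff (?D (mvar u * g)) n = mcoeff (?D (mvar u) * g) n"
      proof (cases "u = v")
        case True
        have "Poly_Mapping.lookup n v = 0"
        proof (rule ccontr)
          assume "Poly_Mapping.lookup n v \<noteq> 0"
          then have "n = ?u + (n - ?u)"
            using True by (intro poly_mapping_eqI) (auto simp: lookup_add lookup_minus lookup_single when_def)
          with False show False by blast
        qed
        then show ?thesis
          using mcoeff_monomial_mult_shift(2)[of ?u g n]
          by (simp add: True pdiff_coeff pdiff_mvar mvar_eq_monomial[symmetric] del: One_nat_def)
      next
        case neq: False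
        have "\<nexists>b. n + ?s = ?u + b"
        proof
          assume "\<exists>b. n + ?s = ?u + b"
          then have "Poly_Mapping.lookup (n + ?s) u \<ge> 1"
            by (metis lookup_add lookup_single_eq le_add1)
          then have "Poly_Mapping.lookup n u \<ge> 1"
            using neq by (simp add: lookup_add lookup_single when_def split: if_splits)
          then have "n = ?u + (n - ?u)"
            by (intro poly_mapping_eqI) (auto simp: lookup_add lookup_minus lookup_single when_def)
          with False show False by blast
        qed
        then have "mcoeff (mvar u * g) (n + ?s) = 0"
          unfolding mvar_eq_monomial mcoeff_monomial_mult by simp
        then show ?thesis
          using neq by (simp add: pdiff_coeff pdiff_mvar del: One_nat_def)
      qed
      ultimately show ?thesis by simp
    qed
  qed
  have mon: "?D (monomial n * g) = ?D (monomial n) * g + monomial n * ?D g" for n g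
  proof (induction n arbitrary: g rule: monomial_induct)
    case zero
    have "?D 1 = 0"
      using var[of v 1] mvar_mult_cancel[of v "?D 1" 0] by (simp add: pdiff_mvar)
    then show ?case by (simp add: one_eq_monomial[symmetric])
  next
    case (add n u)
    show ?case
      unfolding monomial_mult[symmetric] mvar_eq_monomial[symmetric] mult.assoc var add.IH
      by (simp add: algebra_simps)
  qed
  have "?D (f * g) = ?D f * g + f * ?D g" for f g
    by (rule cont_linear_eq_on[where L = "\<lambda>f. ?D (f * g)"])
       (simp_all add: mon cont_linear_plus cont_linear_mult cont_linear_pdiff cont_linear_id
         cont_linear_compose[OF cont_linear_pdiff] del: One_nat_def)
  then show ?thesis
    by (simp add: derivation_along_def cont_linear_pdiff)
qed

section \<open>Substitution\<close>

definition monomial_subst :: "('v \<Rightarrow> ('w, 'a) mfps) \<Rightarrow> ('v \<Rightarrow>\<^sub>0 nat) \<Rightarrow> ('w, 'a :: comm_ring_1) mfps" where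
  "monomial_subst \<phi> n = (\<Prod>v\<in>Poly_Mapping.keys n. \<phi> v ^ Poly_Mapping.lookup n v)"

lemma monomial_subst_superset:
  "finite A \<Longrightarrow> Poly_Mapping.keys n \<subseteq> A \<Longrightarrow> monomial_subst \<phi> n = (\<Prod>v\<in>A. \<phi> v ^ Poly_Mapping.lookup n v)"
  unfolding monomial_subst_def by (rule prod.mono_neutral_left) (auto simp: not_in_keys_iff_lookup_eq_zero)

lemma monomial_subst_add: "monomial_subst \<phi> (a + b) = monomial_subst \<phi> a * monomial_subst \<phi> b"
proof -
  let ?A = "Poly_Mapping.keys a \<union> Poly_Mapping.keys b"
  have "monomial_subst \<phi> x = (\<Prod>v\<in>?A. \<phi> v ^ Poly_Mapping.lookup x v)" if "x \<in> {a, b, a + b}" for x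
    using that keys_add[of a b] by (intro monomial_subst_superset) auto
  then show ?thesis
    by (simp add: lookup_add power_add prod.distrib)
qed

lemma monomial_subst_0 [simp]: "monomial_subst \<phi> 0 = 1"
  by (simp add: monomial_subst_def)

lemma monomial_subst_single: "monomial_subst \<phi> (Poly_Mapping.single v k) = \<phi> v ^ k"
  by (simp add: monomial_subst_def)

lemma monomial_subst_mvar: "(\<And>v. v \<in> Poly_Mapping.keys n \<Longrightarrow> \<phi> v = mvar v) \<Longrightarrow> monomial_subst \<phi> n = monomial n"
proof (induction n rule: monomial_induct)
  case (add n v)
  have "v \<in> Poly_Mapping.keys (Poly_Mapping.single v 1 + n)"
    "Poly_Mapping.keys n \<subseteq> Poly_Mapping.keys (Poly_Mapping.single v 1 + n)"
    using keys_subset_add[of "Poly_Mapping.single v 1" n] keys_subset_add[of n "Poly_Mapping.single v 1"]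
    by (auto simp: add.commute)
  then show ?case
    using add by (simp add: monomial_subst_add monomial_subst_single monomial_mult[symmetric] subset_iff
        mvar_eq_monomial[symmetric] del: One_nat_def)
qed (simp add: one_eq_monomial)

lemma supp_monomial_subst_ge:
  assumes "\<And>v. supp (\<phi> v) \<subseteq> ge_wt c (d v)"
  shows "supp (monomial_subst \<phi> n) \<subseteq> ge_wt c (wt d n)"
proof (induction n rule: monomial_induct)
  case (add n v)
  then show ?case
    using supp_mult_ge[OF assms[of v] add.IH]
    by (simp add: monomial_subst_add monomial_subst_single)
qed (simp add: wt_def)

lemma supp_monomial_subst_over:
  assumes "\<And>v. v \<in> A \<Longrightarrow> supp (\<phi> v) \<subseteq> over B" "n \<in> over A"
  shows "supp (monomial_subst \<phi> n) \<subseteq> over B"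
  unfolding monomial_subst_def
  by (intro supp_prod_over supp_power_over assms(1)) (use assms(2) in \<open>auto simp: over_def\<close>)

text \<open>
  A substitution \<open>\<phi>\<close> into a power series makes sense if no \<open>\<phi> v\<close> has a constant term and only finitely
  many variables are neither fixed nor annihilated: then a given monomial of the result gets
  contributions from finitely many monomials of the argument.
\<close>

definition substitution :: "('v \<Rightarrow> ('v, 'a :: comm_ring_1) mfps) \<Rightarrow> bool" where
  "substitution \<phi> \<longleftrightarrow> (\<forall>v. mcoeff (\<phi> v) 0 = 0) \<and> finite {v. \<phi> v \<noteq> 0 \<and> \<phi> v \<noteq> mvar v}"

lemma msubst_eq: "msubst \<phi> f = formal_sum (\<lambda>n. mconst (mcoeff f n) * monomial_subst \<phi> n)"
  by (simp add: msubst_def monomial_subst_def)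

text \<open>
  A variable that is fixed or annihilated by \<open>\<phi>\<close> can occur in a monomial contributing to \<open>p\<close> only if it
  occurs in \<open>p\<close>; and substitution does not lower the degree.
\<close>

lemma msubst_supports:
  assumes \<phi>: "substitution \<phi>"
  defines "N \<equiv> \<lambda>p. {n \<in> over ({v. \<phi> v \<noteq> 0 \<and> \<phi> v \<noteq> mvar v} \<union> Poly_Mapping.keys p). mdeg n \<le> mdeg p}"
  shows "finite (N p)" "n \<notin> N p \<Longrightarrow> mcoeff (monomial_subst \<phi> n) p = 0"
proof -
  show "finite (N p)"
    unfolding N_def by (rule finite_bounded_monomials) (use \<phi> in \<open>simp add: substitution_def\<close>)
  assume "n \<notin> N p"
  then consider "\<not> mdeg n \<le> mdeg p"
    | v where "v \<in> Poly_Mapping.keys n" "v \<notin> Poly_Mapping.keys p" "\<phi> v = 0 \<or> \<phi> v = mvar v"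
    by (auto simp: N_def over_def)
  then show "mcoeff (monomial_subst \<phi> n) p = 0"
  proof cases
    case 1
    have "supp (monomial_subst \<phi> n) \<subseteq> ge_wt deg_wt (wt deg_wt n)"
    proof (rule supp_monomial_subst_ge)
      show "supp (\<phi> v) \<subseteq> ge_wt deg_wt (deg_wt v)" for v
        using \<phi> by (simp add: supp_ge_deg_1_iff substitution_def)
    qed
    then show ?thesis
      by (rule supp_subsetD) (use 1 in \<open>simp add: ge_wt_def\<close>)
  next
    case 2
    have "monomial_subst \<phi> n = \<phi> v ^ Poly_Mapping.lookup n v
        * (\<Prod>u\<in>Poly_Mapping.keys n - {v}. \<phi> u ^ Poly_Mapping.lookup n u)"
      unfolding monomial_subst_def by (rule prod.remove) (use 2 in auto)
    moreover have "Poly_Mapping.lookup n v = Suc (Poly_Mapping.lookup n v - 1)"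
      using 2(1) by (cases "Poly_Mapping.lookup n v") auto
    ultimately have dvd: "\<phi> v dvd monomial_subst \<phi> n"
      by (metis dvd_mult2 dvd_triv_left power_Suc)
    from 2(3) show ?thesis
    proof
      assume "\<phi> v = 0"
      with dvd show ?thesis by simp
    next
      assume "\<phi> v = mvar v"
      with dvd obtain g where g: "monomial_subst \<phi> n = monomial (Poly_Mapping.single v 1) * g"
        by (auto simp: mvar_eq_monomial)
      have "\<nexists>b. p = Poly_Mapping.single v 1 + b"
        using 2(2) keys_subset_add[of "Poly_Mapping.single v 1"] by auto
      then show ?thesis
        unfolding g mcoeff_monomial_mult by simp
    qed
  qed
qed

lemma msubst_monomial: "msubst \<phi> (monomial n) = monomial_subst \<phi> n"
  unfolding msubst_eq by (subst formal_sum_finite[of "{n}"]) (auto simp: mcoeff_monomial mconst_simps)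

lemma msubst_mvar [simp]: "msubst \<phi> (mvar v) = \<phi> v"
  by (simp add: mvar_eq_monomial msubst_monomial monomial_subst_single)

lemma cont_linear_coeff: "cont_linear (\<lambda>f. mconst (mcoeff f n) * g)"
  by (rule cont_linearI[where N = "\<lambda>p. {n}"]) (auto simp: mconst_simps mconst_mult distrib_right mult.assoc)

lemma cont_hom_msubst:
  assumes \<phi>: "substitution \<phi>"
  shows "cont_hom (msubst \<phi>)"
proof -
  have lin: "cont_linear (msubst \<phi>)"
    unfolding msubst_eq[abs_def]
    by (rule cont_linear_family[where I = "\<lambda>p. {n \<in> over ({v. \<phi> v \<noteq> 0 \<and> \<phi> v \<noteq> mvar v} \<union> Poly_Mapping.keys p). mdeg n \<le> mdeg p}"])
       (use msubst_supports[OF \<phi>] cont_linear_coeff in auto)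
  have "msubst \<phi> (monomial n * g) = msubst \<phi> (monomial n) * msubst \<phi> g" for n g
    by (rule cont_linear_eq_on[where L = "\<lambda>g. msubst \<phi> (monomial n * g)"])
       (simp_all add: cont_linear_mult cont_linear_compose[OF lin] cont_linear_id lin monomial_mult
         msubst_monomial monomial_subst_add)
  then have "msubst \<phi> (f * g) = msubst \<phi> f * msubst \<phi> g" for f g
    by (rule cont_linear_eq_on[where L = "\<lambda>f. msubst \<phi> (f * g)",
          OF cont_linear_compose[OF lin cont_linear_mult(2)[OF cont_linear_id]] cont_linear_mult(2)[OF lin]])
  moreover have "msubst \<phi> 1 = 1"
    using msubst_monomial[of \<phi> 0] by (simp add: one_eq_monomial[symmetric])
  ultimately show ?thesis
    using lin by (simp add: cont_hom_def)
qed

lemma msubst_cong: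
  assumes "supp f \<subseteq> over A" "\<And>v. v \<in> A \<Longrightarrow> \<phi> v = \<psi> v"
  shows "msubst \<phi> f = msubst \<psi> f"
proof -
  have "mconst (mcoeff f n) * monomial_subst \<phi> n = mconst (mcoeff f n) * monomial_subst \<psi> n" for n
  proof (cases "mcoeff f n = 0")
    case False
    then have "Poly_Mapping.keys n \<subseteq> A"
      using assms(1) by (auto simp: supp_def over_def)
    then show ?thesis
      unfolding monomial_subst_def by (auto intro!: arg_cong2[of _ _ _ _ "(*)"] prod.cong simp: assms(2) subset_iff)
  qed (simp add: mconst_simps)
  then show ?thesis
    by (simp add: msubst_eq)
qed

lemma msubst_ident: "supp f \<subseteq> over A \<Longrightarrow> (\<And>v. v \<in> A \<Longrightarrow> \<phi> v = mvar v) \<Longrightarrow> msubst \<phi> f = f"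
  using monomial_expansion(2)[of f]
  by (subst msubst_cong[of f A \<phi> mvar]) (simp_all add: msubst_eq monomial_subst_mvar)

lemma supp_msubst_over:
  assumes "supp f \<subseteq> over A" "\<And>v. v \<in> A \<Longrightarrow> supp (\<phi> v) \<subseteq> over B"
  shows "supp (msubst \<phi> f) \<subseteq> over B"
  unfolding msubst_eq
proof (rule supp_formal_sum)
  fix n
  show "supp (mconst (mcoeff f n) * monomial_subst \<phi> n) \<subseteq> over B"
  proof (cases "n \<in> supp f")
    case True
    then have "n \<in> over A"
      using assms(1) by blast
    then show ?thesis
      by (intro supp_mconst_mult supp_monomial_subst_over[where A = A] assms(2))
  qed (simp add: supp_def[of f] mconst_simps)
qed

lemma supp_msubst_ge:
  assumes "supp f \<subseteq> ge_wt d k" "\<And>v. supp (\<phi> v) \<subseteq> ge_wt c (d v)"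
  shows "supp (msubst \<phi> f) \<subseteq> ge_wt c k"
  unfolding msubst_eq
proof (rule supp_formal_sum)
  fix n
  show "supp (mconst (mcoeff f n) * monomial_subst \<phi> n) \<subseteq> ge_wt c k"
  proof (cases "n \<in> supp f")
    case True
    then have "k \<le> wt d n"
      using assms(1) by (auto simp: ge_wt_def)
    then show ?thesis
      by (intro supp_mconst_mult ge_wt_mono[OF supp_monomial_subst_ge[of \<phi> c d]] assms(2))
  qed (simp add: supp_def[of f] mconst_simps)
qed

text \<open>
  This estimate makes the nonlinear equations below triangular. For monomials it is proved by exchanging
  one factor at a time; every exchange gains \<open>d\<close> in weight.
\<close>

lemma msubst_perturbation:
  fixes f :: "('v, 'a :: comm_ring_1) mfps"
  assumes f: "supp f \<subseteq> ge_wt c k"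
    and \<phi>: "\<And>v. supp (\<phi> v) \<subseteq> ge_wt c (c v)" and \<psi>: "\<And>v. supp (\<psi> v) \<subseteq> ge_wt c (c v)"
    and diff: "\<And>v. supp (\<phi> v - \<psi> v) \<subseteq> ge_wt c (c v + d)"
    and subst: "substitution \<phi>" "substitution \<psi>"
  shows "supp (msubst \<phi> f - msubst \<psi> f) \<subseteq> ge_wt c (k + d)"
proof -
  have mono: "supp (monomial_subst \<phi> n - monomial_subst \<psi> n) \<subseteq> ge_wt c (wt c n + d)" for n
  proof (induction n rule: monomial_induct)
    case (add n v)
    have "supp (\<phi> v * (monomial_subst \<phi> n - monomial_subst \<psi> n) + (\<phi> v - \<psi> v) * monomial_subst \<psi> n)
        \<subseteq> ge_wt c (c v + wt c n + d)"
      using supp_mult_ge[OF \<phi>[of v] add.IH] supp_mult_ge[OF diff[of v] supp_monomial_subst_ge[of \<psi> c c n, OF \<psi>]]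
      by (intro supp_add) (simp_all add: add_ac)
    then show ?case
      by (simp add: monomial_subst_add monomial_subst_single algebra_simps)
  qed simp
  have "supp (mconst (mcoeff f n) * (monomial_subst \<phi> n - monomial_subst \<psi> n)) \<subseteq> ge_wt c (k + d)" for n
  proof (cases "n \<in> supp f")
    case True
    then have "k \<le> wt c n"
      using f by (auto simp: ge_wt_def)
    then show ?thesis
      by (intro supp_mconst_mult ge_wt_mono[OF mono]) simp
  qed (simp add: supp_def[of f] mconst_simps)
  moreover have "msubst \<phi> f - msubst \<psi> f
      = formal_sum (\<lambda>n. mconst (mcoeff f n) * (monomial_subst \<phi> n - monomial_subst \<psi> n))"
  proof (rule mfps_eqI)
    fix p :: "'v \<Rightarrow>\<^sub>0 nat"
    let ?N = "\<lambda>\<phi> :: 'v \<Rightarrow> ('v, 'a) mfps. {n \<in> over ({v. \<phi> v \<noteq> 0 \<and> \<phi> v \<noteq> mvar v} \<union> Poly_Mapping.keys p). mdeg n \<le> mdeg p}"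
    let ?M = "?N \<phi> \<union> ?N \<psi>"
    have out: "mcoeff (monomial_subst \<phi> n) p = 0" "mcoeff (monomial_subst \<psi> n) p = 0"
      if "n \<notin> ?M" for n
      using msubst_supports(2)[OF subst(1), of n p] msubst_supports(2)[OF subst(2), of n p] that by blast+
    have fin: "finite ?M"
      using msubst_supports(1)[OF subst(1), of p] msubst_supports(1)[OF subst(2), of p] by blast
    show "mcoeff (msubst \<phi> f - msubst \<psi> f) p = mcoeff (formal_sum
        (\<lambda>n. mconst (mcoeff f n) * (monomial_subst \<phi> n - monomial_subst \<psi> n))) p"
      unfolding msubst_eq mcoeff_simps
      by (subst (1 2 3) mcoeff_formal_sum_superset[OF fin])
         (simp_all add: out sum_subtractf[symmetric] right_diff_distrib)
  qed
  ultimately show ?thesis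
    by (metis (no_types, lifting) supp_formal_sum)
qed

section \<open>Exponentials of derivations\<close>

lemma supp_formal_sum_tail:
  fixes F :: "nat \<Rightarrow> ('v, 'a :: comm_ring_1) mfps"
  assumes "\<And>k. supp (F k) \<subseteq> ge_deg k"
  shows "supp (formal_sum F - (\<Sum>k\<le>N. F k)) \<subseteq> ge_deg (Suc N)"
proof (rule supp_subsetI)
  fix n assume n: "mcoeff (formal_sum F - (\<Sum>k\<le>N. F k)) n \<noteq> 0"
  have "mcoeff (formal_sum F) n = (\<Sum>k\<le>N. mcoeff (F k) n)" if "mdeg n \<le> N"
  proof (rule mcoeff_formal_sum_superset)
    show "mcoeff (F k) n = 0" if "k \<notin> {..N}" for k
      by (rule supp_subsetD[OF assms[of k]]) (use that \<open>mdeg n \<le> N\<close> in \<open>simp add: ge_wt_def\<close>)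
  qed simp
  with n show "n \<in> ge_deg (Suc N)"
    by (auto simp: ge_wt_def not_less_eq_eq[symmetric])
qed

lemma eq_by_degree:
  fixes f :: "('v, 'a :: comm_ring_1) mfps"
  assumes "\<And>N. supp (f - g) \<subseteq> ge_deg (Suc N)"
  shows "f = g"
proof (rule mfps_eqI)
  fix n
  have "mcoeff (f - g) n = 0"
    by (rule supp_subsetD[OF assms[of "mdeg n"]]) (simp add: ge_wt_def)
  then show "mcoeff f n = mcoeff g n"
    by simp
qed

text \<open>
  The Cauchy product. Up to terms of degree greater than \<open>N\<close> both factors are finite sums.
\<close>

lemma formal_sum_mult:
  fixes F G :: "nat \<Rightarrow> ('v, 'a :: comm_ring_1) mfps"
  assumes F: "\<And>k. supp (F k) \<subseteq> ge_deg k" and G: "\<And>k. supp (G k) \<subseteq> ge_deg k"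
  shows "formal_sum F * formal_sum G = formal_sum (\<lambda>k. \<Sum>i\<le>k. F i * G (k - i))"
proof (rule eq_by_degree)
  fix N
  let ?F = "\<Sum>k\<le>N. F k" and ?G = "\<Sum>k\<le>N. G k" and ?H = "\<lambda>k. \<Sum>i\<le>k. F i * G (k - i)"
  have H: "supp (?H k) \<subseteq> ge_deg k" for k
    using supp_mult_ge[OF F G] by (intro supp_sum) (metis atMost_iff le_add_diff_inverse)
  have "?F * ?G = (\<Sum>(i, j)\<in>{..N} \<times> {..N}. F i * G j)"
    by (simp add: sum_product sum.cartesian_product)
  also have "\<dots> = (\<Sum>(i, j)\<in>{(i, j). i + j \<le> N}. F i * G j)
      + (\<Sum>(i, j)\<in>{..N} \<times> {..N} - {(i, j). i + j \<le> N}. F i * G j)"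
    by (subst add.commute, rule sum.subset_diff) auto
  also have "(\<Sum>(i, j)\<in>{(i, j). i + j \<le> N}. F i * G j) = (\<Sum>k\<le>N. ?H k)"
    by (rule sum.triangle_reindex_eq)
  finally have FG: "?F * ?G - (\<Sum>k\<le>N. ?H k)
      = (\<Sum>(i, j)\<in>{..N} \<times> {..N} - {(i, j). i + j \<le> N}. F i * G j)"
    by simp
  have big: "supp (F i * G j) \<subseteq> ge_deg (Suc N)" if "\<not> i + j \<le> N" for i j
    by (rule ge_wt_mono[OF supp_mult_ge[OF F G]]) (use that in simp)
  have 1: "supp (?F * ?G - (\<Sum>k\<le>N. ?H k)) \<subseteq> ge_deg (Suc N)"
    unfolding FG by (rule supp_sum) (simp add: case_prod_unfold big)
  have 2: "supp ((formal_sum F - ?F) * formal_sum G) \<subseteq> ge_deg (Suc N)"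
    using supp_mult_ge_left[OF supp_formal_sum_tail[of F N, OF F], of "formal_sum G"] by (simp add: mult.commute)
  have 3: "supp (?F * (formal_sum G - ?G)) \<subseteq> ge_deg (Suc N)"
    by (rule supp_mult_ge_left[OF supp_formal_sum_tail[of G N, OF G]])
  have 4: "supp (formal_sum ?H - (\<Sum>k\<le>N. ?H k)) \<subseteq> ge_deg (Suc N)"
    by (rule supp_formal_sum_tail[of ?H, OF H])
  have "supp ((formal_sum F - ?F) * formal_sum G + ?F * (formal_sum G - ?G)
      + (?F * ?G - (\<Sum>k\<le>N. ?H k)) - (formal_sum ?H - (\<Sum>k\<le>N. ?H k))) \<subseteq> ge_deg (Suc N)"
    by (rule supp_diff[OF supp_add[OF supp_add[OF 2 3] 1] 4])
  then show "supp (formal_sum F * formal_sum G - formal_sum ?H) \<subseteq> ge_deg (Suc N)"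
    by (simp add: algebra_simps)
qed

definition exp_derivation ::
  "(('v, 'a) mfps \<Rightarrow> ('v, 'a) mfps) \<Rightarrow> ('v, 'a :: field_char_0) mfps \<Rightarrow> ('v, 'a) mfps" where
  "exp_derivation D f = formal_sum (\<lambda>n. mconst (1 / fact n) * (D ^^ n) f)"

definition raises_degree :: "(('v, 'a :: zero) mfps \<Rightarrow> ('v, 'a) mfps) \<Rightarrow> bool" where
  "raises_degree D \<longleftrightarrow> (\<forall>f k. supp f \<subseteq> ge_deg k \<longrightarrow> supp (D f) \<subseteq> ge_deg (Suc k))"

lemma supp_funpow:
  fixes D :: "('v, 'a :: zero) mfps \<Rightarrow> ('v, 'a) mfps"
  assumes "\<And>f k. supp f \<subseteq> ge_wt c k \<Longrightarrow> supp (D f) \<subseteq> ge_wt c (Suc k)" "supp f \<subseteq> ge_wt c k"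
  shows "supp ((D ^^ n) f) \<subseteq> ge_wt c (n + k)"
  by (induction n) (use assms in simp_all)

lemma raises_degree_funpow: "raises_degree D \<Longrightarrow> supp ((D ^^ n) f) \<subseteq> ge_deg n"
  using supp_funpow[of deg_wt D f 0 n] by (simp add: raises_degree_def)

lemma locally_finite_exp:
  "raises_degree D \<Longrightarrow> locally_finite (\<lambda>n. mconst (1 / fact n) * (D ^^ n) f)"
  for D :: "('v, 'a :: field_char_0) mfps \<Rightarrow> ('v, 'a) mfps"
  by (intro locally_finite_deg supp_mconst_mult raises_degree_funpow)

lemma cont_linear_funpow: "cont_linear D \<Longrightarrow> cont_linear (D ^^ n)"
  for D :: "('v, 'a :: comm_ring_1) mfps \<Rightarrow> ('v, 'a) mfps"
proof (induction n)
  case (Suc n)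
  then show ?case
    using cont_linear_compose[of D "D ^^ n"] by (simp add: comp_def)
qed (simp add: cont_linear_id id_def)

lemma exp_derivation_fixed: "cont_linear D \<Longrightarrow> D f = 0 \<Longrightarrow> exp_derivation D f = f"
proof -
  assume D: "cont_linear D" "D f = 0"
  have "(D ^^ n) f = 0" if "n \<noteq> 0" for n
    using that cont_linear_0[OF cont_linear_funpow[OF D(1)]]
    by (cases n) (simp_all add: funpow_Suc_right D del: funpow.simps)
  then show "exp_derivation D f = f"
    unfolding exp_derivation_def by (subst formal_sum_finite[of "{0}"]) (auto simp: mconst_simps)
qed

lemma exp_derivation_head:
  assumes "raises_degree D"
  shows "supp (exp_derivation D f - f) \<subseteq> ge_deg (Suc 0)"
proof -
  have "exp_derivation D f - f = formal_sum (\<lambda>n. mconst (1 / fact (Suc n)) * (D ^^ Suc n) f)"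
    unfolding exp_derivation_def by (subst formal_sum_Suc[OF locally_finite_exp[OF assms]]) (simp add: mconst_simps)
  then show ?thesis
    using ge_wt_mono[OF raises_degree_funpow[OF assms]]
    by (simp del: funpow.simps add: supp_formal_sum supp_mconst_mult)
qed

lemma taylor_coeff_Suc:
  "of_nat (Suc n) * (mconst (1 / fact (Suc n)) * (D ^^ Suc n) f) = D (mconst (1 / fact n) * (D ^^ n) f)"
  if "cont_linear D" for D :: "('v, 'a :: field_char_0) mfps \<Rightarrow> ('v, 'a) mfps"
proof -
  have "of_nat (Suc n) * mconst (1 / fact (Suc n)) = (mconst (1 / fact n) :: ('v, 'a) mfps)"
    unfolding mconst_of_nat[symmetric] mconst_mult[symmetric] by (simp add: field_simps del: of_nat_Suc)
  then show ?thesis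
    using that by (simp only: mult.assoc[symmetric] cont_linear_mconst[OF that] funpow.simps comp_def)
qed

lemma of_nat_mult_cancel: "of_nat (Suc n) * f = of_nat (Suc n) * g \<Longrightarrow> f = g"
  for f :: "('v, 'a :: field_char_0) mfps"
  using mconst_mult_eq_0_iff[of "of_nat (Suc n)" "f - g"]
  by (simp add: mconst_of_nat right_diff_distrib del: of_nat_Suc)

text \<open>
  The Leibniz rule for \<open>D\<^sup>n / n!\<close>. It is proved after multiplication by \<open>n + 1\<close>, where the recursion
  \<open>(n + 1) e\<^sub>n\<^sub>+\<^sub>1 = D e\<^sub>n\<close> avoids binomial coefficients.
\<close>

lemma taylor_coeff_mult:
  fixes D :: "('v, 'a :: field_char_0) mfps \<Rightarrow> ('v, 'a) mfps"
  assumes D: "derivation D"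
  defines "e \<equiv> \<lambda>n f. mconst (1 / fact n) * (D ^^ n) f"
  shows "e n (f * g) = (\<Sum>i\<le>n. e i f * e (n - i) g)"
proof (induction n)
  case (Suc n)
  note lin = derivation_along_linear[OF D]
  have e: "of_nat (Suc n) * e (Suc n) h = D (e n h)" for n h
    unfolding e_def by (rule taylor_coeff_Suc[OF lin])
  have "of_nat (Suc n) * e (Suc n) (f * g) = (\<Sum>i\<le>n. D (e i f) * e (n - i) g + e i f * D (e (n - i) g))"
    by (simp only: e Suc cont_linear_sum[OF lin] derivation_along_mult[OF D])
  also have "\<dots> = (\<Sum>i\<le>n. of_nat (Suc i) * (e (Suc i) f * e (n - i) g))
      + (\<Sum>i\<le>n. of_nat (Suc n - i) * (e i f * e (Suc n - i) g))"
    unfolding e[symmetric] sum.distrib by (intro arg_cong2[of _ _ _ _ "(+)"] sum.cong) (auto simp: Suc_diff_le mult_ac simp del: of_nat_Suc)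
  also have "(\<Sum>i\<le>n. of_nat (Suc i) * (e (Suc i) f * e (n - i) g))
      = (\<Sum>i\<le>Suc n. of_nat i * (e i f * e (Suc n - i) g))"
    by (subst sum.atMost_Suc_shift) simp
  also have "(\<Sum>i\<le>n. of_nat (Suc n - i) * (e i f * e (Suc n - i) g))
      = (\<Sum>i\<le>Suc n. of_nat (Suc n - i) * (e i f * e (Suc n - i) g))"
    by simp
  also have "(\<Sum>i\<le>Suc n. of_nat i * (e i f * e (Suc n - i) g)) + (\<Sum>i\<le>Suc n. of_nat (Suc n - i) * (e i f * e (Suc n - i) g))
      = of_nat (Suc n) * (\<Sum>i\<le>Suc n. e i f * e (Suc n - i) g)"
    unfolding sum.distrib[symmetric] sum_distrib_left
    by (intro sum.cong) (simp_all add: distrib_right[symmetric] of_nat_add[symmetric] del: of_nat_add of_nat_Suc)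
  finally show ?case
    by (rule of_nat_mult_cancel)
qed (simp add: e_def mconst_simps)

text \<open>
  The Leibniz rule says that the terms of \<open>exp D (f g)\<close> are those of the Cauchy product of \<open>exp D f\<close> and
  \<open>exp D g\<close>. This makes a formal flow a substitution.
\<close>

lemma cont_hom_exp_derivation:
  fixes D :: "('v, 'a :: field_char_0) mfps \<Rightarrow> ('v, 'a) mfps"
  assumes D: "derivation D" and deg: "raises_degree D"
  shows "cont_hom (exp_derivation D)"
proof -
  note lin = derivation_along_linear[OF D]
  have small: "supp (mconst (1 / fact n) * (D ^^ n) f) \<subseteq> ge_deg n" for n f
    by (intro supp_mconst_mult raises_degree_funpow[OF deg])
  have "cont_linear (exp_derivation D)"
    unfolding exp_derivation_def[abs_def]
  proof (rule cont_linear_family[where I = "\<lambda>p. {..mdeg p}"])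
    show "mcoeff (mconst (1 / fact i) * (D ^^ i) f) p = 0" if "i \<notin> {..mdeg p}" for p i f
      by (rule supp_subsetD[OF small]) (use that in \<open>simp add: ge_wt_def\<close>)
  qed (simp_all add: cont_linear_mult cont_linear_funpow lin)
  moreover have "exp_derivation D (f * g) = exp_derivation D f * exp_derivation D g" for f g
    unfolding exp_derivation_def by (simp only: formal_sum_mult[OF small small] taylor_coeff_mult[OF D])
  moreover have "exp_derivation D 1 = 1"
    by (intro exp_derivation_fixed lin derivation_along_1[OF cont_hom_id D])
  ultimately show ?thesis
    by (simp add: cont_hom_def)
qed

section \<open>Units and triangular systems\<close>

text \<open>
  The inverse is the geometric series in \<open>1 - U\<close>.
\<close>

lemma unit_inverse:
  fixes U :: "('v, 'a :: comm_ring_1) mfps"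
  assumes "mcoeff U 0 = 1"
  obtains V where "U * V = 1" "mcoeff V 0 = 1" "\<And>A. supp U \<subseteq> over A \<Longrightarrow> supp V \<subseteq> over A"
proof
  define a where "a = 1 - U"
  define V where "V = formal_sum (\<lambda>n. a ^ n)"
  have "mcoeff a 0 = 0"
    using assms by (simp add: a_def one_eq_monomial mcoeff_monomial)
  then have a: "supp (a ^ n) \<subseteq> ge_deg n" for n
    using supp_power_ge[of a deg_wt 1 n] by (simp add: supp_ge_deg_1_iff)
  have "a * V = formal_sum (\<lambda>n. a ^ Suc n)"
    unfolding V_def by (simp add: cont_linear_formal_sum(2)[OF cont_linear_mult_left locally_finite_deg[OF a]])
  also have "\<dots> = V - 1"
    using formal_sum_Suc[OF locally_finite_deg[OF a]] by (simp add: V_def)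
  finally show UV: "U * V = 1"
    by (simp add: a_def algebra_simps)
  show "mcoeff V 0 = 1"
    using arg_cong[OF UV, of "\<lambda>f. mcoeff f 0"] assms by (simp add: mcoeff_mult_0 one_eq_monomial mcoeff_monomial)
  show "supp V \<subseteq> over A" if "supp U \<subseteq> over A" for A
    unfolding V_def a_def by (intro supp_formal_sum supp_power_over supp_diff that supp_one_over)
qed

text \<open>
  A system in which the unknown \<open>f i\<close> enters its own equation linearly, with coefficient \<open>c\<close>, once the
  unknowns of lower rank are known, is solved by well-founded recursion: \<open>f i\<close> is the solution of the
  equation in which all unknowns of rank at least \<open>rank i\<close> are given arbitrary values.
\<close>

lemma triangular_system_solvable:
  fixes \<Phi> :: "('i \<Rightarrow> 'a :: field) \<Rightarrow> 'i \<Rightarrow> 'a" and rank :: "'i \<Rightarrow> nat"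
  assumes c: "c \<noteq> 0"
    and tri: "\<And>f g i. (\<And>j. rank j < rank i \<Longrightarrow> f j = g j) \<Longrightarrow> \<Phi> f i - \<Phi> g i = c * (f i - g i)"
  shows "\<exists>f. \<forall>i. \<Phi> f i = 0"
proof -
  let ?R = "measure rank"
  let ?step = "\<lambda>g i. g i - \<Phi> g i / c"
  define f where "f = wfrec ?R ?step"
  have "\<Phi> f i = 0" for i
  proof -
    let ?g = "cut f ?R i"
    have "f i = ?step ?g i"
      unfolding f_def by (rule wfrec) simp
    moreover have "\<Phi> f i - \<Phi> ?g i = c * (f i - ?g i)"
      by (rule tri) (simp add: cut_def)
    ultimately show ?thesis
      using c by simp
  qed
  then show ?thesis by blast
qed

section \<open>The planar model of the vector fields\<close>

lemma finite_states [simp]: "finite (UNIV :: state set)"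
proof -
  have "UNIV = {X, Y, Z}"
    using state.exhaust by auto
  then show ?thesis by (metis finite.simps)
qed

text \<open>
  Every element of \<open>\<S>\<close> is a multiple of \<open>E\<close> by a series in \<open>x\<close>, \<open>R = y\<^sup>2 + z\<^sup>2\<close> and the parameters.
  Such series are written as \<open>emb g\<close> with \<open>g\<close> a series in the variables \<open>X\<close> (for \<open>x\<close>), \<open>Y\<close> (for \<open>R\<close>) and
  the parameters; all equations are then solved for \<open>g\<close>.
\<close>

definition emb_subst :: "var \<Rightarrow> 'a :: comm_ring_1 series" where
  "emb_subst v = (case v of State s \<Rightarrow> (case s of X \<Rightarrow> xv | Y \<Rightarrow> yv\<^sup>2 + zv\<^sup>2 | Z \<Rightarrow> 0) | _ \<Rightarrow> mvar v)"

definition emb :: "'a :: comm_ring_1 series \<Rightarrow> 'a series" where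
  "emb = msubst emb_subst"

lemma mcoeff_0_simps [simp]:
  "mcoeff (mvar v :: ('v, 'a :: comm_ring_1) mfps) 0 = 0" "mcoeff (1 :: ('v, 'a) mfps) 0 = 1"
  "mcoeff (f * g :: ('v, 'a) mfps) 0 = mcoeff f 0 * mcoeff g 0" "mcoeff (mconst c :: ('v, 'a) mfps) 0 = c"
  "mcoeff (f ^ k :: ('v, 'a) mfps) 0 = mcoeff f 0 ^ k"
proof -
  have "Poly_Mapping.single v (1 :: nat) \<noteq> 0"
    by (metis lookup_single_eq lookup_zero one_neq_zero)
  then show "mcoeff (mvar v :: ('v, 'a) mfps) 0 = 0"
    unfolding mvar_eq_monomial mcoeff_monomial by metis
  show "mcoeff (1 :: ('v, 'a) mfps) 0 = 1"
    by (simp add: one_eq_monomial mcoeff_monomial)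
  then show "mcoeff (f ^ k :: ('v, 'a) mfps) 0 = mcoeff f 0 ^ k"
    by (induction k) (simp_all add: mcoeff_mult_0)
qed (simp_all add: mcoeff_mult_0 mcoeff_mconst)

lemma substitution_emb: "substitution (emb_subst :: var \<Rightarrow> 'a :: comm_ring_1 series)"
proof -
  have "{v. emb_subst v \<noteq> (0 :: 'a series) \<and> emb_subst v \<noteq> (mvar v :: 'a series)} \<subseteq> State ` UNIV"
  proof
    fix v :: var assume "v \<in> {v. emb_subst v \<noteq> (0 :: 'a series) \<and> emb_subst v \<noteq> (mvar v :: 'a series)}"
    then show "v \<in> State ` UNIV"
      by (cases v) (auto simp: emb_subst_def)
  qed
  then have "finite {v. emb_subst v \<noteq> (0 :: 'a series) \<and> emb_subst v \<noteq> (mvar v :: 'a series)}"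
    by (rule finite_subset) simp
  then show ?thesis
    by (simp add: substitution_def emb_subst_def power2_eq_square split: var.splits state.splits)
qed

lemma cont_hom_emb: "cont_hom emb"
  unfolding emb_def by (rule cont_hom_msubst[OF substitution_emb])

lemmas emb_simps = cont_hom_simps[OF cont_hom_emb]

lemma emb_mvar [simp]: "emb xv = xv" "emb yv = yv\<^sup>2 + zv\<^sup>2" "emb zv = 0" "emb tv = tv" "emb (mu j) = mu j"
  by (simp_all add: emb_def emb_subst_def)

definition planar_vars :: "nat \<Rightarrow> var set" where
  "planar_vars q = {State X, State Y} \<union> Param ` {1..q}"

definition planar_monomial :: "nat \<Rightarrow> nat \<Rightarrow> (nat \<Rightarrow>\<^sub>0 nat) \<Rightarrow> (var \<Rightarrow>\<^sub>0 nat)" where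
  "planar_monomial k l m = Poly_Mapping.single (State X) l + Poly_Mapping.single (State Y) (k - l)
     + (\<Sum>j\<in>Poly_Mapping.keys m. Poly_Mapping.single (Param j) (Poly_Mapping.lookup m j))"

lemma lookup_planar_monomial:
  "Poly_Mapping.lookup (planar_monomial k l m) v =
     (case v of State s \<Rightarrow> (case s of X \<Rightarrow> l | Y \<Rightarrow> k - l | Z \<Rightarrow> 0) | Time \<Rightarrow> 0 | Param j \<Rightarrow> Poly_Mapping.lookup m j)"
proof -
  have "(\<Sum>i\<in>Poly_Mapping.keys m. Poly_Mapping.lookup (Poly_Mapping.single (Param i) (Poly_Mapping.lookup m i)) v)
      = (case v of Param j \<Rightarrow> Poly_Mapping.lookup m j | _ \<Rightarrow> 0)"
  proof (cases v)
    case (Param j)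
    have "(\<Sum>i\<in>Poly_Mapping.keys m. Poly_Mapping.lookup (Poly_Mapping.single (Param i) (Poly_Mapping.lookup m i)) v)
        = (\<Sum>i\<in>Poly_Mapping.keys m. if i = j then Poly_Mapping.lookup m i else 0)"
      by (rule sum.cong) (auto simp: Param lookup_single when_def)
    also have "\<dots> = Poly_Mapping.lookup m j"
      by (simp add: sum.delta' not_in_keys_iff_lookup_eq_zero)
    finally show ?thesis
      by (simp add: Param)
  qed (auto simp: lookup_single when_def)
  then show ?thesis
    by (auto simp: planar_monomial_def lookup_add lookup_sum lookup_single when_def split: var.splits state.splits)
qed

lemma inj_Param: "inj Param"
  by (auto intro: injI)

lemma lookup_param_part: "Poly_Mapping.lookup (Poly_Mapping.map_key Param n) j = Poly_Mapping.lookup n (Param j)"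
  by (simp add: map_key.rep_eq[OF inj_Param])

text \<open>
  The pair \<open>(k, l)\<close> and the exponent vector \<open>m\<close> can be read off from the exponents of \<open>x\<close>, \<open>R\<close> and the
  parameters; so the coefficients \<open>\<beta> k l m\<close> with \<open>l \<le> k\<close> are exactly those of a series in these variables.
\<close>

lemma planar_monomial_inverse:
  assumes "n \<in> over (planar_vars q)"
  shows "planar_monomial (Poly_Mapping.lookup n (State X) + Poly_Mapping.lookup n (State Y))
    (Poly_Mapping.lookup n (State X)) (Poly_Mapping.map_key Param n) = n"
proof (rule poly_mapping_eqI)
  fix v
  have "Poly_Mapping.lookup n v = 0" if "v \<notin> planar_vars q"
    using assms that by (auto simp: over_def not_in_keys_iff_lookup_eq_zero[symmetric])
  then have "Poly_Mapping.lookup n (State Z) = 0" "Poly_Mapping.lookup n Time = 0"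
    using assms by (auto simp: over_def planar_vars_def not_in_keys_iff_lookup_eq_zero[symmetric])
  then show "Poly_Mapping.lookup (planar_monomial (Poly_Mapping.lookup n (State X) + Poly_Mapping.lookup n (State Y))
    (Poly_Mapping.lookup n (State X)) (Poly_Mapping.map_key Param n)) v = Poly_Mapping.lookup n v"
    by (auto simp: lookup_planar_monomial lookup_param_part split: var.splits state.splits)
qed

lemma planar_monomial_eqD:
  assumes "planar_monomial k l m = n" "l \<le> k"
  shows "k = Poly_Mapping.lookup n (State X) + Poly_Mapping.lookup n (State Y)"
    "l = Poly_Mapping.lookup n (State X)" "m = Poly_Mapping.map_key Param n"
  using assms(2) unfolding assms(1)[symmetric]
  by (auto simp: lookup_planar_monomial lookup_param_part intro!: poly_mapping_eqI)

lemma in_keys_nat_iff: "v \<in> Poly_Mapping.keys n \<longleftrightarrow> 0 < Poly_Mapping.lookup n v" for n :: "'v \<Rightarrow>\<^sub>0 nat"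
  by (simp add: in_keys_iff)

lemma planar_monomial_over:
  assumes "Poly_Mapping.keys m \<subseteq> {1..q}"
  shows "planar_monomial k l m \<in> over (planar_vars q)"
proof -
  have "v \<in> planar_vars q" if "v \<in> Poly_Mapping.keys (planar_monomial k l m)" for v
  proof -
    have "Poly_Mapping.lookup (planar_monomial k l m) v > 0"
      using that by (simp add: in_keys_nat_iff)
    then show ?thesis
      using assms
      by (cases v) (auto simp: lookup_planar_monomial planar_vars_def in_keys_nat_iff[symmetric] split: state.splits)
  qed
  then show ?thesis
    by (auto simp: over_def)
qed

lemma emb_planar_monomial: "emb (monomial (planar_monomial k l m)) = Zterm k l m"
  by (simp add: planar_monomial_def monomial_mult[symmetric] monomial_sum monomial_single emb_simps
      Zterm_def mu_power_def)

definition euler_field :: "'a series \<Rightarrow> 'a :: field_char_0 vfield" where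
  "euler_field a = smult_fun a Euler"

definition planar_series :: "'a :: field_char_0 coeffs \<Rightarrow> 'a series" where
  "planar_series \<beta> = formal_sum (\<lambda>(k, l, m). mconst (\<beta> k l m) * monomial (planar_monomial k l m))"

lemma planar_series:
  fixes \<beta> :: "'a :: field_char_0 coeffs"
  assumes \<beta>: "\<And>k l m. \<beta> k l m \<noteq> 0 \<Longrightarrow> l \<le> k"
  shows "locally_finite (\<lambda>(k, l, m). mconst (\<beta> k l m) * monomial (planar_monomial k l m))" (is "locally_finite ?F")
    and "l \<le> k \<Longrightarrow> mcoeff (planar_series \<beta>) (planar_monomial k l m) = \<beta> k l m"
    and "(\<And>k l m. \<beta> k l m \<noteq> 0 \<Longrightarrow> planar_monomial k l m \<in> M) \<Longrightarrow> supp (planar_series \<beta>) \<subseteq> M"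
    and "emb (planar_series \<beta>) = Zsum \<beta>"
    and "Esum \<beta> = euler_field (emb (planar_series \<beta>))"
proof -
  have supp1: "{i. mcoeff (?F i) n \<noteq> 0} \<subseteq> {(Poly_Mapping.lookup n (State X) + Poly_Mapping.lookup n (State Y),
      Poly_Mapping.lookup n (State X), Poly_Mapping.map_key Param n)}" for n
  proof
    fix i assume i: "i \<in> {i. mcoeff (?F i) n \<noteq> 0}"
    obtain k l m where klm: "i = (k, l, m)"
      by (cases i)
    with i have "planar_monomial k l m = n" "l \<le> k"
      by (auto simp: mcoeff_monomial intro: \<beta> split: if_splits)
    from planar_monomial_eqD[OF this] show "i \<in> {(Poly_Mapping.lookup n (State X) + Poly_Mapping.lookup n (State Y),
      Poly_Mapping.lookup n (State X), Poly_Mapping.map_key Param n)}"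
      by (simp add: klm)
  qed
  then show lf: "locally_finite ?F"
    unfolding locally_finite_def using finite_subset by blast
  show "mcoeff (planar_series \<beta>) (planar_monomial k l m) = \<beta> k l m" if "l \<le> k"
  proof -
    have "mcoeff (planar_series \<beta>) (planar_monomial k l m) = (\<Sum>i\<in>{(k, l, m)}. mcoeff (?F i) (planar_monomial k l m))"
      unfolding planar_series_def
    proof (rule mcoeff_formal_sum_superset)
      fix i assume i: "i \<notin> {(k, l, m)}"
      show "mcoeff (?F i) (planar_monomial k l m) = 0"
        using supp1[of "planar_monomial k l m"] i planar_monomial_eqD[OF refl that, of m] by auto
    qed simp
    then show ?thesis
      by (simp add: mcoeff_monomial)
  qed
  show "supp (planar_series \<beta>) \<subseteq> M" if M: "\<And>k l m. \<beta> k l m \<noteq> 0 \<Longrightarrow> planar_monomial k l m \<in> M"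
    unfolding planar_series_def
  proof (rule supp_formal_sum)
    fix i
    show "supp (?F i) \<subseteq> M"
      using M by (cases i) (auto simp: supp_def mcoeff_monomial split: if_splits)
  qed
  have F: "emb (?F i) = (\<lambda>(k, l, m). mconst (\<beta> k l m) * Zterm k l m) i" for i
    by (cases i) (simp add: emb_simps emb_planar_monomial)
  show Z: "emb (planar_series \<beta>) = Zsum \<beta>"
    unfolding planar_series_def Zsum_def cont_linear_formal_sum(2)[OF cont_hom_linear[OF cont_hom_emb] lf] F ..
  have lz: "locally_finite (\<lambda>(k, l, m). mconst (\<beta> k l m) * (Zterm k l m :: 'a series))"
    using cont_linear_formal_sum(1)[OF cont_hom_linear[OF cont_hom_emb] lf] unfolding F .
  show "Esum \<beta> = euler_field (emb (planar_series \<beta>))"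
  proof
    fix s
    have "Zsum \<beta> * Euler s = formal_sum (\<lambda>i. (\<lambda>(k, l, m). mconst (\<beta> k l m) * Zterm k l m) i * Euler s)"
      unfolding Zsum_def by (rule cont_linear_formal_sum(2)[OF cont_linear_mult(2)[OF cont_linear_id] lz])
    then show "Esum \<beta> s = euler_field (emb (planar_series \<beta>)) s"
      by (simp add: Z Esum_def Eterm_def smult_fun_def euler_field_def case_prod_unfold mult.assoc)
  qed
qed

definition planar_coeffs :: "'a :: field_char_0 series \<Rightarrow> 'a coeffs" where
  "planar_coeffs g k l m = (if l \<le> k then mcoeff g (planar_monomial k l m) else 0)"

text \<open>
  The set \<open>M\<close> restricts the monomials; it allows \<open>\<S>\<close>, \<open>\<T>\<close> and their graded parts to be described at once.
\<close>

definition planar :: "nat \<Rightarrow> (var \<Rightarrow>\<^sub>0 nat) set \<Rightarrow> 'a :: field_char_0 series set" where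
  "planar q M = {g. supp g \<subseteq> over (planar_vars q) \<and> supp g \<subseteq> M \<and> mcoeff g 0 = 0}"

lemma planar_monomial_0: "planar_monomial 0 0 0 = 0"
  by (simp add: planar_monomial_def)

lemma planar_eq_series:
  "planar q M = planar_series ` {\<beta> \<in> admissible q. \<forall>k l m. \<beta> k l m \<noteq> 0 \<longrightarrow> planar_monomial k l m \<in> M}"
proof safe
  fix g :: "'a series" assume g: "g \<in> planar q M"
  let ?\<beta> = "planar_coeffs g"
  have keys: "Poly_Mapping.keys m \<subseteq> {1..q}" if "planar_monomial k l m \<in> over (planar_vars q)" for k l m
  proof
    fix j assume "j \<in> Poly_Mapping.keys m"
    then have "Param j \<in> Poly_Mapping.keys (planar_monomial k l m)"
      by (simp add: lookup_planar_monomial in_keys_nat_iff)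
    then have "Param j \<in> planar_vars q"
      using that by (auto simp: over_def)
    then show "j \<in> {1..q}"
      by (auto simp: planar_vars_def)
  qed
  have adm: "?\<beta> \<in> {\<beta> \<in> admissible q. \<forall>k l m. \<beta> k l m \<noteq> 0 \<longrightarrow> planar_monomial k l m \<in> M}"
    using g keys by (force simp: planar_coeffs_def admissible_def planar_def supp_def planar_monomial_0 split: if_splits)
  have le: "\<And>k l m. ?\<beta> k l m \<noteq> 0 \<Longrightarrow> l \<le> k"
    by (auto simp: planar_coeffs_def split: if_splits)
  have eq: "planar_series ?\<beta> = g"
  proof (rule mfps_eqI)
    fix n
    have *: "supp (planar_series ?\<beta>) \<subseteq> over (planar_vars q)"
    proof (rule planar_series(3)[OF le])
      show "planar_monomial k l m \<in> over (planar_vars q)" if "?\<beta> k l m \<noteq> 0" for k l m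
        using adm that by (intro planar_monomial_over) (auto simp: admissible_def)
    qed
    show "mcoeff (planar_series ?\<beta>) n = mcoeff g n"
    proof (cases "n \<in> over (planar_vars q)")
      case True
      show ?thesis
        using planar_series(2)[of ?\<beta> "Poly_Mapping.lookup n (State X)"
          "Poly_Mapping.lookup n (State X) + Poly_Mapping.lookup n (State Y)" "Poly_Mapping.map_key Param n", OF le]
        by (simp add: planar_monomial_inverse[OF True] planar_coeffs_def)
    next
      case False
      then show ?thesis
        using supp_subsetD[OF * False] supp_subsetD[OF _ False, of g] g by (simp add: planar_def)
    qed
  qed
  show "g \<in> planar_series ` {\<beta> \<in> admissible q. \<forall>k l m. \<beta> k l m \<noteq> 0 \<longrightarrow> planar_monomial k l m \<in> M}"
    unfolding image_iff by (rule bexI[where x = ?\<beta>, rotated]) (rule adm, rule eq[symmetric])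
next
  fix \<beta> :: "'a coeffs" assume \<beta>: "\<beta> \<in> admissible q" "\<forall>k l m. \<beta> k l m \<noteq> 0 \<longrightarrow> planar_monomial k l m \<in> M"
  have le: "\<And>k l m. \<beta> k l m \<noteq> 0 \<Longrightarrow> l \<le> k"
    using \<beta> by (auto simp: admissible_def)
  have "mcoeff (planar_series \<beta>) 0 = 0"
    using planar_series(2)[of \<beta> 0 0 0, OF le] \<beta>(1) by (simp add: planar_monomial_0 admissible_def)
  moreover have "supp (planar_series \<beta>) \<subseteq> over (planar_vars q)"
  proof (rule planar_series(3)[OF le])
    show "planar_monomial k l m \<in> over (planar_vars q)" if "\<beta> k l m \<noteq> 0" for k l m
      using \<beta> that by (intro planar_monomial_over) (auto simp: admissible_def)
  qed
  moreover have "supp (planar_series \<beta>) \<subseteq> M"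
    by (rule planar_series(3)[OF le]) (use \<beta> in auto)
  ultimately show "planar_series \<beta> \<in> planar q M"
    by (simp add: planar_def)
qed

lemma Zsum_image:
  "Zsum ` {\<beta> \<in> admissible q. \<forall>k l m. \<beta> k l m \<noteq> 0 \<longrightarrow> planar_monomial k l m \<in> M} = emb ` planar q M"
  unfolding planar_eq_series image_image
  by (intro image_cong refl) (rule planar_series(4)[symmetric], auto simp: admissible_def)

lemma Esum_image:
  "Esum ` {\<beta> \<in> admissible q. \<forall>k l m. \<beta> k l m \<noteq> 0 \<longrightarrow> planar_monomial k l m \<in> M}
    = (\<lambda>g. euler_field (emb g)) ` planar q M"
  unfolding planar_eq_series image_image
  by (intro image_cong refl) (rule planar_series(5), auto simp: admissible_def)

lemma Tspace_eq: "Tspace q = emb ` planar q UNIV"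
  and Sspace_eq: "Sspace q = (\<lambda>g. euler_field (emb g)) ` planar q UNIV"
  unfolding Zsum_image[symmetric] Esum_image[symmetric] Tspace_def Sspace_def by simp_all

text \<open>
  The grade \<open>\<delta>\<^sub>\<alpha>\<close> as a weight: \<open>2 k - l = l + 2 (k - l)\<close> gives \<open>x\<close> weight \<open>1\<close> and \<open>R\<close> weight \<open>2\<close>.
\<close>

definition grade_wt :: "nat \<Rightarrow> var \<Rightarrow> nat" where
  "grade_wt r v = (case v of State s \<Rightarrow> (case s of X \<Rightarrow> 1 | Y \<Rightarrow> 2 | Z \<Rightarrow> 0) | Time \<Rightarrow> 0 | Param j \<Rightarrow> alpha r j)"

lemma wt_sum: "wt c (\<Sum>i\<in>I. F i) = (\<Sum>i\<in>I. wt c (F i))"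
  by (induction I rule: infinite_finite_induct) auto

lemma wt_planar_monomial: "l \<le> k \<Longrightarrow> wt (grade_wt r) (planar_monomial k l m) = grade r k l m"
  by (simp add: planar_monomial_def wt_sum grade_def) (simp add: grade_wt_def)

lemma admissible_grade_eq:
  "admissible_grade q r i = {\<beta> \<in> admissible q. \<forall>k l m. \<beta> k l m \<noteq> 0 \<longrightarrow> planar_monomial k l m \<in> eq_wt (grade_wt r) i}"
  by (auto simp: admissible_grade_def admissible_def eq_wt_def wt_planar_monomial)

lemma Tgrade_eq: "Tgrade q r i = emb ` planar q (eq_wt (grade_wt r) i)"
  and Sgrade_eq: "Sgrade q r i = (\<lambda>g. euler_field (emb g)) ` planar q (eq_wt (grade_wt r) i)"
  unfolding Zsum_image[symmetric] Esum_image[symmetric] Tgrade_def Sgrade_def admissible_grade_eq by simp_all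

section \<open>Flows and the rotation\<close>

lemma derivation_lie_deriv: "derivation (lie_deriv V)"
  unfolding lie_deriv_def[abs_def] by (intro derivation_along_sum derivation_along_scale derivation_pdiff)

lemma cont_linear_lie_deriv: "cont_linear (lie_deriv V)"
  by (rule derivation_along_linear[OF derivation_lie_deriv])

lemma lie_deriv_mvar [simp]:
  "lie_deriv V (mvar (State s)) = V s" "lie_deriv V tv = 0" "lie_deriv V (mu j) = 0"
  by (cases s) (simp_all add: lie_deriv_def pdiff_mvar)

lemma lie_deriv_mult: "lie_deriv V (f * g) = lie_deriv V f * g + f * lie_deriv V g"
  by (rule derivation_along_mult[OF derivation_lie_deriv])

lemma lie_deriv_1 [simp]: "lie_deriv V 1 = 0"
  by (rule derivation_along_1[OF cont_hom_id derivation_lie_deriv])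

lemmas lie_deriv_linear = cont_linear_0[OF cont_linear_lie_deriv] cont_linear_add[OF cont_linear_lie_deriv]
  cont_linear_diff[OF cont_linear_lie_deriv] cont_linear_uminus[OF cont_linear_lie_deriv]
  cont_linear_mconst[OF cont_linear_lie_deriv] cont_linear_sum[OF cont_linear_lie_deriv]

lemma lie_deriv_add_field: "lie_deriv (V + W) f = lie_deriv V f + lie_deriv W f"
  by (simp add: lie_deriv_def plus_fun_def algebra_simps)

lemma lie_deriv_euler_field: "lie_deriv (euler_field a) f = a * lie_deriv Euler f"
  by (simp add: lie_deriv_def euler_field_def smult_fun_def algebra_simps)

lemma supp_lie_deriv:
  assumes V: "\<And>s. supp (V s) \<subseteq> ge_deg (Suc d)" and f: "supp f \<subseteq> ge_deg k"
  shows "supp (lie_deriv V f) \<subseteq> ge_deg (k + d)"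
  unfolding lie_deriv_def
proof (rule supp_sum)
  fix s
  have "supp (V s * pdiff (State s) f) \<subseteq> ge_deg (Suc d + (k - 1))"
    using supp_mult_ge[OF V supp_pdiff_ge[OF f, of "State s"]] by simp
  then show "supp (V s * pdiff (State s) f) \<subseteq> ge_deg (k + d)"
    by (rule ge_wt_mono) simp
qed

lemma substitution_state:
  assumes "\<And>s. mcoeff (\<phi> s) 0 = 0"
  shows "substitution (state_subst \<phi>)"
proof -
  have "{v. state_subst \<phi> v \<noteq> 0 \<and> state_subst \<phi> v \<noteq> mvar v} \<subseteq> State ` UNIV"
  proof
    fix v assume "v \<in> {v. state_subst \<phi> v \<noteq> 0 \<and> state_subst \<phi> v \<noteq> mvar v}"
    then show "v \<in> State ` UNIV"
      by (cases v) (auto simp: state_subst_def)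
  qed
  then have "finite {v. state_subst \<phi> v \<noteq> 0 \<and> state_subst \<phi> v \<noteq> mvar v}"
    by (rule finite_subset) simp
  then show ?thesis
    using assms by (simp add: substitution_def state_subst_def split: var.splits)
qed

lemma exp_derivation_mcoeff_0: "raises_degree D \<Longrightarrow> mcoeff (exp_derivation D f) 0 = mcoeff f 0"
  using exp_derivation_head[of D f] supp_ge_deg_1_iff[of "exp_derivation D f - f"] by simp

text \<open>
  Both sides are continuous homomorphisms that agree on the variables.
\<close>

lemma exp_derivation_eq_msubst:
  assumes D: "derivation D" and deg: "raises_degree D"
    and fixed: "D tv = 0" "\<And>j. D (mu j) = 0"
    and \<phi>: "\<And>s. \<phi> s = exp_derivation D (mvar (State s))"
  shows "msubst (state_subst \<phi>) f = exp_derivation D f"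
proof (rule cont_hom_eq[where L = "msubst (state_subst \<phi>)" and M = "exp_derivation D"])
  show "cont_hom (msubst (state_subst \<phi>))"
    by (intro cont_hom_msubst substitution_state) (simp add: \<phi> exp_derivation_mcoeff_0[OF deg])
  show "cont_hom (exp_derivation D)"
    by (rule cont_hom_exp_derivation[OF D deg])
  show "msubst (state_subst \<phi>) (mvar v) = exp_derivation D (mvar v)" for v
    by (cases v) (simp_all add: state_subst_def \<phi> exp_derivation_fixed[OF derivation_along_linear[OF D]] fixed)
qed

lemma funpow_scaled_derivation:
  assumes "derivation D" "D \<tau> = 0"
  shows "((\<lambda>f. \<tau> * D f) ^^ n) f = \<tau> ^ n * (D ^^ n) f"
  by (induction n) (simp_all add: derivation_along_mult[OF assms(1)] derivation_power[OF assms(1)] assms(2) mult_ac)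

lemma flow_eq: "lie_deriv V \<tau> = 0 \<Longrightarrow> flow \<tau> V s = exp_derivation (\<lambda>f. \<tau> * lie_deriv V f) (mvar (State s))"
  by (simp add: flow_def exp_derivation_def funpow_scaled_derivation[OF derivation_lie_deriv] mult.assoc)

lemma exp_derivation_commute:
  fixes D :: "('v, 'a :: field_char_0) mfps \<Rightarrow> ('v, 'a) mfps"
  assumes D: "raises_degree D" and A: "cont_linear A" and AD: "\<And>f. A (D f) = D' (A f)"
  shows "A (exp_derivation D f) = exp_derivation D' (A f)"
proof -
  have "A ((D ^^ n) f) = (D' ^^ n) (A f)" for n
    by (induction n) (simp_all add: AD)
  then show ?thesis
    unfolding exp_derivation_def
    by (simp add: cont_linear_formal_sum(2)[OF A locally_finite_exp[OF D]] cont_linear_mconst[OF A])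
qed

lemma Euler_simps [simp]:
  "Euler X = xv" "Euler Y = mconst (1 / 2) * yv" "Euler Z = mconst (1 / 2) * zv"
  by (simp_all add: Euler_def)

lemma Theta_simps [simp]: "Theta X = 0" "Theta Y = zv" "Theta Z = - yv"
  by (simp_all add: Theta_def)

lemma half_plus_half: "mconst (1 / 2) * f + mconst (1 / 2) * f = (f :: ('v, 'a :: field_char_0) mfps)"
  unfolding distrib_right[symmetric] mconst_simps(3)[symmetric] by (simp add: mconst_simps)

lemma euler_radius: "lie_deriv Euler (yv\<^sup>2 + zv\<^sup>2) = (yv\<^sup>2 + zv\<^sup>2 :: 'a :: field_char_0 series)"
proof -
  have "lie_deriv Euler (yv\<^sup>2 + zv\<^sup>2) = (mconst (1 / 2) * (yv * yv) + mconst (1 / 2) * (yv * yv))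
      + (mconst (1 / 2) * (zv * zv) + mconst (1 / 2) * (zv * zv) :: 'a series)"
    by (simp add: power2_eq_square lie_deriv_mult lie_deriv_linear mult_ac add_ac)
  then show ?thesis
    by (simp only: half_plus_half power2_eq_square)
qed

text \<open>
  Since \<open>E x = x\<close> and \<open>E R = R\<close>, this is \<open>E\<close> in the variables \<open>x\<close> and \<open>R\<close>.
\<close>

definition planar_euler :: "'a :: comm_ring_1 series \<Rightarrow> 'a series" where
  "planar_euler f = xv * pdiff (State X) f + yv * pdiff (State Y) f"

lemma derivation_along_plus:
  "derivation_along L D \<Longrightarrow> derivation_along L D' \<Longrightarrow> derivation_along L (\<lambda>f. D f + D' f)"
  by (simp add: derivation_along_def cont_linear_plus algebra_simps)

lemma derivation_planar_euler: "derivation planar_euler"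
  unfolding planar_euler_def[abs_def] by (intro derivation_along_plus derivation_along_scale derivation_pdiff)

lemma lie_deriv_emb: "lie_deriv Euler (emb f) = emb (planar_euler f)"
  by (rule derivation_along_eq[OF cont_hom_emb derivation_along_compose_left[OF cont_hom_emb derivation_lie_deriv]
        derivation_along_compose_right[OF cont_hom_emb derivation_planar_euler]],
      rename_tac v, case_tac v rule: var.exhaust, rename_tac s, case_tac s)
     (simp_all add: planar_euler_def pdiff_mvar emb_simps euler_radius lie_deriv_linear(1))

lemma Theta_emb: "lie_deriv Theta (emb f) = 0"
  by (rule derivation_along_eq[OF cont_hom_emb derivation_along_compose_left[OF cont_hom_emb derivation_lie_deriv]
        derivation_along_zero],
      rename_tac v, case_tac v rule: var.exhaust, rename_tac s, case_tac s)
     (simp_all add: power2_eq_square lie_deriv_mult lie_deriv_linear)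

lemma derivations_commute:
  assumes "derivation D" "derivation D'" "\<And>v. D (D' (mvar v)) = D' (D (mvar v))"
  shows "D (D' f) = D' (D f)"
proof -
  have "D (D' f) - D' (D f) = 0"
    using derivation_along_eq[OF cont_hom_id derivation_commutator[OF assms(1,2)] derivation_along_zero, of f]
    by (simp add: assms(3))
  then show ?thesis by simp
qed

lemma Theta_euler_commute: "lie_deriv Euler (lie_deriv Theta f) = lie_deriv Theta (lie_deriv Euler f)"
proof (rule derivations_commute[OF derivation_lie_deriv derivation_lie_deriv])
  fix v
  show "lie_deriv Euler (lie_deriv Theta (mvar v)) = lie_deriv Theta (lie_deriv Euler (mvar v :: 'a :: field_char_0 series))"
  proof (cases v)
    case (State s)
    then show ?thesis by (cases s) (simp_all add: lie_deriv_linear)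
  qed (simp_all add: lie_deriv_linear)
qed

text \<open>
  The rotation commutes with every \<open>u \<in> \<S>\<close>; hence its flow \<open>\<phi>\<close> satisfies \<open>D\<phi> u = u \<circ> \<phi>\<close>, and only the time
  derivative of \<open>\<phi>\<close> contributes to the transformed field.
\<close>

lemma rotation_flow:
  fixes \<epsilon> :: "'a :: field_char_0" and g :: "'a series"
  defines "\<phi> \<equiv> flow (mconst \<epsilon> * tv) Theta" and "u \<equiv> euler_field (emb g)"
  shows "pdiff Time (\<phi> s) = mconst \<epsilon> * msubst (state_subst \<phi>) (Theta s)"
    and "lie_deriv u (\<phi> s) = msubst (state_subst \<phi>) (u s)"
    and "lie_deriv Theta (\<phi> s) = msubst (state_subst \<phi>) (Theta s)"
    and "cont_hom (msubst (state_subst \<phi>))"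
proof -
  let ?\<tau> = "mconst \<epsilon> * tv :: 'a series" and ?T = "lie_deriv (Theta :: 'a vfield)"
  let ?D = "\<lambda>f. ?\<tau> * ?T f"
  have \<tau>: "lie_deriv V ?\<tau> = 0" for V
    by (simp add: lie_deriv_linear)
  have D: "derivation ?D"
    by (intro derivation_along_scale derivation_lie_deriv)
  have "supp (Theta s :: 'a series) \<subseteq> ge_deg (Suc 0)" for s
    by (cases s) (simp_all add: supp_ge_deg_1_iff)
  then have T: "supp f \<subseteq> ge_deg k \<Longrightarrow> supp (?T f) \<subseteq> ge_deg k" for f k
    using supp_lie_deriv[of "Theta :: 'a vfield" 0 f k] by simp
  have "supp ?\<tau> \<subseteq> ge_deg 1"
    by (simp add: supp_ge_deg_1_iff)
  then have deg: "raises_degree ?D"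
    unfolding raises_degree_def using supp_mult_ge[OF _ T, of ?\<tau>] by fastforce
  have \<phi>: "\<phi> s = exp_derivation ?D (mvar (State s))" for s
    unfolding \<phi>_def by (rule flow_eq[OF \<tau>])
  have sub: "msubst (state_subst \<phi>) f = exp_derivation ?D f" for f
    by (rule exp_derivation_eq_msubst[OF D deg _ _ \<phi>]) simp_all
  have "msubst (state_subst \<phi>) = exp_derivation ?D"
    using sub by blast
  then show "cont_hom (msubst (state_subst \<phi>))"
    using cont_hom_exp_derivation[OF D deg] by metis
  have TD: "?T (?D f) = ?D (?T f)" for f
    by (simp add: lie_deriv_mult[of _ ?\<tau>] \<tau>)
  show 3: "?T (\<phi> s) = msubst (state_subst \<phi>) (Theta s)" for s
    unfolding sub \<phi> by (subst exp_derivation_commute[OF deg cont_linear_lie_deriv TD]) simp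
  have "lie_deriv u (?D f) = ?D (lie_deriv u f)" for f
  proof -
    have "lie_deriv Euler (?D f) = ?D (lie_deriv Euler f)"
      by (simp add: lie_deriv_mult[of _ ?\<tau>] \<tau> Theta_euler_commute)
    moreover have "?T (emb g * lie_deriv Euler f) = emb g * ?T (lie_deriv Euler f)"
      by (simp add: lie_deriv_mult[of _ "emb g"] Theta_emb)
    ultimately show ?thesis
      by (simp add: u_def lie_deriv_euler_field mult_ac)
  qed
  then show "lie_deriv u (\<phi> s) = msubst (state_subst \<phi>) (u s)"
    unfolding sub \<phi> by (subst exp_derivation_commute[OF deg cont_linear_lie_deriv]) simp_all
  have dt_T: "pdiff Time (?T f) = ?T (pdiff Time f)" for f
  proof (rule derivations_commute[OF derivation_pdiff derivation_lie_deriv])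
    fix v
    show "pdiff Time (?T (mvar v)) = ?T (pdiff Time (mvar v))"
    proof (cases v)
      case (State s)
      then show ?thesis
        by (cases s) (simp_all add: lie_deriv_linear pdiff_mvar cont_linear_0[OF cont_linear_pdiff]
            cont_linear_uminus[OF cont_linear_pdiff])
    qed (simp_all add: lie_deriv_linear pdiff_mvar cont_linear_0[OF cont_linear_pdiff]
          derivation_along_1[OF cont_hom_id derivation_lie_deriv])
  qed
  have dt_D: "pdiff Time (?D f) = mconst \<epsilon> * ?T f + ?D (pdiff Time f)" for f
    by (simp add: derivation_along_mult[OF derivation_pdiff] derivation_mconst[OF derivation_pdiff] pdiff_mvar dt_T)
  have pow_T: "?T ((?D ^^ n) f) = (?D ^^ n) (?T f)" for n f
  proof (induction n)
    case (Suc n)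
    have "?T ((?D ^^ Suc n) f) = ?D (?T ((?D ^^ n) f))"
      using TD[of "(?D ^^ n) f"] by simp
    also have "\<dots> = (?D ^^ Suc n) (?T f)"
      unfolding Suc by simp
    finally show ?case .
  qed simp
  have dt_pow: "pdiff Time ((?D ^^ Suc n) f) = mconst \<epsilon> * (of_nat (Suc n) * ?T ((?D ^^ n) f))"
    if "pdiff Time f = 0" for n f
  proof (induction n)
    case 0
    then show ?case
      by (simp add: dt_D that lie_deriv_linear)
  next
    case (Suc n)
    have "?D (mconst \<epsilon> * (of_nat (Suc n) * ?T ((?D ^^ n) f))) = mconst \<epsilon> * (of_nat (Suc n) * ?T ((?D ^^ Suc n) f))"
      by (simp only: mconst_of_nat[symmetric] cont_linear_mconst[OF derivation_along_linear[OF D]] TD funpow.simps comp_def)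
    then show ?case
      by (subst funpow.simps(2), unfold comp_def dt_D Suc) (simp add: algebra_simps)
  qed
  show "pdiff Time (\<phi> s) = mconst \<epsilon> * msubst (state_subst \<phi>) (Theta s)"
  proof -
    let ?v = "mvar (State s) :: 'a series" and ?c = "\<lambda>n. mconst (1 / fact n) :: 'a series"
    note lf = locally_finite_exp[OF deg, of ?v]
    have v: "pdiff Time ?v = 0"
      by (simp add: pdiff_mvar)
    have "pdiff Time (\<phi> s) = formal_sum (\<lambda>n. ?c n * pdiff Time ((?D ^^ n) ?v))"
      unfolding \<phi> exp_derivation_def
      by (simp add: cont_linear_formal_sum(2)[OF cont_linear_pdiff lf] cont_linear_mconst[OF cont_linear_pdiff])
    also have "\<dots> = formal_sum (\<lambda>n. ?c (Suc n) * pdiff Time ((?D ^^ Suc n) ?v))"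
      using cont_linear_formal_sum(1)[OF cont_linear_pdiff lf]
      by (subst formal_sum_Suc) (simp_all add: cont_linear_mconst[OF cont_linear_pdiff] v del: fact_Suc)
    also have "(\<lambda>n. ?c (Suc n) * pdiff Time ((?D ^^ Suc n) ?v)) = (\<lambda>n. mconst \<epsilon> * ?T (?c n * (?D ^^ n) ?v))"
    proof
      fix n
      have "of_nat (Suc n) * ?c (Suc n) = ?c n"
        unfolding mconst_of_nat[symmetric] mconst_mult[symmetric] by (simp add: field_simps del: of_nat_Suc)
      then have "?c (Suc n) * (mconst \<epsilon> * (of_nat (Suc n) * ?T ((?D ^^ n) ?v))) = mconst \<epsilon> * (?c n * ?T ((?D ^^ n) ?v))"
        by (metis (no_types, lifting) mult.assoc mult.left_commute)
      then show "?c (Suc n) * pdiff Time ((?D ^^ Suc n) ?v) = mconst \<epsilon> * ?T (?c n * (?D ^^ n) ?v)"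
        unfolding dt_pow[OF v] lie_deriv_linear(5) .
    qed
    also have "formal_sum (\<lambda>n. mconst \<epsilon> * ?T (?c n * (?D ^^ n) ?v)) = mconst \<epsilon> * ?T (\<phi> s)"
      unfolding \<phi> exp_derivation_def
      by (rule cont_linear_formal_sum(2)[OF cont_linear_mult(1)[OF cont_linear_lie_deriv] lf, symmetric])
    finally show ?thesis
      unfolding 3 .
  qed
qed

lemma remove_rotation: "remove_rotation (Theta + euler_field (emb g)) (euler_field (emb g))"
  for g :: "'a :: field_char_0 series"
  unfolding remove_rotation_def change_of_coords_def
  using rotation_flow(1,3,4)[where \<epsilon> = "1 :: 'a"] rotation_flow(2)[where \<epsilon> = "1 :: 'a" and g = g] by (simp add: mconst_simps cont_hom_add)

lemma restore_rotation: "restore_rotation (euler_field (emb g)) (Theta + euler_field (emb g))"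
  for g :: "'a :: field_char_0 series"
  unfolding restore_rotation_def change_of_coords_def
  using rotation_flow(1,3,4)[where \<epsilon> = "- 1 :: 'a"] rotation_flow(2)[where \<epsilon> = "- 1 :: 'a" and g = g] by (simp add: mconst_simps lie_deriv_add_field)

section \<open>Cylindrical coordinates\<close>

text \<open>
  Insertion of a variable into a univariate series is multiplicative. This transfers
  \<open>sin\<^sup>2 + cos\<^sup>2 = 1\<close> from univariate series.
\<close>

lemma of_fps_mult:
  fixes f g :: "'b :: field_char_0 fps" and v :: 'v
  shows "formal_sum (\<lambda>n. mconst (fps_nth f n) * mvar v ^ n) * formal_sum (\<lambda>n. mconst (fps_nth g n) * mvar v ^ n)
    = formal_sum (\<lambda>n. mconst (fps_nth (f * g) n) * mvar v ^ n)"
proof -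
  have pow: "supp (mvar v ^ n :: ('v, 'b) mfps) \<subseteq> ge_deg n" for n
    using supp_power_ge[OF supp_mvar_ge[of 1 deg_wt v], of n] by simp
  have summand: "(\<Sum>i\<le>n. (mconst (fps_nth f i) * mvar v ^ i) * (mconst (fps_nth g (n - i)) * mvar v ^ (n - i)))
      = mconst (fps_nth (f * g) n) * (mvar v ^ n :: ('v, 'b) mfps)" for n
  proof -
    have "(mconst (fps_nth f i) * mvar v ^ i) * (mconst (fps_nth g (n - i)) * mvar v ^ (n - i))
        = mconst (fps_nth f i * fps_nth g (n - i)) * (mvar v ^ n :: ('v, 'b) mfps)" if "i \<le> n" for i
      using that power_add[of "mvar v :: ('v, 'b) mfps" i "n - i"] by (simp add: mconst_mult mult_ac)
    moreover have "mconst (\<Sum>i\<le>n. F i) = (\<Sum>i\<le>n. mconst (F i) :: ('v, 'b) mfps)" for F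
      by (rule mfps_eqI) (simp add: mcoeff_mconst)
    ultimately show ?thesis
      by (simp add: fps_mult_nth atMost_atLeast0[symmetric] sum_distrib_right)
  qed
  have "formal_sum (\<lambda>n. mconst (fps_nth f n) * mvar v ^ n) * formal_sum (\<lambda>n. mconst (fps_nth g n) * mvar v ^ n)
      = formal_sum (\<lambda>n. \<Sum>i\<le>n. (mconst (fps_nth f i) * mvar v ^ i) * (mconst (fps_nth g (n - i)) * mvar v ^ (n - i)))"
    by (intro formal_sum_mult supp_mconst_mult pow)
  also have "\<dots> = formal_sum (\<lambda>n. mconst (fps_nth (f * g) n) * mvar v ^ n)"
    by (simp only: summand)
  finally show ?thesis .
qed

lemma sin_cos_theta: "sin_theta\<^sup>2 + cos_theta\<^sup>2 = (1 :: 'a :: field_char_0 series)"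
proof -
  have lf: "locally_finite (\<lambda>n. mconst (fps_nth f n) * theta ^ n)" for f :: "'a fps"
    unfolding theta_def using supp_power_ge[OF supp_mvar_ge[of 1 deg_wt "State Z"]]
    by (intro locally_finite_deg supp_mconst_mult) simp
  have "sin_theta\<^sup>2 + cos_theta\<^sup>2 = formal_sum (\<lambda>n. mconst (fps_nth (fps_sin 1 * fps_sin 1) n) * theta ^ n)
      + (formal_sum (\<lambda>n. mconst (fps_nth (fps_cos 1 * fps_cos 1) n) * theta ^ n) :: 'a series)"
    unfolding power2_eq_square sin_theta_def cos_theta_def theta_def of_fps_mult ..
  also have "\<dots> = formal_sum (\<lambda>n. mconst (fps_nth (fps_sin 1 * fps_sin 1 + fps_cos 1 * fps_cos 1) n) * theta ^ n)"
  proof (rule mfps_eqI)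
    fix p
    have fin: "finite {n. mcoeff (mconst (fps_nth f n) * theta ^ n) p \<noteq> 0}" for f :: "'a fps"
      using lf[of f] by (simp only: locally_finite_def)
    show "mcoeff (formal_sum (\<lambda>n. mconst (fps_nth (fps_sin 1 * fps_sin 1) n) * theta ^ n)
      + (formal_sum (\<lambda>n. mconst (fps_nth (fps_cos 1 * fps_cos 1) n) * theta ^ n) :: 'a series)) p
      = mcoeff (formal_sum (\<lambda>n. mconst (fps_nth (fps_sin 1 * fps_sin 1 + fps_cos 1 * fps_cos 1) n) * theta ^ n)) p"
      unfolding mcoeff_simps mcoeff_formal_sum
      by (subst Sum_any.distrib[symmetric]) (use fin in \<open>simp_all add: mconst_simps distrib_right\<close>)
  qed
  also have "fps_sin 1 * fps_sin 1 + fps_cos 1 * fps_cos 1 = (1 :: 'a fps)"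
    using fps_sin_cos_sum_of_squares[of "1 :: 'a"] by (simp add: power2_eq_square add.commute)
  also have "formal_sum (\<lambda>n. mconst (fps_nth 1 n) * theta ^ n) = (1 :: 'a series)"
    by (subst formal_sum_finite[of "{0}"]) (simp_all add: mconst_simps)
  finally show ?thesis .
qed

lemma pdiff_of_fps:
  fixes f :: "'b :: field_char_0 fps" and u v :: 'v
  shows "pdiff u (formal_sum (\<lambda>n. mconst (fps_nth f n) * mvar v ^ n))
    = (if u = v then formal_sum (\<lambda>n. mconst (fps_nth (fps_deriv f) n) * mvar v ^ n) else 0)"
proof -
  have lf: "locally_finite (\<lambda>n. mconst (fps_nth f n) * (mvar v ^ n :: ('v, 'b) mfps))"
    using supp_power_ge[OF supp_mvar_ge[of 1 deg_wt v]] by (intro locally_finite_deg supp_mconst_mult) simp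
  have d: "pdiff u (mconst c * mvar v ^ n) = (if u = v then of_nat n * (mconst c * mvar v ^ (n - 1)) else 0 :: ('v, 'b) mfps)"
    for c n
    by (simp add: cont_linear_mconst[OF cont_linear_pdiff] derivation_power[OF derivation_pdiff] pdiff_mvar mult_ac)
  have "pdiff u (formal_sum (\<lambda>n. mconst (fps_nth f n) * mvar v ^ n))
    = formal_sum (\<lambda>n. if u = v then of_nat n * (mconst (fps_nth f n) * mvar v ^ (n - 1)) else 0 :: ('v, 'b) mfps)"
    unfolding cont_linear_formal_sum(2)[OF cont_linear_pdiff lf] d ..
  also have "\<dots> = (if u = v then formal_sum (\<lambda>n. mconst (fps_nth (fps_deriv f) n) * mvar v ^ n) else 0)"
  proof (cases "u = v")
    case True
    show ?thesis
      using cont_linear_formal_sum(1)[OF cont_linear_pdiff lf, of u] unfolding d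
      by (subst formal_sum_Suc) (simp_all add: True mconst_mult mconst_of_nat mult_ac flip: of_nat_Suc)
  next
    case False
    then show ?thesis
      by (subst formal_sum_finite[of "{}"]) simp_all
  qed
  finally show ?thesis .
qed

lemma pdiff_sin_cos_theta:
  "pdiff v sin_theta = (if v = State Z then cos_theta else 0 :: 'a :: field_char_0 series)"
  "pdiff v cos_theta = (if v = State Z then - sin_theta else 0 :: 'a series)"
proof -
  show "pdiff v sin_theta = (if v = State Z then cos_theta else 0 :: 'a series)"
    unfolding sin_theta_def cos_theta_def theta_def pdiff_of_fps by (simp add: fps_sin_deriv)
  have "locally_finite (\<lambda>n. mconst (fps_nth (fps_sin (1 :: 'a)) n) * mvar (State Z) ^ n)"
    using supp_power_ge[OF supp_mvar_ge[of 1 deg_wt "State Z"]] by (intro locally_finite_deg supp_mconst_mult) simp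
  from cont_linear_formal_sum(2)[OF cont_linear_mult_left this, of "- 1"]
  have "formal_sum (\<lambda>n. mconst (- fps_nth (fps_sin 1) n) * mvar (State Z) ^ n)
      = - formal_sum (\<lambda>n. mconst (fps_nth (fps_sin 1) n) * mvar (State Z) ^ n :: 'a series)"
    by (simp add: mconst_simps)
  then show "pdiff v cos_theta = (if v = State Z then - sin_theta else 0 :: 'a series)"
    unfolding sin_theta_def cos_theta_def theta_def pdiff_of_fps by (simp add: fps_cos_deriv)
qed

lemma cylindrical_simps [simp]:
  "cylindrical X = xv" "cylindrical Y = rho * sin_theta" "cylindrical Z = rho * cos_theta"
  "cylindrical_system g X = xv * g" "cylindrical_system g Y = mconst (1 / 2) * rho * g" "cylindrical_system g Z = 1"
  by (simp_all add: cylindrical_def cylindrical_system_def)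

lemma cont_hom_cylindrical: "cont_hom (msubst (state_subst (cylindrical :: 'a :: field_char_0 vfield)))"
proof (intro cont_hom_msubst substitution_state)
  show "mcoeff (cylindrical s :: 'a series) 0 = 0" for s
    by (cases s) (simp_all add: rho_def)
qed

lemma cylindrical_radius: "msubst (state_subst cylindrical) (yv\<^sup>2 + zv\<^sup>2) = (rho\<^sup>2 :: 'a :: field_char_0 series)"
proof -
  have "msubst (state_subst cylindrical) (yv\<^sup>2 + zv\<^sup>2) = (rho * sin_theta)\<^sup>2 + (rho * cos_theta :: 'a series)\<^sup>2"
    by (simp add: cont_hom_simps[OF cont_hom_cylindrical] state_subst_def)
  also have "\<dots> = rho\<^sup>2 * (sin_theta\<^sup>2 + cos_theta\<^sup>2)"
    by (simp add: power_mult_distrib distrib_left)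
  finally show ?thesis
    by (simp add: sin_cos_theta)
qed

text \<open>
  In \<open>(x, \<rho>, \<theta>)\<close> the field \<open>E\<close> is \<open>x \<partial>/\<partial>x + \<rho>/2 \<partial>/\<partial>\<rho>\<close>, and \<open>\<Theta>\<close> is \<open>\<partial>/\<partial>\<theta>\<close>.
\<close>

lemma change_to_cylindrical:
  fixes g :: "'a :: field_char_0 series"
  assumes "msubst (state_subst cylindrical) g = h"
  shows "change_of_coords cylindrical (Theta + euler_field g) (cylindrical_system h)"
  unfolding change_of_coords_def
proof
  fix s
  note hom = cont_hom_simps[OF cont_hom_cylindrical]
  have var: "msubst (state_subst cylindrical) (mvar (State s)) = (cylindrical s :: 'a series)" for s
    by (simp add: state_subst_def)
  have lie: "lie_deriv V sin_theta = V Z * cos_theta" "lie_deriv V cos_theta = - (V Z * sin_theta)"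
    "lie_deriv V rho = V Y" for V :: "'a vfield"
    by (simp_all add: lie_deriv_def pdiff_sin_cos_theta rho_def pdiff_mvar)
  have "pdiff Time (cylindrical s :: 'a series) = 0"
    by (cases s) (simp_all add: derivation_along_mult[OF derivation_pdiff] pdiff_sin_cos_theta rho_def pdiff_mvar)
  then show "pdiff Time (cylindrical s) + lie_deriv (cylindrical_system h) (cylindrical s)
      = msubst (state_subst cylindrical) ((Theta + euler_field g) s)"
    by (cases s)
       (simp_all add: lie_deriv_mult lie hom var euler_field_def smult_fun_def assms mult_ac del: msubst_mvar)
qed

section \<open>State changes along the orbits of the Euler field\<close>

text \<open>
  The variables \<open>R\<close> and \<open>\<mu>\<close> of the series \<open>h\<close> whose graph \<open>x = - h\<close> is the zero set.
\<close>

definition base_vars :: "nat \<Rightarrow> var set" where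
  "base_vars q = insert (State Y) (Param ` {1..q})"

lemma base_subset_planar: "base_vars q \<subseteq> planar_vars q"
  by (auto simp: base_vars_def planar_vars_def)

lemma over_mono: "A \<subseteq> B \<Longrightarrow> over A \<subseteq> over B"
  by (auto simp: over_def)

lemma supp_base_planar: "supp f \<subseteq> over (base_vars q) \<Longrightarrow> supp f \<subseteq> over (planar_vars q)"
  using over_mono[OF base_subset_planar] by blast

definition radius_wt :: "var \<Rightarrow> nat" where
  "radius_wt v = (if v = State Y then 1 else 0)"

lemma wt_mono: "(\<And>v. c v \<le> d v) \<Longrightarrow> wt c n \<le> wt d n"
  unfolding wt_def by (intro sum_mono mult_right_mono) simp_all

lemma ge_wt_weight_mono: "supp f \<subseteq> ge_wt c k \<Longrightarrow> (\<And>v. c v \<le> d v) \<Longrightarrow> supp f \<subseteq> ge_wt d k"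
  using wt_mono[of c d] by (force simp: ge_wt_def intro: le_trans)

lemma mcoeff_mvar_pdiff: "mcoeff (mvar v * pdiff v f) n = of_nat (Poly_Mapping.lookup n v) * mcoeff f n"
  for f :: "('v, 'a :: comm_ring_1) mfps"
proof (cases "Poly_Mapping.lookup n v = 0")
  case True
  then have "\<nexists>b. n = Poly_Mapping.single v 1 + b"
    by (auto simp: lookup_add)
  then show ?thesis
    unfolding mvar_eq_monomial mcoeff_monomial_mult by (simp add: True)
next
  case False
  then have n: "n = Poly_Mapping.single v 1 + (n - Poly_Mapping.single v 1)" (is "n = _ + ?m")
    by (intro poly_mapping_eqI) (auto simp: lookup_add lookup_minus lookup_single when_def)
  have "mcoeff (mvar v * pdiff v f) n = mcoeff (pdiff v f) ?m"
    unfolding mvar_eq_monomial by (subst n) simp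
  also have "\<dots> = of_nat (Poly_Mapping.lookup n v) * mcoeff f n"
  proof -
    have "?m + Poly_Mapping.single v 1 = n"
      using n by (simp add: add.commute)
    moreover have "Poly_Mapping.lookup ?m v + 1 = Poly_Mapping.lookup n v"
      using False by (simp add: lookup_minus)
    ultimately show ?thesis
      unfolding pdiff_coeff by simp
  qed
  finally show ?thesis .
qed

lemma supp_planar_euler: "supp f \<subseteq> M \<Longrightarrow> supp (planar_euler f) \<subseteq> M"
  for f :: "'a :: comm_ring_1 series"
  by (rule supp_subsetI) (auto simp: planar_euler_def mcoeff_mvar_pdiff supp_def)

lemma planar_euler_simps [simp]:
  "planar_euler xv = xv" "planar_euler yv = yv" "planar_euler (mu j) = 0" "planar_euler 1 = 0"
  by (simp_all add: planar_euler_def pdiff_mvar derivation_along_1[OF cont_hom_id derivation_pdiff])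

lemma mcoeff_planar_euler_0 [simp]: "mcoeff (planar_euler f) 0 = 0"
  by (simp add: planar_euler_def)

text \<open>
  If \<open>E v = c v\<close>, then \<open>f E (v a) = v f (c a + E a)\<close>. So the flow of \<open>f E\<close> multiplies \<open>v\<close> by
  \<open>stretch f c\<close>, which depends on \<open>v\<close> only through its eigenvalue \<open>c\<close>.
\<close>

definition stretch_op :: "'a :: field_char_0 series \<Rightarrow> 'a \<Rightarrow> 'a series \<Rightarrow> 'a series" where
  "stretch_op f c a = f * (mconst c * a + planar_euler a)"

definition stretch :: "'a :: field_char_0 series \<Rightarrow> 'a \<Rightarrow> 'a series" where
  "stretch f c = formal_sum (\<lambda>n. mconst (1 / fact n) * (stretch_op f c ^^ n) 1)"

lemma supp_stretch_op:
  "supp f \<subseteq> ge_wt w 1 \<Longrightarrow> supp a \<subseteq> ge_wt w k \<Longrightarrow> supp (stretch_op f c a) \<subseteq> ge_wt w (Suc k)"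
  unfolding stretch_op_def
  using supp_mult_ge[of f w 1] by (simp add: supp_add supp_mconst_mult supp_planar_euler)

lemma supp_stretch_pow: "supp f \<subseteq> ge_wt w 1 \<Longrightarrow> supp ((stretch_op f c ^^ n) 1) \<subseteq> ge_wt w n"
  using supp_funpow[of w "stretch_op f c" 1 0 n] supp_stretch_op[of f w] by simp

lemma supp_stretch_over: "supp f \<subseteq> over A \<Longrightarrow> supp (stretch f c) \<subseteq> over A"
proof -
  assume f: "supp f \<subseteq> over A"
  have "supp ((stretch_op f c ^^ n) 1) \<subseteq> over A" for n
    by (induction n)
       (simp_all add: stretch_op_def f supp_mult_over supp_add supp_mconst_mult supp_planar_euler)
  then show ?thesis
    unfolding stretch_def by (intro supp_formal_sum supp_mconst_mult)
qed

lemma mcoeff_msubst_0: "substitution \<phi> \<Longrightarrow> mcoeff (msubst \<phi> g) 0 = mcoeff g 0"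
  for \<phi> :: "'v \<Rightarrow> ('v, 'b :: comm_ring_1) mfps"
proof -
  assume \<phi>: "substitution \<phi>"
  have "supp (msubst \<phi> (g - mconst (mcoeff g 0))) \<subseteq> ge_deg (Suc 0)"
  proof (rule supp_msubst_ge[where d = deg_wt])
    show "supp (g - mconst (mcoeff g 0)) \<subseteq> ge_deg (Suc 0)"
      by (simp add: supp_ge_deg_1_iff)
    show "supp (\<phi> v) \<subseteq> ge_wt deg_wt (deg_wt v)" for v
      using \<phi> by (simp add: supp_ge_deg_1_iff substitution_def)
  qed
  then show ?thesis
    by (simp add: supp_ge_deg_1_iff cont_hom_simps[OF cont_hom_msubst[OF \<phi>]])
qed

lemma mcoeff_emb_0 [simp]: "mcoeff (emb g) 0 = mcoeff g 0"
  unfolding emb_def by (rule mcoeff_msubst_0[OF substitution_emb])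

lemma pdiff_outside: "supp g \<subseteq> over A \<Longrightarrow> v \<notin> A \<Longrightarrow> pdiff v g = 0"
  for g :: "('v, 'b :: comm_ring_1) mfps"
proof (rule mfps_eqI)
  fix n :: "'v \<Rightarrow>\<^sub>0 nat"
  assume g: "supp g \<subseteq> over A" "v \<notin> A"
  have "v \<in> Poly_Mapping.keys (n + Poly_Mapping.single v 1)"
    by (simp add: in_keys_nat_iff lookup_add)
  then have "mcoeff g (n + Poly_Mapping.single v 1) = 0"
    using g(2) by (intro supp_subsetD[OF g(1)]) (auto simp: over_def)
  then show "mcoeff (pdiff v g) n = mcoeff 0 n"
    unfolding pdiff_coeff by simp
qed

lemma supp_emb: "supp g \<subseteq> over (planar_vars q) \<Longrightarrow> supp (emb g) \<subseteq> over (- {Time})"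
  unfolding emb_def
proof (erule supp_msubst_over)
  fix v assume "v \<in> planar_vars q"
  then consider "v = State X" | "v = State Y" | j where "v = Param j"
    by (auto simp: planar_vars_def)
  then show "supp (emb_subst v :: 'b :: comm_ring_1 series) \<subseteq> over (- {Time})"
    by cases (simp_all add: emb_subst_def supp_mvar_over supp_add supp_power_over)
qed

context
  fixes f :: "'a :: field_char_0 series"
  assumes f0: "mcoeff f 0 = 0"
begin

lemma supp_deg_f: "supp f \<subseteq> ge_deg 1"
  using f0 by (simp add: supp_ge_deg_1_iff)

lemma locally_finite_stretch: "locally_finite (\<lambda>n. mconst (1 / fact n) * (stretch_op f c ^^ n) 1)"
  by (intro locally_finite_deg supp_mconst_mult supp_stretch_pow supp_deg_f)

lemma stretch_tail: "stretch f c = 1 + formal_sum (\<lambda>n. mconst (1 / fact (Suc n)) * (stretch_op f c ^^ Suc n) 1)"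
  unfolding stretch_def by (subst formal_sum_Suc[OF locally_finite_stretch]) (simp add: mconst_simps)

lemma supp_stretch_minus_1: "supp f \<subseteq> ge_wt w 1 \<Longrightarrow> supp (stretch f c - 1) \<subseteq> ge_wt w 1"
proof -
  assume "supp f \<subseteq> ge_wt w 1"
  then have "supp ((stretch_op f c ^^ Suc n) 1) \<subseteq> ge_wt w 1" for n
    by (rule ge_wt_mono[OF supp_stretch_pow]) simp
  then show ?thesis
    unfolding stretch_tail by (simp del: funpow.simps add: supp_formal_sum supp_mconst_mult)
qed

lemma mcoeff_stretch_0 [simp]: "mcoeff (stretch f c) 0 = 1"
  using supp_stretch_minus_1[OF supp_deg_f, of c] supp_ge_deg_1_iff[of "stretch f c - 1"] by simp

text \<open>
  With \<open>L = emb\<close> this describes the flow in \<open>(x, y, z)\<close>, and with \<open>L\<close> the identity the induced flow in \<open>(x, R)\<close>.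
\<close>

lemma exp_derivation_stretch:
  fixes L D :: "'a series \<Rightarrow> 'a series"
  assumes D: "derivation D" and L: "cont_hom L"
    and v: "D v = L f * (mconst c * v)" and DL: "\<And>a. D (L a) = L f * L (planar_euler a)"
  shows "exp_derivation D v = v * L (stretch f c)"
proof -
  have "(D ^^ n) v = v * L ((stretch_op f c ^^ n) 1)" for n
    by (induction n) (simp_all add: cont_hom_simps[OF L] derivation_along_mult[OF D] v DL stretch_op_def algebra_simps)
  moreover have "cont_linear (\<lambda>a. v * L a)"
    by (intro cont_linear_mult cont_hom_linear L)
  note cont_linear_formal_sum(2)[OF this locally_finite_stretch] cont_linear_mconst[OF this]
  ultimately show ?thesis
    unfolding exp_derivation_def stretch_def by simp
qed

text \<open>
  Conjugating \<open>g E\<close> by the flow \<open>\<phi>\<close> of \<open>f E\<close> gives \<open>g' E\<close> with \<open>g' = (g \<circ> \<phi>) U / (U + E U)\<close>, where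
  \<open>U\<close> is the factor by which \<open>\<phi>\<close> multiplies \<open>x\<close>. The factor of \<open>y\<close> and \<open>z\<close> is a square root of \<open>U\<close>.
\<close>

lemma change_of_coords_euler_flow:
  fixes g :: "'a series"
  defines "U \<equiv> stretch f 1" and "D\<^sub>0 \<equiv> \<lambda>a. f * planar_euler a"
  assumes V: "(U + planar_euler U) * V = 1"
    and over: "supp f \<subseteq> over (planar_vars q)"
  shows "change_of_coords (flow 1 (euler_field (emb f))) (euler_field (emb g))
    (euler_field (emb (U * V * exp_derivation D\<^sub>0 g)))"
    and "raises_degree D\<^sub>0" and "derivation D\<^sub>0"
proof -
  let ?S = "euler_field (emb f)" and ?E = "lie_deriv (Euler :: 'a vfield)"
  let ?D = "lie_deriv ?S"
  have D: "?D a = emb f * ?E a" for a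
    by (rule lie_deriv_euler_field)
  have small: "supp (?S s) \<subseteq> ge_deg (Suc 1)" for s
  proof -
    have "supp (Euler s :: 'a series) \<subseteq> ge_deg 1" "supp (emb f) \<subseteq> ge_deg 1"
      using f0 by (cases s; simp add: supp_ge_deg_1_iff)+
    from supp_mult_ge[OF this(2,1)] show ?thesis
      by (simp add: euler_field_def smult_fun_def)
  qed
  have deg: "raises_degree ?D"
    unfolding raises_degree_def using supp_lie_deriv[OF small] by simp
  have "supp (D\<^sub>0 a) \<subseteq> ge_deg (Suc k)" if "supp a \<subseteq> ge_deg k" for a k
    unfolding D\<^sub>0_def using supp_mult_ge[OF supp_deg_f supp_planar_euler[OF that]] by simp
  then show "raises_degree D\<^sub>0"
    by (simp add: raises_degree_def)
  then have exp_emb: "exp_derivation ?D (emb a) = emb (exp_derivation D\<^sub>0 a)" for a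
    by (rule exp_derivation_commute[OF _ cont_hom_linear[OF cont_hom_emb], symmetric])
       (simp add: D\<^sub>0_def D emb_simps lie_deriv_emb)
  show "derivation D\<^sub>0"
    unfolding D\<^sub>0_def by (intro derivation_along_scale derivation_planar_euler)
  have exp_var: "exp_derivation ?D v = v * emb (stretch f c)" if "?E v = mconst c * v" for v c
    by (rule exp_derivation_stretch[OF derivation_lie_deriv cont_hom_emb]) (simp_all add: D that lie_deriv_emb)
  have hom: "cont_hom (exp_derivation ?D)"
    by (rule cont_hom_exp_derivation[OF derivation_lie_deriv deg])
  have \<phi>: "flow 1 ?S s = exp_derivation ?D (mvar (State s))" for s
    using flow_eq[where V = ?S and \<tau> = 1] by simp
  have subst: "msubst (state_subst (flow 1 ?S)) a = exp_derivation ?D a" for a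
    by (rule exp_derivation_eq_msubst[OF derivation_lie_deriv deg _ _ \<phi>]) simp_all
  define W where "W = emb (stretch f (1 / 2))"
  \<comment> \<open>\<open>y\<^sup>2\<close> has eigenvalue \<open>1\<close> like \<open>x\<close>, and the flow is multiplicative, so \<open>y\<^sup>2 U = (y W)\<^sup>2\<close>.\<close>
  have UW: "emb U = W * W"
  proof -
    have "?E (yv * yv) = mconst 1 * (yv * yv :: 'a series)"
      using half_plus_half[of "yv * yv :: 'a series"] by (simp add: lie_deriv_mult mconst_simps mult_ac)
    then have "yv * yv * emb U = (yv * W) * (yv * W)"
      using exp_var[where v = "yv * yv" and c = 1] exp_var[where v = yv and c = "1 / 2"] cont_hom_mult[OF hom, where f = yv and g = yv] by (simp add: U_def W_def)
    then have "yv * (yv * emb U) = yv * (yv * (W * W))"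
      by (simp add: mult_ac)
    then have "yv * emb U = yv * (W * W)"
      by (rule mvar_mult_cancel)
    then show ?thesis
      by (rule mvar_mult_cancel)
  qed
  have V': "(W * W + (?E W * W + W * ?E W)) * emb V = 1"
    using arg_cong[OF V, of emb] UW by (simp add: emb_simps lie_deriv_emb[symmetric] lie_deriv_mult)
  have U_scale: "emb (U * V) * (mconst 1 * emb U + ?E (emb U)) = mconst 1 * emb U"
    using V' UW by (simp add: mconst_simps emb_simps lie_deriv_mult mult_ac)
  have W_scale: "emb (U * V) * (mconst (1 / 2) * W + ?E W) = mconst (1 / 2) * W"
  proof -
    have two: "mconst (1 / 2) * (?E W * W + W * ?E W) = W * ?E W"
      by (simp only: mult.commute[of "?E W" W] distrib_left half_plus_half)
    have "emb (U * V) * (mconst (1 / 2) * W + ?E W) = W * emb V * (W * (mconst (1 / 2) * W) + W * ?E W)"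
      by (simp add: emb_simps UW algebra_simps)
    also have "W * (mconst (1 / 2) * W) + W * ?E W = mconst (1 / 2) * (W * W + (?E W * W + W * ?E W))"
      using two by (simp add: distrib_left mult.left_commute)
    also have "W * emb V * (mconst (1 / 2) * (W * W + (?E W * W + W * ?E W)))
        = mconst (1 / 2) * W * ((W * W + (?E W * W + W * ?E W)) * emb V)"
      by (simp only: mult_ac)
    finally show ?thesis
      unfolding V' by simp
  qed
  show "change_of_coords (flow 1 ?S) (euler_field (emb g)) (euler_field (emb (U * V * exp_derivation D\<^sub>0 g)))"
    unfolding change_of_coords_def
  proof
    fix s
    obtain c where c: "?E (mvar (State s)) = mconst c * mvar (State s)"
      "emb (U * V) * (mconst c * emb (stretch f c) + ?E (emb (stretch f c))) = mconst c * emb (stretch f c)"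
    proof (cases s)
      case X
      show thesis
        using that[of 1] U_scale by (simp add: X U_def mconst_simps)
    qed (use that[of "1 / 2"] W_scale in \<open>simp_all add: W_def\<close>)
    let ?v = "mvar (State s) :: 'a series" and ?A = "emb (stretch f c)"
    have "supp (?v * ?A) \<subseteq> over (- {Time})"
      by (intro supp_mult_over supp_mvar_over supp_emb[OF supp_stretch_over[OF over]]) simp
    then have "pdiff Time (?v * ?A) = 0"
      by (rule pdiff_outside) simp
    moreover have "lie_deriv (euler_field (emb (U * V * exp_derivation D\<^sub>0 g))) (?v * ?A)
        = emb (exp_derivation D\<^sub>0 g) * ?v * (emb (U * V) * (mconst c * ?A + ?E ?A))"
      by (simp add: lie_deriv_euler_field lie_deriv_mult c(1) emb_simps algebra_simps del: lie_deriv_mvar)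
    moreover have "(Euler s :: 'a series) = mconst c * ?v"
      using c(1) by simp
    then have "euler_field (emb g) s = emb g * (mconst c * ?v)"
      by (simp add: euler_field_def smult_fun_def)
    then have "msubst (state_subst (flow 1 ?S)) (euler_field (emb g) s)
        = emb (exp_derivation D\<^sub>0 g) * ?v * (mconst c * ?A)"
      unfolding subst by (simp add: cont_hom_simps[OF hom] exp_emb exp_var[OF c(1)] mult_ac)
    ultimately show "pdiff Time (flow 1 ?S s) + lie_deriv (euler_field (emb (U * V * exp_derivation D\<^sub>0 g))) (flow 1 ?S s)
        = msubst (state_subst (flow 1 ?S)) (euler_field (emb g) s)"
      unfolding \<phi> exp_var[OF c(1)] c(2) by simp
  qed
qed

end

lemma supp_exp_derivation:
  fixes D :: "('v, 'a :: field_char_0) mfps \<Rightarrow> ('v, 'a) mfps"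
  assumes "\<And>a. supp a \<subseteq> M \<Longrightarrow> supp (D a) \<subseteq> M" "supp f \<subseteq> M"
  shows "supp (exp_derivation D f) \<subseteq> M"
proof -
  have "supp ((D ^^ n) f) \<subseteq> M" for n
    by (induction n) (use assms in simp_all)
  then show ?thesis
    unfolding exp_derivation_def by (intro supp_formal_sum supp_mconst_mult)
qed

definition radius_subst :: "'a :: comm_ring_1 series \<Rightarrow> var \<Rightarrow> 'a series" where
  "radius_subst U v = (if v = State Y then yv * U else mvar v)"

lemma substitution_radius: "substitution (radius_subst U)"
proof -
  have "{v. radius_subst U v \<noteq> 0 \<and> radius_subst U v \<noteq> mvar v} \<subseteq> {State Y}"
    by (auto simp: radius_subst_def)
  then have "finite {v. radius_subst U v \<noteq> 0 \<and> radius_subst U v \<noteq> mvar v}"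
    by (rule finite_subset) simp
  then show ?thesis
    by (simp add: substitution_def radius_subst_def)
qed

lemma euler_field_in_Sspace:
  assumes "g \<in> planar q UNIV"
  shows "euler_field (emb g) \<in> Sspace q"
  using assms by (simp add: Sspace_eq)

text \<open>
  Up to units, only the zero set \<open>x = - h\<close> of the coefficient matters. In the variables scaled by \<open>U\<close> it
  is \<open>x U = - h(R U)\<close>; the time rescaling divides by the units that the conjugation introduces.
\<close>

lemma scaling_step:
  fixes f h :: "'a :: field_char_0 series"
  assumes f: "supp f \<subseteq> over (base_vars q)" "mcoeff f 0 = 0"
    and h: "supp h \<subseteq> over (base_vars q)" "mcoeff h 0 = 0"
    and V: "stretch f 1 * V = 1"
  shows "(elementary_step q)\<^sup>*\<^sup>* (euler_field (emb (xv + h)))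
    (euler_field (emb (xv + V * msubst (radius_subst (stretch f 1)) h)))"
proof -
  define U where "U = stretch f 1"
  let ?D = "\<lambda>a. f * planar_euler a" and ?A = "U + planar_euler U"
  have fp: "supp f \<subseteq> over (planar_vars q)" and hp: "supp h \<subseteq> over (planar_vars q)"
    by (intro supp_base_planar f h)+
  have U: "supp U \<subseteq> over (planar_vars q)" "mcoeff U 0 = 1"
    unfolding U_def using supp_stretch_over[OF fp] mcoeff_stretch_0[OF f(2)] by simp_all
  have A: "supp ?A \<subseteq> over (planar_vars q)" "mcoeff ?A 0 = 1"
    using U by (simp_all add: supp_add supp_planar_euler)
  obtain V' where V': "?A * V' = 1" "mcoeff V' 0 = 1" "supp V' \<subseteq> over (planar_vars q)"
    using unit_inverse[OF A(2)] A(1) by metis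
  obtain V'' where "U * V'' = 1" "mcoeff V'' 0 = 1" "supp V'' \<subseteq> over (planar_vars q)"
    using unit_inverse[OF U(2)] U(1) by metis
  moreover have "V'' = V"
  proof -
    have "V'' = (U * V) * V''"
      using V by (simp add: U_def)
    also have "\<dots> = (U * V'') * V"
      by (simp only: mult_ac)
    finally show ?thesis
      by (simp add: \<open>U * V'' = 1\<close>)
  qed
  ultimately have V1: "mcoeff V 0 = 1" "supp V \<subseteq> over (planar_vars q)"
    by simp_all
  note coc = change_of_coords_euler_flow[OF f(2) V'(1)[unfolded U_def] fp]
  have hom: "cont_hom (exp_derivation ?D)"
    by (rule cont_hom_exp_derivation[OF coc(3,2)])
  have var: "exp_derivation ?D v = v * U" if "planar_euler v = v" for v
    using exp_derivation_stretch[OF f(2) coc(3) cont_hom_id, of v 1] by (simp add: that mconst_simps U_def)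
  have exp_h: "exp_derivation ?D h = msubst (radius_subst U) h"
  proof (rule cont_hom_eq_on[OF hom cont_hom_msubst[OF substitution_radius] h(1)])
    fix v assume "v \<in> base_vars q"
    then consider "v = State Y" | j where "v = Param j"
      by (auto simp: base_vars_def)
    then show "exp_derivation ?D (mvar v) = msubst (radius_subst U) (mvar v)"
      by cases (simp_all add: var radius_subst_def exp_derivation_fixed[OF derivation_along_linear[OF coc(3)]])
  qed
  let ?k = "exp_derivation ?D (xv + h)"
  have k: "?k = xv * U + msubst (radius_subst U) h"
    by (simp add: cont_hom_add[OF hom] exp_h var)
  have "State X \<in> planar_vars q"
    by (simp add: planar_vars_def)
  then have "supp ?k \<subseteq> over (planar_vars q)"
    by (intro supp_exp_derivation) (simp_all add: fp hp supp_mult_over supp_planar_euler supp_add supp_mvar_over)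
  moreover have "mcoeff ?k 0 = 0"
    using h(2) by (simp add: k mcoeff_msubst_0[OF substitution_radius])
  ultimately have "U * V' * ?k \<in> planar q UNIV"
    using U V' by (simp add: planar_def supp_mult_over)
  moreover have "f \<in> planar q UNIV"
    using fp f(2) by (simp add: planar_def)
  ultimately have step1: "elementary_step q (euler_field (emb (xv + h))) (euler_field (emb (U * V' * ?k)))"
    using coc(1)[of "xv + h"] unfolding U_def[symmetric] by (intro state_change[of "euler_field (emb f)"] euler_field_in_Sspace)
  \<comment> \<open>Divide by the factor \<open>U / (U + E U)\<close> of the state change, and by the factor \<open>U\<close> that \<open>x\<close> has acquired.\<close>
  let ?T = "?A * V * V - 1"
  have "?T \<in> planar q UNIV"
    using A V1 by (simp add: planar_def supp_mult_over supp_diff)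
  then have T: "emb ?T \<in> Tspace q"
    by (simp add: Tspace_eq)
  have "(1 + emb ?T) * emb (U * V' * ?k) = emb (xv + V * msubst (radius_subst U) h)"
  proof -
    have "?A * V * V * (U * V' * ?k) = (?A * V') * (U * V) * (V * ?k)"
      by (simp only: mult_ac)
    also have "\<dots> = V * ?k"
      using V V'(1) by (simp add: U_def)
    also have "\<dots> = xv * (U * V) + V * msubst (radius_subst U) h"
      unfolding k by (simp add: distrib_left mult_ac)
    finally have "?A * V * V * (U * V' * ?k) = xv + V * msubst (radius_subst U) h"
      using V by (simp add: U_def)
    from arg_cong[OF this, of emb] show ?thesis
      by (simp add: cont_hom_diff[OF cont_hom_emb] cont_hom_1[OF cont_hom_emb] cont_hom_mult[OF cont_hom_emb])
  qed
  then have "smult_fun (1 + emb ?T) (euler_field (emb (U * V' * ?k))) = euler_field (emb (xv + V * msubst (radius_subst U) h))"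
    by (simp add: euler_field_def smult_fun_def mult.assoc[symmetric])
  with time_rescaling[OF T, of "euler_field (emb (U * V' * ?k))"]
  have "elementary_step q (euler_field (emb (U * V' * ?k))) (euler_field (emb (xv + V * msubst (radius_subst U) h)))"
    by simp
  with step1 show ?thesis
    unfolding U_def by (metis r_into_rtranclp rtranclp.rtrancl_into_rtrancl)
qed

section \<open>Elimination of the higher powers of the radius\<close>

lemma formal_sum_diff:
  fixes F G :: "'i \<Rightarrow> ('v, 'a :: comm_ring_1) mfps"
  assumes "locally_finite F" "locally_finite G"
  shows "formal_sum F - formal_sum G = formal_sum (\<lambda>i. F i - G i)"
proof (rule mfps_eqI)
  fix n
  let ?I = "{i. mcoeff (F i) n \<noteq> 0} \<union> {i. mcoeff (G i) n \<noteq> 0}"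
  have "finite ?I"
    using assms by (simp add: locally_finite_def)
  then show "mcoeff (formal_sum F - formal_sum G) n = mcoeff (formal_sum (\<lambda>i. F i - G i)) n"
    unfolding mcoeff_simps
    by (subst (1 2 3) mcoeff_formal_sum_superset[of ?I]) (auto simp: sum_subtractf)
qed

lemma ge_wt_1_mcoeff_0: "supp f \<subseteq> ge_wt c 1 \<Longrightarrow> mcoeff f 0 = 0"
  by (erule supp_subsetD) (simp add: ge_wt_def)

lemma stretch_op_diff: "stretch_op f c a - stretch_op g c b = stretch_op f c (a - b) + stretch_op (f - g) c b"
  by (simp add: stretch_op_def cont_linear_diff[OF derivation_along_linear[OF derivation_planar_euler]] algebra_simps)

text \<open>
  To first order \<open>stretch f 1\<close> is \<open>1 + f\<close>; each further term of the exponential series contains one more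
  factor of positive weight.
\<close>

lemma stretch_perturbation:
  fixes f g :: "'a :: field_char_0 series"
  assumes f: "supp f \<subseteq> ge_wt w 1" and g: "supp g \<subseteq> ge_wt w 1" and d: "supp (f - g) \<subseteq> ge_wt w d" "1 \<le> d"
  shows "supp (stretch f 1 - stretch g 1 - (f - g)) \<subseteq> ge_wt w (Suc d)"
    and "supp (stretch f 1 - stretch g 1) \<subseteq> ge_wt w d"
proof -
  let ?K = "\<lambda>f n. (stretch_op f 1 ^^ n) 1"
  have op_ge: "supp (stretch_op k 1 a) \<subseteq> ge_wt w (i + j)"
    if "supp k \<subseteq> ge_wt w i" "supp a \<subseteq> ge_wt w j" for k a :: "'a series" and i j
    unfolding stretch_op_def using that by (intro supp_mult_ge supp_add supp_mconst_mult supp_planar_euler)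
  have pow: "supp (?K f (Suc n) - ?K g (Suc n)) \<subseteq> ge_wt w (d + n)" for n
  proof (induction n)
    case 0
    then show ?case
      using d by (simp add: stretch_op_def mconst_simps)
  next
    case (Suc n)
    have "?K f (Suc (Suc n)) - ?K g (Suc (Suc n))
        = stretch_op f 1 (?K f (Suc n) - ?K g (Suc n)) + stretch_op (f - g) 1 (?K g (Suc n))"
      unfolding stretch_op_diff[symmetric] by simp
    then show ?case
      using op_ge[OF f Suc] op_ge[OF d(1) supp_stretch_pow[OF g, where c = 1 and n = "Suc n"]] by (simp add: supp_add)
  qed
  note lf = locally_finite_stretch[OF ge_wt_1_mcoeff_0[OF f]] locally_finite_stretch[OF ge_wt_1_mcoeff_0[OF g]]
  let ?F = "\<lambda>n. mconst (1 / fact n) * ?K f n - mconst (1 / fact n) * ?K g n"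
  have F: "?F n = mconst (1 / fact n) * (?K f n - ?K g n)" for n
    by (simp add: right_diff_distrib)
  have lF: "locally_finite ?F"
    unfolding F using ge_wt_1_mcoeff_0[OF f] ge_wt_1_mcoeff_0[OF g]
    by (intro locally_finite_deg supp_mconst_mult supp_diff supp_stretch_pow) (simp_all add: supp_ge_deg_1_iff)
  then have lF': "locally_finite (\<lambda>n. ?F (Suc n))"
    unfolding locally_finite_def using finite_vimageI[of "{n. mcoeff (?F n) m \<noteq> 0}" Suc for m]
    by (auto simp: vimage_def)
  have "stretch f 1 - stretch g 1 = formal_sum ?F"
    unfolding stretch_def by (rule formal_sum_diff[OF lf])
  also have "\<dots> = formal_sum (\<lambda>n. ?F (Suc n))"
    by (subst formal_sum_Suc[OF lF]) simp
  also have "\<dots> = (f - g) + formal_sum (\<lambda>n. ?F (Suc (Suc n)))"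
    by (subst formal_sum_Suc[OF lF']) (simp add: stretch_op_def mconst_simps)
  finally have eq: "stretch f 1 - stretch g 1 = (f - g) + formal_sum (\<lambda>n. ?F (Suc (Suc n)))" .
  have "supp (formal_sum (\<lambda>n. ?F (Suc (Suc n)))) \<subseteq> ge_wt w (Suc d)"
    unfolding F by (intro supp_formal_sum supp_mconst_mult ge_wt_mono[OF pow]) simp
  then show 1: "supp (stretch f 1 - stretch g 1 - (f - g)) \<subseteq> ge_wt w (Suc d)"
    unfolding eq by simp
  show "supp (stretch f 1 - stretch g 1) \<subseteq> ge_wt w d"
    using supp_add[OF ge_wt_mono[OF 1, of d] d(1)] by simp
qed

lemma power_perturbation:
  fixes A B \<delta> :: "('v, 'a :: comm_ring_1) mfps"
  assumes A: "supp (A - 1) \<subseteq> ge_wt w 1" and B: "supp (B - 1) \<subseteq> ge_wt w 1"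
    and \<delta>: "supp \<delta> \<subseteq> ge_wt w d" "supp (A - B - \<delta>) \<subseteq> ge_wt w (Suc d)"
  shows "supp (A ^ n - B ^ n - of_nat n * \<delta>) \<subseteq> ge_wt w (Suc d)"
proof (induction n)
  case (Suc n)
  have AB: "supp (A - B) \<subseteq> ge_wt w d"
    using supp_add[OF ge_wt_mono[OF \<delta>(2), of d] \<delta>(1)] by simp
  have "supp (of_nat n * \<delta>) \<subseteq> ge_wt w d"
    by (rule supp_mult_ge_left[OF \<delta>(1)])
  then have "supp (A ^ n - B ^ n) \<subseteq> ge_wt w d"
    using supp_add[OF ge_wt_mono[OF Suc, of d], of "of_nat n * \<delta>"] by simp
  then have 1: "supp ((A - 1) * (A ^ n - B ^ n)) \<subseteq> ge_wt w (Suc d)"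
    using supp_mult_ge[OF A] by fastforce
  have "supp (B ^ n - 1) \<subseteq> ge_wt w 1"
  proof (induction n)
    case (Suc n)
    have "B ^ Suc n - 1 = B * (B ^ n - 1) + (B - 1)"
      by (simp add: algebra_simps)
    then show ?case
      using supp_mult_ge_left[OF Suc] B by (simp only: supp_add)
  qed simp
  from supp_mult_ge[OF AB this] have 2: "supp ((A - B) * (B ^ n - 1)) \<subseteq> ge_wt w (Suc d)"
    by simp
  have "A ^ Suc n - B ^ Suc n - of_nat (Suc n) * \<delta>
      = (A ^ n - B ^ n - of_nat n * \<delta>) + (A - 1) * (A ^ n - B ^ n) + (A - B - \<delta>) + (A - B) * (B ^ n - 1)"
    by (simp add: algebra_simps)
  then show ?case
    using supp_add[OF supp_add[OF supp_add[OF Suc 1] \<delta>(2)] 2] by (simp only:)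
qed simp

text \<open>
  With \<open>R\<close> of weight \<open>1\<close> and every parameter of weight \<open>r + 1\<close>, the term \<open>\<beta>\<^sub>r R\<^sup>r\<close> dominates all
  other terms except \<open>\<beta>\<^sub>1 R\<close>, and the latter is invariant under scalings.
\<close>

definition unfolding_wt :: "nat \<Rightarrow> var \<Rightarrow> nat" where
  "unfolding_wt r v = (case v of State s \<Rightarrow> (if s = Y then 1 else 0) | Time \<Rightarrow> 0 | Param j \<Rightarrow> r + 1)"

lemma radius_wt_le: "radius_wt v \<le> unfolding_wt r v"
  by (auto simp: radius_wt_def unfolding_wt_def)

lemma wt_radius: "wt radius_wt n = Poly_Mapping.lookup n (State Y)"
proof -
  have "wt radius_wt n = (\<Sum>v\<in>Poly_Mapping.keys n. if v = State Y then Poly_Mapping.lookup n v else 0)"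
    unfolding wt_def by (rule sum.cong) (auto simp: radius_wt_def)
  then show ?thesis
    by (simp add: not_in_keys_iff_lookup_eq_zero)
qed

text \<open>
  The series \<open>h(R U, \<mu>) / U\<close> with \<open>U = stretch f 1\<close>. The choice operator picks the unique inverse of \<open>U\<close>.
\<close>

definition scaled :: "'a :: field_char_0 series \<Rightarrow> 'a series \<Rightarrow> 'a series" where
  "scaled f h = (SOME V. stretch f 1 * V = 1) * msubst (radius_subst (stretch f 1)) h"

lemma scaled_inverse:
  assumes "mcoeff f 0 = 0"
  obtains V where "stretch f 1 * V = 1" "\<And>h. scaled f h = V * msubst (radius_subst (stretch f 1)) h"
    "\<And>A. supp f \<subseteq> over A \<Longrightarrow> supp V \<subseteq> over A" "mcoeff V 0 = 1"
proof
  let ?U = "stretch f 1"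
  let ?V = "SOME V. ?U * V = 1"
  obtain W where W: "?U * W = 1" "\<And>A. supp ?U \<subseteq> over A \<Longrightarrow> supp W \<subseteq> over A" "mcoeff W 0 = 1"
    using unit_inverse[OF mcoeff_stretch_0[OF assms, of 1]] by metis
  show V: "?U * ?V = 1"
    using W(1) by (rule someI)
  have "?V = (?U * W) * ?V"
    using W(1) by simp
  also have "\<dots> = (?U * ?V) * W"
    by (simp only: mult_ac)
  finally have VW: "?V = W"
    using V by simp
  show "supp f \<subseteq> over A \<Longrightarrow> supp ?V \<subseteq> over A" for A
    unfolding VW by (intro W(2) supp_stretch_over)
  show "mcoeff ?V 0 = 1"
    unfolding VW by (rule W(3))
qed (simp add: scaled_def)

lemma supp_radius_subst: "supp U \<subseteq> ge_wt w 0 \<Longrightarrow> supp (radius_subst U v) \<subseteq> ge_wt w (w v)"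
  unfolding radius_subst_def
  using supp_mult_ge[OF supp_mvar_ge[of "w (State Y)" w "State Y"], of U 0]
  by (simp add: supp_mvar_ge)

text \<open>
  The term \<open>\<beta>\<^sub>1 R\<close> is invariant, \<open>\<beta>\<^sub>r R\<^sup>r\<close> becomes \<open>\<beta>\<^sub>r R\<^sup>r U\<^sup>r\<^sup>-\<^sup>1\<close> and yields the stated leading term of the
  difference, and the remainder \<open>h'\<close> starts with a higher weight.
\<close>

lemma scaled_perturbation:
  fixes h h' f g :: "'a :: field_char_0 series" and r :: nat
  defines "w \<equiv> unfolding_wt r"
  assumes h: "h = mconst \<beta>\<^sub>1 * yv + mconst \<beta>\<^sub>r * yv ^ r + h'" and h': "supp h' \<subseteq> ge_wt w (Suc r)" and r: "1 \<le> r"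
    and f: "supp f \<subseteq> ge_wt w 1" and g: "supp g \<subseteq> ge_wt w 1" and d: "supp (f - g) \<subseteq> ge_wt w d" "1 \<le> d"
  shows "supp (scaled f h - scaled g h - mconst (\<beta>\<^sub>r * of_nat (r - 1)) * (yv ^ r * (f - g))) \<subseteq> ge_wt w (Suc (d + r))"
proof -
  let ?U = "\<lambda>f. stretch f 1" and ?\<phi> = "\<lambda>f. radius_subst (stretch f 1)"
  have split: "scaled f h = mconst \<beta>\<^sub>1 * yv + mconst \<beta>\<^sub>r * (yv ^ r * ?U f ^ (r - 1)) + V * msubst (?\<phi> f) h'"
    if V: "?U f * V = 1" "\<And>h. scaled f h = V * msubst (?\<phi> f) h" for f V
  proof -
    note hom = cont_hom_simps[OF cont_hom_msubst[OF substitution_radius]]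
    have y: "msubst (?\<phi> f) yv = yv * ?U f"
      by (simp add: radius_subst_def)
    have p: "?U f ^ r = ?U f * ?U f ^ (r - 1)"
      using r by (cases r) simp_all
    have "V * (mconst \<beta>\<^sub>1 * (yv * ?U f)) = mconst \<beta>\<^sub>1 * yv * (?U f * V)"
      by (simp only: mult_ac)
    moreover have "V * (mconst \<beta>\<^sub>r * (yv * ?U f) ^ r) = mconst \<beta>\<^sub>r * (yv ^ r * ?U f ^ (r - 1)) * (?U f * V)"
      unfolding power_mult_distrib p by (simp only: mult_ac)
    ultimately show ?thesis
      unfolding V(2) h hom y distrib_left V(1) by simp
  qed
  obtain V where V: "?U f * V = 1" "\<And>h. scaled f h = V * msubst (?\<phi> f) h"
    using scaled_inverse[OF ge_wt_1_mcoeff_0[OF f]] by metis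
  obtain W where W: "?U g * W = 1" "\<And>h. scaled g h = W * msubst (?\<phi> g) h"
    using scaled_inverse[OF ge_wt_1_mcoeff_0[OF g]] by metis
  note U = stretch_perturbation[OF f g d]
  have one: "supp (?U f - 1) \<subseteq> ge_wt w 1" "supp (?U g - 1) \<subseteq> ge_wt w 1"
    by (rule supp_stretch_minus_1[OF ge_wt_1_mcoeff_0[OF f] f] supp_stretch_minus_1[OF ge_wt_1_mcoeff_0[OF g] g])+
  have "supp (yv ^ r * (?U f ^ (r - 1) - ?U g ^ (r - 1) - of_nat (r - 1) * (f - g))) \<subseteq> ge_wt w (r + Suc d)"
    using supp_power_ge[OF supp_mvar_ge[of 1 w "State Y"], of r] power_perturbation[OF one d(1) U(1), of "r - 1"]
    by (intro supp_mult_ge) (simp_all add: w_def unfolding_wt_def)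
  then have 1: "supp (mconst \<beta>\<^sub>r * (yv ^ r * (?U f ^ (r - 1) - ?U g ^ (r - 1) - of_nat (r - 1) * (f - g)))) \<subseteq> ge_wt w (Suc (d + r))"
    by (intro supp_mconst_mult) (simp add: add.commute)
  have "supp (?\<phi> f v - ?\<phi> g v) \<subseteq> ge_wt w (w v + d)" for v
  proof (cases "v = State Y")
    case True
    have "?\<phi> f v - ?\<phi> g v = yv * (?U f - ?U g)"
      by (simp add: True radius_subst_def right_diff_distrib)
    then show ?thesis
      using supp_mult_ge[OF supp_mvar_ge[of "w v" w v] U(2)] by (simp add: True)
  qed (simp add: radius_subst_def)
  then have "supp (msubst (?\<phi> f) h' - msubst (?\<phi> g) h') \<subseteq> ge_wt w (Suc r + d)"
    by (intro msubst_perturbation[OF h'] supp_radius_subst substitution_radius) simp_all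
  from supp_mult_ge_left[OF this, of V]
  have 2: "supp (V * (msubst (?\<phi> f) h' - msubst (?\<phi> g) h')) \<subseteq> ge_wt w (Suc (d + r))"
    by (simp add: add.commute)
  have "V - W = - (V * W) * (?U f - ?U g)"
  proof -
    have "- (V * W) * (?U f - ?U g) = V * (?U g * W) - (?U f * V) * W"
      by (simp add: algebra_simps)
    then show ?thesis
      by (simp add: V W)
  qed
  then have "supp (V - W) \<subseteq> ge_wt w d"
    using supp_mult_ge_left[OF U(2)] by metis
  moreover have "supp (msubst (?\<phi> g) h') \<subseteq> ge_wt w (Suc r)"
    by (rule supp_msubst_ge[OF h' supp_radius_subst]) simp
  ultimately have 3: "supp ((V - W) * msubst (?\<phi> g) h') \<subseteq> ge_wt w (Suc (d + r))"
    using supp_mult_ge by fastforce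
  have "mconst (\<beta>\<^sub>r * of_nat (r - 1)) * (yv ^ r * (f - g)) = mconst \<beta>\<^sub>r * (yv ^ r * (of_nat (r - 1) * (f - g)))"
    by (simp only: mconst_mult mconst_of_nat mult_ac)
  then have "scaled f h - scaled g h - mconst (\<beta>\<^sub>r * of_nat (r - 1)) * (yv ^ r * (f - g))
      = mconst \<beta>\<^sub>r * (yv ^ r * (?U f ^ (r - 1) - ?U g ^ (r - 1) - of_nat (r - 1) * (f - g)))
        + V * (msubst (?\<phi> f) h' - msubst (?\<phi> g) h') + (V - W) * msubst (?\<phi> g) h'"
    unfolding split[OF V] split[OF W] by (simp only: right_diff_distrib left_diff_distrib) simp
  then show ?thesis
    using supp_add[OF supp_add[OF 1 2] 3] by (simp only:)
qed

text \<open>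
  By the preceding lemma, the coefficient of \<open>f\<close> at \<open>n\<close> enters the coefficient of \<open>scaled f h\<close> at \<open>R\<^sup>r n\<close> linearly,
  with the factor \<open>(r - 1) \<beta>\<^sub>r\<close>, and all other coefficients of \<open>f\<close> occurring there have smaller weight. The
  unknowns are the coefficients at monomials \<open>n\<close> divisible by \<open>R\<close>, so \<open>R\<^sup>r n\<close> runs through the monomials
  with a higher power of \<open>R\<close> than \<open>R\<^sup>r\<close>.
\<close>

lemma exists_scaling:
  fixes h h' :: "'a :: field_char_0 series"
  assumes h: "h = mconst \<beta>\<^sub>1 * yv + mconst \<beta>\<^sub>r * yv ^ r + h'" "supp h \<subseteq> over (base_vars q)"
    and h': "supp h' \<subseteq> ge_wt (unfolding_wt r) (Suc r)" and r: "2 \<le> r" and \<beta>\<^sub>r: "\<beta>\<^sub>r \<noteq> 0"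
  obtains f where "supp f \<subseteq> over (base_vars q)" "supp f \<subseteq> ge_wt radius_wt 1"
    "\<And>n. r < Poly_Mapping.lookup n (State Y) \<Longrightarrow> mcoeff (scaled f h) n = 0"
proof -
  let ?w = "unfolding_wt r" and ?Y = "Poly_Mapping.single (State Y) r :: var \<Rightarrow>\<^sub>0 nat"
  define G where "G = {n. n \<in> over (base_vars q) \<and> 1 \<le> Poly_Mapping.lookup n (State Y)}"
  define ser where "ser a = (Abs_mfps (\<lambda>n. if n \<in> G then a n else 0) :: 'a series)" for a
  have ser: "mcoeff (ser a) n = (if n \<in> G then a n else 0)" for a n
    by (simp add: ser_def Abs_mfps_inverse)
  have ser_base: "supp (ser a) \<subseteq> over (base_vars q)" and ser_radius: "supp (ser a) \<subseteq> ge_wt radius_wt 1" for a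
    by (auto simp: supp_def ser G_def ge_wt_def wt_radius split: if_splits)
  have ser_w: "supp (ser a) \<subseteq> ge_wt ?w 1" for a
    by (rule ge_wt_weight_mono[OF ser_radius radius_wt_le])
  define c where "c = \<beta>\<^sub>r * of_nat (r - 1)"
  have c: "c \<noteq> 0"
    using \<beta>\<^sub>r r by (simp add: c_def)
  \<comment> \<open>Outside \<open>G\<close> a trivial equation with the same coefficient \<open>c\<close>, so that the system is indexed by all monomials.\<close>
  define \<Phi> where "\<Phi> a n = (if n \<in> G then mcoeff (scaled (ser a) h) (?Y + n) else c * a n)" for a n
  have "\<exists>a. \<forall>n. \<Phi> a n = 0"
  proof (rule triangular_system_solvable[OF c, where rank = "wt ?w"])
    fix a b :: "(var \<Rightarrow>\<^sub>0 nat) \<Rightarrow> 'a" and n assume ab: "\<And>m. wt ?w m < wt ?w n \<Longrightarrow> a m = b m"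
    show "\<Phi> a n - \<Phi> b n = c * (a n - b n)"
    proof (cases "n \<in> G")
      case True
      let ?d = "wt ?w n"
      have "supp (ser a - ser b) \<subseteq> ge_wt ?w ?d"
        using ab by (auto simp: supp_def ser ge_wt_def not_less split: if_splits) (metis linorder_not_less)
      moreover have "1 \<le> ?d"
        using True wt_mono[of radius_wt ?w n, OF radius_wt_le] by (auto simp: G_def wt_radius)
      ultimately have "supp (scaled (ser a) h - scaled (ser b) h - mconst c * (yv ^ r * (ser a - ser b))) \<subseteq> ge_wt ?w (Suc (?d + r))"
        unfolding c_def using r by (intro scaled_perturbation[OF h(1) h'] ser_w) simp_all
      then have "mcoeff (scaled (ser a) h - scaled (ser b) h - mconst c * (yv ^ r * (ser a - ser b))) (?Y + n) = 0"
        by (rule supp_subsetD) (simp add: ge_wt_def unfolding_wt_def)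
      then show ?thesis
        using True by (simp add: \<Phi>_def monomial_single[symmetric] ser)
    qed (simp add: \<Phi>_def algebra_simps)
  qed
  then obtain a where a: "\<And>n. \<Phi> a n = 0"
    by blast
  show thesis
  proof
    show "mcoeff (scaled (ser a) h) n = 0" if "r < Poly_Mapping.lookup n (State Y)" for n
    proof (cases "n \<in> over (base_vars q)")
      case True
      have n: "n = ?Y + (n - ?Y)"
        using that by (intro poly_mapping_eqI) (auto simp: lookup_add lookup_minus lookup_single when_def)
      have "Poly_Mapping.keys (n - ?Y) \<subseteq> Poly_Mapping.keys n"
        using keys_subset_add[of "n - ?Y" ?Y] n by (metis add.commute)
      then have "n - ?Y \<in> G"
        using True that by (auto simp: G_def over_def lookup_minus)
      then show ?thesis
        using a[of "n - ?Y"] n by (simp add: \<Phi>_def)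
    next
      case False
      obtain V where V: "\<And>h. scaled (ser a) h = V * msubst (radius_subst (stretch (ser a) 1)) h"
        "\<And>A. supp (ser a) \<subseteq> over A \<Longrightarrow> supp V \<subseteq> over A"
        using scaled_inverse[OF ge_wt_1_mcoeff_0[OF ser_w]] by metis
      have "supp (radius_subst (stretch (ser a) 1) v) \<subseteq> over (base_vars q)" if "v \<in> base_vars q" for v
        using that supp_mult_over[OF supp_mvar_over[of "State Y"] supp_stretch_over[OF ser_base]]
        by (cases "v = State Y") (simp_all add: radius_subst_def supp_mvar_over)
      then have "supp (scaled (ser a) h) \<subseteq> over (base_vars q)"
        unfolding V(1) by (intro supp_mult_over supp_msubst_over[OF h(2)] V(2)[OF ser_base])
      then show ?thesis
        using False by (rule supp_subsetD)
    qed
  qed (rule ser_base ser_radius)+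
qed

section \<open>The coefficients of low order\<close>

lemma monomial_subst_radius:
  "monomial_subst (radius_subst U) n = monomial n * U ^ Poly_Mapping.lookup n (State Y)"
proof (induction n rule: monomial_induct)
  case (add n v)
  then show ?case
    by (auto simp: monomial_subst_add monomial_subst_single radius_subst_def monomial_mult[symmetric]
        mvar_eq_monomial[symmetric] lookup_add lookup_single when_def power_add mult_ac simp del: One_nat_def)
qed (simp add: one_eq_monomial[symmetric])

abbreviation radius_pow :: "nat \<Rightarrow> var \<Rightarrow>\<^sub>0 nat" where
  "radius_pow k \<equiv> Poly_Mapping.single (State Y) k"

abbreviation param_var :: "nat \<Rightarrow> var \<Rightarrow>\<^sub>0 nat" where
  "param_var j \<equiv> Poly_Mapping.single (Param j) 1"

lemma divisor_radius_pow:
  assumes "radius_pow k = m + b"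
  shows "\<exists>i\<le>k. m = radius_pow i"
proof (intro exI conjI)
  have l: "Poly_Mapping.lookup (radius_pow k) v = Poly_Mapping.lookup m v + Poly_Mapping.lookup b v" for v
    using assms by (simp add: lookup_add)
  show "Poly_Mapping.lookup m (State Y) \<le> k"
    using l[of "State Y"] by simp
  show "m = radius_pow (Poly_Mapping.lookup m (State Y))"
  proof (rule poly_mapping_eqI)
    show "Poly_Mapping.lookup m v = Poly_Mapping.lookup (radius_pow (Poly_Mapping.lookup m (State Y))) v" for v
      using l[of v] by (cases "v = State Y") (simp_all add: lookup_single when_def)
  qed
qed

lemma divisor_radius_pow_param:
  assumes "radius_pow k + param_var j = m + b"
  shows "\<exists>i\<le>k. m = radius_pow i \<or> m = radius_pow i + param_var j"
proof (intro exI conjI)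
  have l: "Poly_Mapping.lookup (radius_pow k) v + Poly_Mapping.lookup (param_var j) v
      = Poly_Mapping.lookup m v + Poly_Mapping.lookup b v" for v
    using assms by (metis lookup_add)
  show "Poly_Mapping.lookup m (State Y) \<le> k"
    using l[of "State Y"] by (simp add: lookup_single when_def)
  have other: "Poly_Mapping.lookup m v = 0" if "v \<noteq> State Y" "v \<noteq> Param j" for v
    using l[of v] that by (simp add: lookup_single when_def split: if_splits)
  have "Poly_Mapping.lookup m (Param j) \<le> 1"
    using l[of "Param j"] by (simp add: lookup_single when_def)
  then consider "Poly_Mapping.lookup m (Param j) = 0" | "Poly_Mapping.lookup m (Param j) = 1"
    by linarith
  then show "m = radius_pow (Poly_Mapping.lookup m (State Y)) \<or> m = radius_pow (Poly_Mapping.lookup m (State Y)) + param_var j"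
  proof cases
    case 1
    have "Poly_Mapping.lookup m v = Poly_Mapping.lookup (radius_pow (Poly_Mapping.lookup m (State Y))) v" for v
      using other[of v] 1 by (auto simp: lookup_single when_def)
    then show ?thesis
      by (intro disjI1 poly_mapping_eqI)
  next
    case 2
    have "Poly_Mapping.lookup m v = Poly_Mapping.lookup (radius_pow (Poly_Mapping.lookup m (State Y)) + param_var j) v" for v
      using other[of v] 2 by (auto simp: lookup_single lookup_add when_def)
    then show ?thesis
      by (intro disjI2 poly_mapping_eqI)
  qed
qed

lemma radius_pow_eq_iff: "radius_pow i = radius_pow k \<longleftrightarrow> i = k"
  by (metis lookup_single_eq)

lemma param_var_eq_0: "param_var j \<noteq> 0"
  by (metis lookup_single_eq lookup_zero one_neq_zero)

lemma radius_pow_param_neq: "radius_pow i + param_var j \<noteq> radius_pow k"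
proof
  assume "radius_pow i + param_var j = radius_pow k"
  then have "Poly_Mapping.lookup (radius_pow i + param_var j) (Param j) = Poly_Mapping.lookup (radius_pow k) (Param j)"
    by simp
  then show False
    by (simp add: lookup_add lookup_single when_def)
qed

text \<open>
  A monomial of \<open>h\<close> that contains \<open>R\<^sup>i\<close> is multiplied by \<open>T i = U\<^sup>i\<^sup>-\<^sup>1 = 1 + O(R)\<close>, and \<open>T 1 = 1\<close>. So the terms
  \<open>\<beta>\<^sub>1 R\<close> and \<open>\<beta>\<^sub>r R\<^sup>r\<close> influence no other coefficient of \<open>R\<^sup>k\<close> or \<open>R\<^sup>k \<mu>\<^sub>j\<close> with \<open>k \<le> r\<close>, and the coefficients of
  \<open>R\<^sup>k \<mu>\<^sub>j\<close> are changed by a unipotent triangular matrix.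
\<close>

lemma scaled_coefficients:
  fixes h f :: "'a :: field_char_0 series"
  assumes f: "supp f \<subseteq> ge_wt radius_wt 1" and r: "2 \<le> r"
    and h: "\<And>i. i \<le> r \<Longrightarrow> i \<noteq> 1 \<Longrightarrow> i \<noteq> r \<Longrightarrow> mcoeff h (radius_pow i) = 0"
  obtains t where "\<And>k. t k k = 1"
    "\<And>k. k \<le> r \<Longrightarrow> mcoeff (scaled f h) (radius_pow k) = mcoeff h (radius_pow k)"
    "\<And>k j. k \<le> r \<Longrightarrow> mcoeff (scaled f h) (radius_pow k + param_var j)
      = (\<Sum>i\<le>k. t k i * mcoeff h (radius_pow i + param_var j))"
proof -
  let ?U = "stretch f 1"
  have f0: "mcoeff f 0 = 0"
    by (rule ge_wt_1_mcoeff_0[OF f])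
  obtain V where V: "?U * V = 1" "\<And>h. scaled f h = V * msubst (radius_subst ?U) h" "mcoeff V 0 = 1"
    using scaled_inverse[OF f0] by metis
  define T where "T i = V * ?U ^ i" for i
  have T1: "T 1 = 1"
    using V(1) by (simp add: T_def mult.commute)
  have T0: "mcoeff (T i) 0 = 1" for i
    using V(3) mcoeff_stretch_0[OF f0] by (simp add: T_def)
  have T_param: "mcoeff (T i) (param_var j) = 0" for i j
  proof -
    have U1: "supp (?U - 1) \<subseteq> ge_wt radius_wt 1"
      by (rule supp_stretch_minus_1[OF f0 f])
    have "V - 1 = - V * (?U - 1)"
      using V(1) by (simp add: algebra_simps)
    then have V1: "supp (V - 1) \<subseteq> ge_wt radius_wt 1"
      using supp_mult_ge_left[OF U1] by metis
    have "supp (T i - 1) \<subseteq> ge_wt radius_wt 1"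
    proof (induction i)
      case (Suc i)
      have "T (Suc i) - 1 = T i * (?U - 1) + (T i - 1)"
        by (simp add: T_def algebra_simps)
      then show ?case
        using supp_mult_ge_left[OF U1] Suc by (simp only: supp_add)
    qed (use V1 in \<open>simp add: T_def\<close>)
    then have "mcoeff (T i - 1) (param_var j) = 0"
      by (rule supp_subsetD) (simp add: ge_wt_def wt_radius lookup_single when_def)
    then show ?thesis
      using param_var_eq_0[of j] by (simp add: one_eq_monomial mcoeff_monomial del: One_nat_def)
  qed
  have expansion: "mcoeff (scaled f h) n = (\<Sum>m\<in>I. mcoeff h m * mcoeff (monomial m * T (Poly_Mapping.lookup m (State Y))) n)"
    if "finite I" "\<And>m. m \<notin> I \<Longrightarrow> \<nexists>b. n = m + b" for I n
  proof -
    have lf: "locally_finite (\<lambda>m. mconst (mcoeff h m) * monomial m)"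
      by (rule monomial_expansion)
    have lin: "cont_linear (\<lambda>a. V * msubst (radius_subst ?U) a)"
      by (intro cont_linear_mult cont_hom_linear cont_hom_msubst substitution_radius)
    have "scaled f h = formal_sum (\<lambda>m. V * msubst (radius_subst ?U) (mconst (mcoeff h m) * monomial m))"
      unfolding V(2) by (subst monomial_expansion(2)[of h]) (rule cont_linear_formal_sum(2)[OF lin lf])
    also have "(\<lambda>m. V * msubst (radius_subst ?U) (mconst (mcoeff h m) * monomial m))
        = (\<lambda>m. mconst (mcoeff h m) * (monomial m * T (Poly_Mapping.lookup m (State Y))))"
      unfolding cont_linear_mconst[OF lin] msubst_monomial monomial_subst_radius T_def by (simp add: mult_ac)
    finally show ?thesis
      using that by (simp add: mcoeff_formal_sum_superset[OF that(1)] mcoeff_monomial_mult)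
  qed
  have shift: "mcoeff (monomial (radius_pow i) * g) (radius_pow k) = mcoeff g (radius_pow (k - i))"
    "mcoeff (monomial (radius_pow i) * g) (radius_pow k + param_var j) = mcoeff g (radius_pow (k - i) + param_var j)"
    "mcoeff (monomial (radius_pow i + param_var j) * g) (radius_pow k + param_var j) = mcoeff g (radius_pow (k - i))"
    if "i \<le> k" for i k j and g :: "'a series"
  proof -
    have k: "radius_pow k = radius_pow i + radius_pow (k - i)"
      using that by (simp flip: single_add)
    show "mcoeff (monomial (radius_pow i) * g) (radius_pow k) = mcoeff g (radius_pow (k - i))"
      unfolding k by simp
    show "mcoeff (monomial (radius_pow i) * g) (radius_pow k + param_var j) = mcoeff g (radius_pow (k - i) + param_var j)"
      unfolding k add.assoc by simp
    have "radius_pow k + param_var j = (radius_pow i + param_var j) + radius_pow (k - i)"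
      unfolding k by (simp only: add_ac)
    then show "mcoeff (monomial (radius_pow i + param_var j) * g) (radius_pow k + param_var j) = mcoeff g (radius_pow (k - i))"
      by simp
  qed
  have inj: "inj_on radius_pow A" "inj_on (\<lambda>i. radius_pow i + param_var j) A" for A j
    by (auto intro!: inj_onI simp: radius_pow_eq_iff)
  define t where "t k i = mcoeff (T i) (radius_pow (k - i))" for k i
  show thesis
  proof
    show "t k k = 1" for k
      by (simp add: t_def T0)
    fix k assume k: "k \<le> r"
    have term0: "mcoeff h (radius_pow i) * mcoeff (T i) n = 0"
      if "i \<le> k" "n \<noteq> 0" "i = k \<Longrightarrow> mcoeff (T i) n = 0" for i n
    proof (cases "i = 1")
      case True
      then show ?thesis
        using that(2) by (simp add: T1[simplified] one_eq_monomial mcoeff_monomial)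
    next
      case False
      then show ?thesis
        using that h[of i] k by (cases "i = k") auto
    qed
    have "mcoeff (scaled f h) (radius_pow k)
        = (\<Sum>m\<in>radius_pow ` {..k}. mcoeff h m * mcoeff (monomial m * T (Poly_Mapping.lookup m (State Y))) (radius_pow k))"
      by (rule expansion) (use divisor_radius_pow in fastforce)+
    also have "\<dots> = (\<Sum>i\<le>k. mcoeff h (radius_pow i) * mcoeff (T i) (radius_pow (k - i)))"
      by (simp add: sum.reindex[OF inj(1)] shift)
    also have "\<dots> = (\<Sum>i\<in>{k}. mcoeff h (radius_pow i) * mcoeff (T i) (radius_pow (k - i)))"
    proof (rule sum.mono_neutral_right)
      show "\<forall>i\<in>{..k} - {k}. mcoeff h (radius_pow i) * mcoeff (T i) (radius_pow (k - i)) = 0"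
      proof
        fix i assume "i \<in> {..k} - {k}"
        then show "mcoeff h (radius_pow i) * mcoeff (T i) (radius_pow (k - i)) = 0"
          using radius_pow_eq_iff[of "k - i" 0] by (intro term0) simp_all
      qed
    qed simp_all
    finally show "mcoeff (scaled f h) (radius_pow k) = mcoeff h (radius_pow k)"
      by (simp add: T0)
    fix j
    let ?n = "radius_pow k + param_var j"
    have "mcoeff (scaled f h) ?n
        = (\<Sum>m\<in>radius_pow ` {..k} \<union> (\<lambda>i. radius_pow i + param_var j) ` {..k}.
            mcoeff h m * mcoeff (monomial m * T (Poly_Mapping.lookup m (State Y))) ?n)"
      by (rule expansion) (use divisor_radius_pow_param[of k j] in fastforce)+
    also have "\<dots> = (\<Sum>i\<le>k. mcoeff h (radius_pow i) * mcoeff (T i) (radius_pow (k - i) + param_var j))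
        + (\<Sum>i\<le>k. mcoeff h (radius_pow i + param_var j) * mcoeff (T i) (radius_pow (k - i)))"
      by (subst sum.union_disjoint)
         (auto simp: sum.reindex[OF inj(1)] sum.reindex[OF inj(2)] shift radius_pow_param_neq
           radius_pow_param_neq[symmetric] lookup_add lookup_single when_def simp del: One_nat_def)
    also have "(\<Sum>i\<le>k. mcoeff h (radius_pow i) * mcoeff (T i) (radius_pow (k - i) + param_var j)) = 0"
    proof (intro sum.neutral ballI term0)
      show "radius_pow (k - i) + param_var j \<noteq> 0" for i
        using radius_pow_param_neq[of "k - i" j 0] by simp
    qed (use T_param in auto)
    finally show "mcoeff (scaled f h) ?n = (\<Sum>i\<le>k. t k i * mcoeff h (radius_pow i + param_var j))"
      by (simp add: t_def mult.commute)
  qed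
qed

section \<open>Full row rank\<close>

text \<open>
  If the rank is the number of rows, then the columns span the whole space. A vector orthogonal to all
  columns is then orthogonal to everything.
\<close>

lemma full_rank_rows_independent:
  fixes A :: "'a :: field mat"
  assumes A: "A \<in> carrier_mat n nc" and rank: "vec_space.rank n A = n"
    and c: "c \<in> carrier_vec n" and orth: "\<And>j. j < nc \<Longrightarrow> c \<bullet> col A j = 0"
  shows "c = 0\<^sub>v n"
proof -
  interpret vec_space "TYPE('a)" n .
  have cols: "set (cols A) \<subseteq> carrier_vec n"
    using cols_dim A by blast
  have "lin_indpt {}"
    by (auto simp: lin_dep_def)
  then obtain S where S: "maximal S (\<lambda>T. T \<subseteq> set (cols A) \<and> lin_indpt T)"
    using maximal_exists_superset[of "set (cols A)" "\<lambda>T. T \<subseteq> set (cols A) \<and> lin_indpt T" "{}"] by auto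
  then have indep: "lin_indpt S" "S \<subseteq> set (cols A)"
    by (auto simp: maximal_def)
  have "card S = n"
    using rank_card_indpt[OF A S] rank by simp
  moreover have "finite S"
    using indep(2) finite_subset by blast
  ultimately have "basis S"
    using indep cols by (intro dim_li_is_basis fin_dim) (auto simp: dim_is_n)
  then have span: "span S = carrier_vec n"
    by (simp add: basis_def)
  let ?W = "{v \<in> carrier_vec n. c \<bullet> v = 0}"
  have "submodule class_ring ?W V"
    by unfold_locales (use c in \<open>auto simp: module_vec_simps scalar_prod_add_distrib class_ring_simps\<close>)
  moreover have "S \<subseteq> ?W"
  proof
    fix v assume "v \<in> S"
    then have "v \<in> set (cols A)"
      using indep(2) by blast
    then obtain j where "j < nc" "v = col A j"
      using A by (auto simp: cols_def)
    then show "v \<in> ?W"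
      using orth A by auto
  qed
  ultimately have W: "carrier_vec n \<subseteq> ?W"
    unfolding span[symmetric] by (intro span_is_subset)
  have "c $ i = 0" if "i < n" for i
    using subsetD[OF W, of "unit_vec n i"] that c by simp
  then show ?thesis
    using c by (intro eq_vecI) auto
qed

lemma vector_space_functions: "vector_space (\<lambda>(c :: 'a :: field) (f :: 'i \<Rightarrow> 'a) i. c * f i)"
  by unfold_locales (auto simp: plus_fun_def algebra_simps)

text \<open>Independent rows are completed to a basis of the space of all rows of length \<open>q\<close>; the coordinates of the unit vectors give the inverse.\<close>

lemma extend_independent_rows:
  fixes H :: "nat \<Rightarrow> nat \<Rightarrow> 'a :: field"
  assumes indep: "\<And>c. (\<And>j. j \<in> {1..q} \<Longrightarrow> (\<Sum>k\<le>r. c k * H k j) = 0) \<Longrightarrow> (\<And>k. k \<le> r \<Longrightarrow> c k = 0)"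
  obtains B C :: "nat \<Rightarrow> nat \<Rightarrow> 'a" where
    "\<And>k j. k \<le> r \<Longrightarrow> j \<in> {1..q} \<Longrightarrow> C (k + 1) j = H k j" "r + 1 \<le> q"
    "\<And>i l. i \<in> {1..q} \<Longrightarrow> l \<in> {1..q} \<Longrightarrow> (\<Sum>j=1..q. B i j * C j l) = (if i = l then 1 else 0)"
    "\<And>i l. i \<in> {1..q} \<Longrightarrow> l \<in> {1..q} \<Longrightarrow> (\<Sum>j=1..q. C i j * B j l) = (if i = l then 1 else 0)"
proof -
  interpret fs: vector_space "\<lambda>(c :: 'a) (f :: nat \<Rightarrow> 'a) i. c * f i"
    by (rule vector_space_functions)
  define Q where "Q = {1..q}"
  have finQ: "finite Q"
    by (simp add: Q_def)
  define e where "e j = (\<lambda>i. if i = j then 1 else 0 :: 'a)" for j :: nat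
  define row where "row k = (\<lambda>j. if j \<in> Q then H k j else 0)" for k
  define V where "V = {f :: nat \<Rightarrow> 'a. \<forall>i. i \<notin> Q \<longrightarrow> f i = 0}"
  have sum_app: "(\<Sum>i\<in>I. F i) x = (\<Sum>i\<in>I. F i x)" for F :: "'i \<Rightarrow> nat \<Rightarrow> 'a" and I x
    by (induction I rule: infinite_finite_induct) (auto simp: plus_fun_def zero_fun_def)
  have zero_row: "c k = 0" if z: "\<And>x. (\<Sum>k\<le>r. c k * row k x) = 0" and k: "k \<le> r" for c k
  proof (rule indep[of c, OF _ k])
    fix j assume "j \<in> {1..q}"
    then have rowH: "row k j = H k j" for k
      unfolding row_def Q_def by (rule if_P)
    show "(\<Sum>k\<le>r. c k * H k j) = 0"
      using z[of j] unfolding rowH .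
  qed
  have inj_row: "inj_on row {..r}"
  proof (rule inj_onI, rule ccontr)
    fix k l assume kl: "k \<in> {..r}" "l \<in> {..r}" "row k = row l" "k \<noteq> l"
    let ?c = "\<lambda>i. if i = k then 1 else if i = l then - 1 else 0 :: 'a"
    have "(\<Sum>i\<le>r. ?c i * row i x) = 0" for x
    proof -
      have "(\<Sum>i\<le>r. ?c i * row i x) = (\<Sum>i\<in>{k, l}. ?c i * row i x)"
        by (rule sum.mono_neutral_right) (use kl(1,2) in auto)
      also have "\<dots> = row k x - row l x"
        using kl(4) by simp
      finally show ?thesis
        unfolding kl(3) diff_self .
    qed
    from zero_row[OF this, of k] show False
      using kl(1) by simp
  qed
  have "fs.independent (row ` {..r})"
  proof -
    have "\<forall>v\<in>row ` {..r}. u v = 0" if u: "(\<Sum>v\<in>row ` {..r}. (\<lambda>i. u v * v i)) = 0" for u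
    proof -
      have "(\<Sum>k\<le>r. u (row k) * row k x) = 0" for x
        using fun_cong[OF u, of x] by (simp add: sum_app sum.reindex[OF inj_row] zero_fun_def)
      from zero_row[OF this] show ?thesis by auto
    qed
    then show ?thesis
      by (auto simp: fs.dependent_finite)
  qed
  moreover have "row ` {..r} \<subseteq> V"
    by (auto simp: row_def V_def)
  ultimately obtain Bs where Bs: "row ` {..r} \<subseteq> Bs" "Bs \<subseteq> V" "fs.independent Bs" "V \<subseteq> fs.span Bs"
    using fs.maximal_independent_subset_extend by metis
  have expand: "f = (\<Sum>j\<in>Q. (\<lambda>i. f j * e j i))" if "f \<in> V" for f
  proof
    fix i
    have "(\<Sum>j\<in>Q. f j * e j i) = (\<Sum>j\<in>Q. if i = j then f j else 0)"
      by (rule sum.cong) (auto simp: e_def)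
    then show "f i = (\<Sum>j\<in>Q. (\<lambda>i. f j * e j i)) i"
      using that finQ by (auto simp: sum_app V_def)
  qed
  have inj_e: "inj_on e Q"
    by (auto simp: inj_on_def e_def fun_eq_iff split: if_splits)
  have span_e: "V \<subseteq> fs.span (e ` Q)"
  proof
    fix f assume "f \<in> V"
    show "f \<in> fs.span (e ` Q)"
      by (subst expand[OF \<open>f \<in> V\<close>]) (intro fs.span_sum fs.span_scale fs.span_base imageI)
  qed
  have "fs.independent (e ` Q)"
  proof -
    have "\<forall>v\<in>e ` Q. u v = 0" if u: "(\<Sum>v\<in>e ` Q. (\<lambda>i. u v * v i)) = 0" for u
    proof
      fix v assume "v \<in> e ` Q"
      then obtain l where l: "l \<in> Q" "v = e l" by blast
      have "(\<Sum>j\<in>Q. u (e j) * e j l) = 0"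
        using fun_cong[OF u, of l] by (simp add: sum_app sum.reindex[OF inj_e] zero_fun_def)
      moreover have "(\<Sum>j\<in>Q. u (e j) * e j l) = (\<Sum>j\<in>Q. if l = j then u (e j) else 0)"
        by (rule sum.cong) (auto simp: e_def)
      ultimately show "u v = 0"
        using l finQ by simp
    qed
    then show ?thesis
      by (auto simp: fs.dependent_finite[OF finite_imageI[OF finQ]])
  qed
  moreover have "e ` Q \<subseteq> V"
    by (auto simp: e_def V_def)
  ultimately have "card (e ` Q) = fs.dim V" "card Bs = fs.dim V"
    using span_e Bs by (auto intro: fs.basis_card_eq_dim)
  then have card: "card Bs = q"
    by (simp add: card_image[OF inj_e]) (simp add: Q_def)
  have fin: "finite Bs"
    using fs.independent_span_bound[of "e ` Q" Bs] Bs span_e finQ by (meson finite_imageI subset_trans)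
  have card_row: "card (row ` {..r}) = r + 1"
    by (simp add: card_image[OF inj_row])
  then have rq: "r + 1 \<le> q"
    using card_mono[OF fin Bs(1)] card by simp
  have "card {r + 2..q} = card (Bs - row ` {..r})"
    using card_Diff_subset[OF _ Bs(1)] card card_row by simp
  then obtain g where g: "bij_betw g {r + 2..q} (Bs - row ` {..r})"
    using finite_same_card_bij[of "{r + 2..q}" "Bs - row ` {..r}"] fin by auto
  define C where "C i = (if i \<le> r + 1 then row (i - 1) else g i)" for i
  have "bij_betw C {1..r + 1} (row ` {..r})"
  proof -
    have "bij_betw (\<lambda>i. i - 1) {1..r + 1} {..r}"
      by (rule bij_betw_byWitness[where f' = Suc]) auto
    then have "bij_betw (row \<circ> (\<lambda>i. i - 1)) {1..r + 1} (row ` {..r})"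
      using inj_row by (rule bij_betw_trans[OF _ inj_on_imp_bij_betw])
    then show ?thesis
      by (rule bij_betw_cong[THEN iffD1, rotated]) (simp add: C_def)
  qed
  moreover have "bij_betw C {r + 2..q} (Bs - row ` {..r})"
    using g by (rule bij_betw_cong[THEN iffD1, rotated]) (simp add: C_def)
  ultimately have "bij_betw C ({1..r + 1} \<union> {r + 2..q}) (row ` {..r} \<union> (Bs - row ` {..r}))"
    by (rule bij_betw_combine) auto
  moreover have "{1..r + 1} \<union> {r + 2..q} = Q" "row ` {..r} \<union> (Bs - row ` {..r}) = Bs"
    using rq Bs(1) by (auto simp: Q_def)
  ultimately have C: "bij_betw C Q Bs"
    by simp
  then have inj_C: "inj_on C Q" and img_C: "C ` Q = Bs"
    by (auto simp: bij_betw_def)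
  have "\<exists>u. e i = (\<Sum>v\<in>Bs. (\<lambda>x. u v * v x))" if "i \<in> Q" for i
  proof -
    have "e i \<in> fs.span Bs"
      using that Bs(4) by (auto simp: e_def V_def)
    then show ?thesis
      unfolding fs.span_finite[OF fin] by (rule rangeE) (rule exI)
  qed
  then obtain u where "\<forall>i\<in>Q. e i = (\<Sum>v\<in>Bs. (\<lambda>x. u i v * v x))"
    using bchoice[of Q "\<lambda>i u. e i = (\<Sum>v\<in>Bs. (\<lambda>x. u v * v x))"] by blast
  then have u: "\<And>i. i \<in> Q \<Longrightarrow> e i = (\<Sum>v\<in>Bs. (\<lambda>x. u i v * v x))"
    by blast
  define B where "B i j = u i (C j)" for i j
  have BC_fun: "e i l = (\<Sum>j\<in>Q. B i j * C j l)" if "i \<in> Q" for i l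
    using fun_cong[OF u[OF that], of l] unfolding img_C[symmetric]
    by (simp add: sum_app sum.reindex[OF inj_C] B_def)
  have CB: "(\<Sum>j\<in>Q. C i j * B j l) = (if i = l then 1 else 0)" if il: "i \<in> Q" "l \<in> Q" for i l
  proof -
    define d where "d k = (\<Sum>j\<in>Q. C i j * B j k) - (if i = k then 1 else 0)" for k
    have "(\<Sum>k\<in>Q. d k * C k x) = 0" for x
    proof -
      have "C i \<in> V"
        using img_C il Bs(2) by blast
      then have "C i x = (\<Sum>j\<in>Q. C i j * e j x)"
        using fun_cong[OF expand, of "C i" x] by (simp add: sum_app)
      also have "\<dots> = (\<Sum>j\<in>Q. \<Sum>k\<in>Q. C i j * B j k * C k x)"
        by (rule sum.cong) (simp_all add: BC_fun sum_distrib_left mult.assoc)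
      also have "\<dots> = (\<Sum>k\<in>Q. (\<Sum>j\<in>Q. C i j * B j k) * C k x)"
        by (subst sum.swap) (simp add: sum_distrib_right)
      finally have "C i x = (\<Sum>k\<in>Q. (\<Sum>j\<in>Q. C i j * B j k) * C k x)" .
      moreover have "(\<Sum>k\<in>Q. (if i = k then 1 else 0) * C k x) = C i x"
        using il finQ by (simp add: if_distrib[where f = "\<lambda>a. a * _"] cong: if_cong)
      ultimately show ?thesis
        by (simp add: d_def left_diff_distrib sum_subtractf)
    qed
    then have "(\<Sum>v\<in>Bs. (\<lambda>x. d (the_inv_into Q C v) * v x)) = 0"
      unfolding img_C[symmetric]
      by (simp add: fun_eq_iff sum_app sum.reindex[OF inj_C] the_inv_into_f_f[OF inj_C] zero_fun_def)
    from fs.independentD[OF Bs(3) fin subset_refl this, of "C l"] have "d (the_inv_into Q C (C l)) = 0"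
      using img_C il(2) by blast
    then show ?thesis
      using il(2) by (simp add: the_inv_into_f_f[OF inj_C] d_def)
  qed
  show thesis
  proof
    show "C (k + 1) j = H k j" if "k \<le> r" "j \<in> {1..q}" for k j
      using that by (simp add: C_def row_def Q_def)
    show "(\<Sum>j=1..q. B i j * C j l) = (if i = l then 1 else 0)" if "i \<in> {1..q}" for i l
      unfolding Q_def[symmetric] using BC_fun[of i l] that by (auto simp: e_def Q_def)
    show "(\<Sum>j=1..q. C i j * B j l) = (if i = l then 1 else 0)" if "i \<in> {1..q}" "l \<in> {1..q}" for i l
      using CB[of i l] that unfolding Q_def by blast
  qed (fact rq)
qed

section \<open>Reparametrizations\<close>

(* Exponent vectors of single variables are written with 1, which must not be rewritten to Suc 0. *)
declare One_nat_def [simp del]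

definition param_over :: "nat \<Rightarrow> (var \<Rightarrow>\<^sub>0 nat) set" where
  "param_over q = over (Param ` {1..q})"

lemma Pspace_iff:
  "P \<in> Pspace q \<longleftrightarrow> (\<forall>j. j \<notin> {1..q} \<longrightarrow> P j = 0) \<and> (\<forall>j. mcoeff (P j) 0 = 0 \<and> supp (P j) \<subseteq> param_over q)"
  by (fastforce simp: Pspace_def supp_def over_def param_over_def)

lemma param_subst_simps [simp]:
  "param_subst \<psi> (Param j) = \<psi> j" "param_subst \<psi> (State s) = mvar (State s)" "param_subst \<psi> Time = tv"
  by (simp_all add: param_subst_def)

lemma substitution_param: "\<psi> \<in> Pspace q \<Longrightarrow> substitution (param_subst \<psi>)"
proof -
  assume \<psi>: "\<psi> \<in> Pspace q"
  have "{v. param_subst \<psi> v \<noteq> 0 \<and> param_subst \<psi> v \<noteq> mvar v} \<subseteq> Param ` {1..q}"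
  proof
    fix v assume "v \<in> {v. param_subst \<psi> v \<noteq> 0 \<and> param_subst \<psi> v \<noteq> mvar v}"
    then obtain j where j: "v = Param j" "\<psi> j \<noteq> 0"
      by (cases v) auto
    with \<psi> have "j \<in> {1..q}"
      unfolding Pspace_iff by blast
    with j(1) show "v \<in> Param ` {1..q}"
      by blast
  qed
  then have "finite {v. param_subst \<psi> v \<noteq> 0 \<and> param_subst \<psi> v \<noteq> mvar v}"
    by (rule finite_subset) simp
  moreover have "mcoeff (param_subst \<psi> v) 0 = 0" for v
    using \<psi> by (cases v) (simp_all add: Pspace_iff)
  ultimately show ?thesis
    by (simp add: substitution_def)
qed

lemma supp_param_subst:
  assumes "\<psi> \<in> Pspace q" "supp f \<subseteq> param_over q"
  shows "supp (msubst (param_subst \<psi>) f) \<subseteq> param_over q"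
proof -
  have "supp (param_subst \<psi> v) \<subseteq> param_over q" if "v \<in> Param ` {1..q}" for v
    using that assms(1) by (elim imageE) (simp add: Pspace_iff)
  then show ?thesis
    using supp_msubst_over[OF assms(2)[unfolded param_over_def]] by (simp add: param_over_def)
qed

lemma supp_mu: "j \<in> {1..q} \<Longrightarrow> supp (mu j) \<subseteq> param_over q"
  by (simp add: param_over_def supp_mvar_over)

lemma supp_ge_deg_param: "\<psi> \<in> Pspace q \<Longrightarrow> supp (param_subst \<psi> v) \<subseteq> ge_wt deg_wt (deg_wt v)"
  using substitution_param[of \<psi> q] by (simp add: substitution_def supp_ge_deg_1_iff One_nat_def)

text \<open>
  A reparametrization commutes with \<open>emb\<close>, because the two act on disjoint sets of variables.
\<close>

lemma reparametrization_step:
  assumes \<psi>: "reparametrization q \<psi>" and g: "supp g \<subseteq> over (planar_vars q)"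
  shows "elementary_step q (euler_field (emb g)) (euler_field (emb (msubst (param_subst \<psi>) g)))"
proof -
  let ?L = "msubst (param_subst \<psi>)"
  have P: "\<psi> \<in> Pspace q"
    using \<psi> by (simp add: reparametrization_def)
  note hom = cont_hom_msubst[OF substitution_param[OF P]]
  have "?L (emb g) = emb (?L g)"
  proof (rule cont_hom_eq_on[OF cont_hom_compose[OF hom cont_hom_emb] cont_hom_compose[OF cont_hom_emb hom] g])
    fix v assume "v \<in> planar_vars q"
    then consider "v = State X" | "v = State Y" | j where "v = Param j" "j \<in> {1..q}"
      by (auto simp: planar_vars_def)
    then show "?L (emb (mvar v)) = emb (?L (mvar v))"
    proof cases
      case 3
      have "emb (\<psi> j) = \<psi> j"
        unfolding emb_def
        by (rule msubst_ident[where A = "Param ` {1..q}"]) (use P in \<open>auto simp: Pspace_iff param_over_def emb_subst_def\<close>)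
      with 3 show ?thesis
        by simp
    qed (simp_all add: cont_hom_simps[OF hom])
  qed
  then have "(\<lambda>s. ?L (euler_field (emb g) s)) = euler_field (emb (?L g))"
    by (intro ext, rename_tac s, case_tac s) (simp_all add: euler_field_def smult_fun_def cont_hom_simps[OF hom])
  with reparametrize[OF \<psi>, of "euler_field (emb g)"] show ?thesis
    by simp
qed

lemma linear_reparametrization:
  fixes B C :: "nat \<Rightarrow> nat \<Rightarrow> 'a :: field_char_0"
  assumes BC: "\<And>i l. i \<in> {1..q} \<Longrightarrow> l \<in> {1..q} \<Longrightarrow> (\<Sum>j=1..q. B i j * C j l) = (if i = l then 1 else 0)"
    and CB: "\<And>i l. i \<in> {1..q} \<Longrightarrow> l \<in> {1..q} \<Longrightarrow> (\<Sum>j=1..q. C i j * B j l) = (if i = l then 1 else 0)"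
  defines "lin \<equiv> \<lambda>(B :: nat \<Rightarrow> nat \<Rightarrow> 'a) i. if i \<in> {1..q} then \<Sum>j=1..q. mconst (B i j) * mu j else 0"
  shows "reparametrization q (lin B)" and "lin B \<in> Pspace q"
    and "i \<in> {1..q} \<Longrightarrow> msubst (param_subst (lin B)) (\<Sum>j=1..q. mconst (C i j) * mu j) = mu i"
proof -
  have "supp (\<Sum>j=1..q. mconst (D i j) * mu j) \<subseteq> param_over q" for D :: "nat \<Rightarrow> nat \<Rightarrow> 'a" and i
    by (intro supp_sum supp_mconst_mult supp_mu)
  then have P: "lin D \<in> Pspace q" for D
    by (simp add: Pspace_iff lin_def)
  show "lin B \<in> Pspace q"
    by (rule P)
  have comp: "msubst (param_subst (lin D)) (\<Sum>j=1..q. mconst (F i j) * mu j) = mu i"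
    if i: "i \<in> {1..q}" and FD: "\<And>i l. i \<in> {1..q} \<Longrightarrow> l \<in> {1..q} \<Longrightarrow> (\<Sum>j=1..q. F i j * D j l) = (if i = l then 1 else 0)"
    for i D F
  proof -
    note hom = cont_hom_msubst[OF substitution_param[OF P[of D]]]
    have "msubst (param_subst (lin D)) (\<Sum>j=1..q. mconst (F i j) * mu j)
        = (\<Sum>j=1..q. mconst (F i j) * (\<Sum>l=1..q. mconst (D j l) * mu l))"
      by (simp add: cont_hom_simps[OF hom]) (simp add: lin_def)
    also have "\<dots> = (\<Sum>l=1..q. \<Sum>j=1..q. mconst (F i j * D j l) * mu l)"
      by (subst sum.swap) (simp add: sum_distrib_left mconst_mult mult.assoc)
    also have "\<dots> = (\<Sum>l=1..q. (if l = i then mu l else 0))"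
    proof (rule sum.cong[OF refl])
      fix l assume l: "l \<in> {1..q}"
      have "(\<Sum>j=1..q. mconst (F i j * D j l) * mu l) = mconst (\<Sum>j=1..q. F i j * D j l) * (mu l :: 'a series)"
        by (rule mfps_eqI) (simp add: sum_distrib_right)
      then show "(\<Sum>j=1..q. mconst (F i j * D j l) * mu l) = (if l = i then mu l else 0 :: 'a series)"
        using FD[OF i l] by (simp add: mconst_simps)
    qed
    also have "\<dots> = mu i"
      using i by simp
    finally show ?thesis .
  qed
  show "i \<in> {1..q} \<Longrightarrow> msubst (param_subst (lin B)) (\<Sum>j=1..q. mconst (C i j) * mu j) = mu i"
    by (rule comp[OF _ CB])
  have "msubst (param_subst (lin B)) (lin C j) = mu j" "msubst (param_subst (lin C)) (lin B j) = mu j"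
    if "j \<in> {1..q}" for j
    using comp[OF that CB] comp[OF that BC] that by (simp_all add: lin_def)
  then show "reparametrization q (lin B)"
    unfolding reparametrization_def using P by blast
qed

text \<open>
  A tuple \<open>\<mu> + O(2)\<close> has a right inverse: at each degree the unknown coefficient enters linearly, through
  the identity, since \<open>N \<circ> \<chi>\<close> with \<open>N = O(2)\<close> involves only coefficients of \<open>\<chi>\<close> of lower degree.
\<close>

lemma formal_right_inverse:
  fixes P :: "nat \<Rightarrow> 'a :: field_char_0 series"
  assumes P: "P \<in> Pspace q" and tangent: "\<And>j. j \<in> {1..q} \<Longrightarrow> supp (P j - mu j) \<subseteq> ge_deg 2"
  obtains \<chi> where "\<chi> \<in> Pspace q" "\<And>j. j \<in> {1..q} \<Longrightarrow> supp (\<chi> j - mu j) \<subseteq> ge_deg 2"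
    "\<And>j. j \<in> {1..q} \<Longrightarrow> msubst (param_subst \<chi>) (P j) = mu j"
proof -
  define G where "G = {(j, n). j \<in> {1..q} \<and> n \<in> param_over q \<and> n \<noteq> 0}"
  define \<chi> where "\<chi> a j = (Abs_mfps (\<lambda>n. if (j, n) \<in> G then a (j, n) else 0) :: 'a series)" for a j
  have \<chi>: "mcoeff (\<chi> a j) n = (if (j, n) \<in> G then a (j, n) else 0)" for a j n
    by (simp add: \<chi>_def Abs_mfps_inverse)
  have \<chi>P: "\<chi> a \<in> Pspace q" for a
    unfolding Pspace_iff by (auto simp: supp_def \<chi> G_def intro: mfps_eqI)
  let ?L = "\<lambda>a. msubst (param_subst (\<chi> a))"
  note hom = cont_hom_msubst[OF substitution_param[OF \<chi>P]]
  have split: "?L a (P j) = \<chi> a j + ?L a (P j - mu j)" for a j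
    by (simp add: cont_hom_diff[OF hom])
  define \<Phi> where "\<Phi> a i = (if i \<in> G then mcoeff (?L a (P (fst i)) - mu (fst i)) (snd i) else a i)" for a i
  have "\<exists>a. \<forall>i. \<Phi> a i = 0"
  proof (rule triangular_system_solvable[where c = 1 and rank = "\<lambda>i. mdeg (snd i)"])
    fix a b :: "nat \<times> (var \<Rightarrow>\<^sub>0 nat) \<Rightarrow> 'a" and i :: "nat \<times> (var \<Rightarrow>\<^sub>0 nat)"
    assume ab: "\<And>k. mdeg (snd k) < mdeg (snd i) \<Longrightarrow> a k = b k"
    show "\<Phi> a i - \<Phi> b i = 1 * (a i - b i)"
    proof (cases "i \<in> G")
      case True
      obtain j n where i: "i = (j, n)" by (cases i)
      let ?d = "mdeg n"
      have j: "j \<in> {1..q}" and d: "1 \<le> ?d"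
        using True mdeg_eq_0_iff[of n] by (auto simp: i G_def Suc_le_eq)
      have "supp (param_subst (\<chi> a) v - param_subst (\<chi> b) v) \<subseteq> ge_wt deg_wt (deg_wt v + (?d - 1))" for v
      proof (cases v)
        case (Param l)
        have "supp (\<chi> a l - \<chi> b l) \<subseteq> ge_deg ?d"
        proof (rule supp_subsetI, rule ccontr)
          fix m assume m: "mcoeff (\<chi> a l - \<chi> b l) m \<noteq> 0" "m \<notin> ge_deg ?d"
          then have "a (l, m) = b (l, m)"
            by (intro ab) (simp add: i ge_wt_def)
          with m(1) show False
            by (simp add: \<chi> split: if_splits)
        qed
        then show ?thesis
          using d by (simp add: Param)
      qed simp_all
      then have "supp (?L a (P j - mu j) - ?L b (P j - mu j)) \<subseteq> ge_deg (2 + (?d - 1))"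
        by (intro msubst_perturbation tangent j supp_ge_deg_param[OF \<chi>P] substitution_param[OF \<chi>P])
      then have "mcoeff (?L a (P j - mu j) - ?L b (P j - mu j)) n = 0"
        by (rule supp_subsetD) (use d in \<open>simp add: ge_wt_def\<close>)
      then show ?thesis
        using True by (simp add: i \<Phi>_def split[of _ j] \<chi> del: split_paired_All)
    qed (simp add: \<Phi>_def)
  qed simp
  then obtain a where a: "\<And>j n. \<Phi> a (j, n) = 0"
    by blast
  have sol: "?L a (P j) = mu j" if j: "j \<in> {1..q}" for j
  proof (rule mfps_eqI)
    fix n
    have s: "supp (?L a (P j) - mu j) \<subseteq> param_over q"
      using P j by (intro supp_diff supp_param_subst[OF \<chi>P] supp_mu) (auto simp: Pspace_iff)
    have z: "mcoeff (?L a (P j) - mu j) 0 = 0"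
      using P by (simp add: mcoeff_msubst_0[OF substitution_param[OF \<chi>P]] Pspace_iff)
    show "mcoeff (?L a (P j)) n = mcoeff (mu j) n"
    proof (cases "(j, n) \<in> G")
      case True
      then show ?thesis
        using a[of j n] by (simp add: \<Phi>_def)
    next
      case False
      then have "n \<notin> param_over q \<or> n = 0"
        using j by (simp add: G_def)
      then have "mcoeff (?L a (P j) - mu j) n = 0"
        using supp_subsetD[OF s] z by metis
      then show ?thesis
        by simp
    qed
  qed
  show thesis
  proof
    show "supp (\<chi> a j - mu j) \<subseteq> ge_deg 2" if "j \<in> {1..q}" for j
    proof -
      have "\<chi> a j - mu j = - ?L a (P j - mu j)"
        using split[of a j] sol[OF that] by (simp add: algebra_simps)
      moreover have "supp (?L a (P j - mu j)) \<subseteq> ge_deg 2"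
        by (rule supp_msubst_ge[OF tangent[OF that] supp_ge_deg_param[OF \<chi>P]])
      ultimately show ?thesis
        by (simp add: supp_uminus)
    qed
  qed (fact \<chi>P sol)+
qed

lemma formal_inverse:
  fixes P :: "nat \<Rightarrow> 'a :: field_char_0 series"
  assumes P: "P \<in> Pspace q" and tangent: "\<And>j. j \<in> {1..q} \<Longrightarrow> supp (P j - mu j) \<subseteq> ge_deg 2"
  obtains \<chi> where "reparametrization q \<chi>" "\<And>j. j \<in> {1..q} \<Longrightarrow> msubst (param_subst \<chi>) (P j) = mu j"
proof -
  obtain \<chi> where \<chi>: "\<chi> \<in> Pspace q" "\<And>j. j \<in> {1..q} \<Longrightarrow> supp (\<chi> j - mu j) \<subseteq> ge_deg 2"
    "\<And>j. j \<in> {1..q} \<Longrightarrow> msubst (param_subst \<chi>) (P j) = mu j"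
    using formal_right_inverse[OF P tangent] by metis
  obtain \<xi> where \<xi>: "\<xi> \<in> Pspace q" "\<And>j. j \<in> {1..q} \<Longrightarrow> msubst (param_subst \<xi>) (\<chi> j) = mu j"
    using formal_right_inverse[OF \<chi>(1,2)] by metis
  \<comment> \<open>Right inverses of right inverses: \<open>P = P \<circ> (\<chi> \<circ> \<xi>) = (P \<circ> \<chi>) \<circ> \<xi> = \<xi>\<close>.\<close>
  have "\<xi> j = P j" if j: "j \<in> {1..q}" for j
  proof -
    note hom = cont_hom_msubst[OF substitution_param[OF \<chi>(1)]] cont_hom_msubst[OF substitution_param[OF \<xi>(1)]]
    have "msubst (param_subst \<xi>) (msubst (param_subst \<chi>) (P j)) = P j"
    proof (rule cont_hom_eq_on[OF cont_hom_compose[OF hom(2,1)] cont_hom_id])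
      show "supp (P j) \<subseteq> over (Param ` {1..q})"
        using P by (auto simp: Pspace_iff param_over_def)
    qed (use \<xi>(2) in auto)
    then show ?thesis
      using \<chi>(3)[OF j] by simp
  qed
  then have "reparametrization q \<chi>"
    unfolding reparametrization_def using \<chi>(1,3) \<xi> P by metis
  then show thesis
    using that \<chi>(3) by blast
qed

section \<open>Reduction to the normal form\<close>

text \<open>
  The coefficient of \<open>R\<^sup>k\<close>, as a series in the other variables.
\<close>

definition slice :: "nat \<Rightarrow> 'a :: comm_ring_1 series \<Rightarrow> 'a series" where
  "slice k h = Abs_mfps (\<lambda>n. if Poly_Mapping.lookup n (State Y) = 0 then mcoeff h (radius_pow k + n) else 0)"

lemma mcoeff_slice:
  "mcoeff (slice k h) n = (if Poly_Mapping.lookup n (State Y) = 0 then mcoeff h (radius_pow k + n) else 0)"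
  by (simp add: slice_def Abs_mfps_inverse)

lemma slice_expansion:
  fixes h :: "'a :: comm_ring_1 series"
  assumes "\<And>n. r < Poly_Mapping.lookup n (State Y) \<Longrightarrow> mcoeff h n = 0"
  shows "h = (\<Sum>k\<le>r. yv ^ k * slice k h)"
proof (rule mfps_eqI)
  fix n :: "var \<Rightarrow>\<^sub>0 nat"
  let ?y = "Poly_Mapping.lookup n (State Y)"
  have split: "n = radius_pow k + (n - radius_pow k)" if "k \<le> ?y" for k
    using that by (intro poly_mapping_eqI) (auto simp: lookup_add lookup_minus lookup_single when_def)
  have co: "mcoeff (yv ^ k * slice k h) n = (if k = ?y then mcoeff h n else 0)" for k
  proof (cases "k \<le> ?y")
    case True
    have "mcoeff (yv ^ k * slice k h) n = mcoeff (slice k h) (n - radius_pow k)"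
      using split[OF True] unfolding monomial_single[symmetric] mcoeff_monomial_mult by auto
    then show ?thesis
      using True split[OF True] by (auto simp: mcoeff_slice lookup_minus)
  next
    case False
    then have "\<nexists>b. n = radius_pow k + b"
      by (auto simp: lookup_add)
    then show ?thesis
      using False unfolding monomial_single[symmetric] mcoeff_monomial_mult by auto
  qed
  show "mcoeff h n = mcoeff (\<Sum>k\<le>r. yv ^ k * slice k h) n"
    using assms[of n] by (simp add: co not_le)
qed

lemma supp_slice: "supp h \<subseteq> over (base_vars q) \<Longrightarrow> supp (slice k h) \<subseteq> param_over q"
proof (rule supp_subsetI)
  fix n assume h: "supp h \<subseteq> over (base_vars q)" and n: "mcoeff (slice k h) n \<noteq> 0"
  then have y: "Poly_Mapping.lookup n (State Y) = 0" and "mcoeff h (radius_pow k + n) \<noteq> 0"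
    by (auto simp: mcoeff_slice split: if_splits)
  then have "radius_pow k + n \<in> over (base_vars q)"
    using h by (auto simp: supp_def)
  then have "Poly_Mapping.keys n \<subseteq> base_vars q"
    using keys_subset_add[of n "radius_pow k"] by (auto simp: over_def add.commute)
  moreover have "State Y \<notin> Poly_Mapping.keys n"
    using y by (simp add: in_keys_nat_iff)
  ultimately show "n \<in> param_over q"
    by (auto simp: over_def param_over_def base_vars_def)
qed

lemma mdeg_1_single: "mdeg n = 1 \<Longrightarrow> \<exists>v. n = Poly_Mapping.single v 1"
proof (induction n rule: monomial_induct)
  case (add n v)
  have "mdeg (Poly_Mapping.single v 1 + n) = 1 + mdeg n"
    by (simp only: wt_add wt_single deg_wt_def mult_1)
  then have "mdeg n = 0"
    using add.prems by linarith
  then have "n = 0"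
    using mdeg_eq_0_iff by blast
  then show ?case by auto
qed simp

lemma single_1_eq_iff: "Poly_Mapping.single u (1 :: nat) = Poly_Mapping.single v 1 \<longleftrightarrow> u = v"
  by (metis lookup_single_eq lookup_single_not_eq zero_neq_one)

lemma linear_part_remainder:
  fixes p :: "'a :: comm_ring_1 series"
  assumes p: "supp p \<subseteq> param_over q" "mcoeff p 0 = 0"
  shows "supp (p - (\<Sum>j=1..q. mconst (mcoeff p (param_var j)) * mu j)) \<subseteq> ge_deg 2"
proof (rule supp_subsetI, rule ccontr)
  fix n
  let ?l = "\<Sum>j=1..q. mconst (mcoeff p (param_var j)) * mu j"
  assume n: "mcoeff (p - ?l) n \<noteq> 0" "n \<notin> ge_deg 2"
  have "n \<noteq> 0"
    using n(1) p(2) by auto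
  then have "mdeg n = 1"
    using n(2) mdeg_eq_0_iff[of n] by (simp add: ge_wt_def)
  then obtain v where v: "n = Poly_Mapping.single v 1"
    using mdeg_1_single by blast
  have "supp (p - ?l) \<subseteq> param_over q"
    by (intro supp_diff p supp_sum supp_mconst_mult supp_mu)
  then have "n \<in> param_over q"
    using n(1) by (auto simp: supp_def)
  then obtain j where j: "v = Param j" "j \<in> {1..q}"
    by (auto simp: v param_over_def over_def)
  have "mcoeff ?l n = (\<Sum>i=1..q. if i = j then mcoeff p (param_var i) else 0)"
    unfolding mcoeff_sum
    by (rule sum.cong) (auto simp: v j mvar_eq_monomial mcoeff_monomial single_1_eq_iff)
  also have "\<dots> = mcoeff p n"
    using j by (simp add: v)
  finally show False
    using n(1) by simp
qed

text \<open>
  The invertible linear change of parameters and the formal inverse function theorem turn the coefficients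
  of \<open>1, R, \<dots>, R\<^sup>r\<close> into the first \<open>r + 1\<close> parameters.
\<close>

lemma parameters_from_coefficients:
  fixes p :: "nat \<Rightarrow> 'a :: field_char_0 series" and \<beta> :: "'a series"
  assumes p: "\<And>k. k \<le> r \<Longrightarrow> supp (p k) \<subseteq> param_over q \<and> mcoeff (p k) 0 = 0"
    and indep: "\<And>c. (\<And>j. j \<in> {1..q} \<Longrightarrow> (\<Sum>k\<le>r. c k * mcoeff (p k) (param_var j)) = 0) \<Longrightarrow> (\<And>k. k \<le> r \<Longrightarrow> c k = 0)"
    and \<beta>: "supp \<beta> \<subseteq> over {State X, State Y}"
  shows "(elementary_step q)\<^sup>*\<^sup>* (euler_field (emb (\<beta> + (\<Sum>k\<le>r. yv ^ k * p k))))
      (euler_field (emb (\<beta> + (\<Sum>k\<le>r. yv ^ k * mu (k + 1)))))" and "r + 1 \<le> q"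
proof -
  obtain B C :: "nat \<Rightarrow> nat \<Rightarrow> 'a" where
    C: "\<And>k j. k \<le> r \<Longrightarrow> j \<in> {1..q} \<Longrightarrow> C (k + 1) j = mcoeff (p k) (param_var j)" and rq: "r + 1 \<le> q"
    and BC: "\<And>i l. i \<in> {1..q} \<Longrightarrow> l \<in> {1..q} \<Longrightarrow> (\<Sum>j=1..q. B i j * C j l) = (if i = l then 1 else 0)"
    and CB: "\<And>i l. i \<in> {1..q} \<Longrightarrow> l \<in> {1..q} \<Longrightarrow> (\<Sum>j=1..q. C i j * B j l) = (if i = l then 1 else 0)"
  proof (rule extend_independent_rows[where q = q and r = r and H = "\<lambda>k j. mcoeff (p k) (param_var j)"])
    show "c k = 0" if "\<And>j. j \<in> {1..q} \<Longrightarrow> (\<Sum>k\<le>r. c k * mcoeff (p k) (param_var j)) = 0" "k \<le> r" for c k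
      by (rule indep[OF that])
  qed (rule that)
  then show "r + 1 \<le> q" by simp
  define \<psi> where "\<psi> = (\<lambda>i. if i \<in> {1..q} then \<Sum>j=1..q. mconst (B i j) * mu j else 0 :: 'a series)"
  have \<psi>: "reparametrization q \<psi>" "\<psi> \<in> Pspace q"
    "\<And>i. i \<in> {1..q} \<Longrightarrow> msubst (param_subst \<psi>) (\<Sum>j=1..q. mconst (C i j) * mu j) = mu i"
    using linear_reparametrization[of q B C, OF BC CB] unfolding \<psi>_def by blast+
  note hom\<psi> = cont_hom_msubst[OF substitution_param[OF \<psi>(2)]]
  define p' where "p' k = msubst (param_subst \<psi>) (p k)" for k
  have p': "supp (p' k - mu (k + 1)) \<subseteq> ge_deg 2" "supp (p' k) \<subseteq> param_over q" "mcoeff (p' k) 0 = 0" if k: "k \<le> r" for k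
  proof -
    let ?l = "\<Sum>j=1..q. mconst (mcoeff (p k) (param_var j)) * mu j"
    have "?l = (\<Sum>j=1..q. mconst (C (k + 1) j) * mu j)"
      by (rule sum.cong) (simp_all add: C[OF k])
    then have "msubst (param_subst \<psi>) ?l = mu (k + 1)"
      using \<psi>(3)[of "k + 1"] k rq by simp
    then have "p' k - mu (k + 1) = msubst (param_subst \<psi>) (p k - ?l)"
      by (simp add: p'_def cont_hom_diff[OF hom\<psi>])
    then show "supp (p' k - mu (k + 1)) \<subseteq> ge_deg 2"
      using supp_msubst_ge[OF linear_part_remainder supp_ge_deg_param[OF \<psi>(2)], of "p k" q] p[OF k] by simp
    show "supp (p' k) \<subseteq> param_over q" "mcoeff (p' k) 0 = 0"
      using p[OF k] supp_param_subst[OF \<psi>(2)] mcoeff_msubst_0[OF substitution_param[OF \<psi>(2)]] by (simp_all add: p'_def)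
  qed
  define P where "P j = (if j \<in> {1..r + 1} then p' (j - 1) else if j \<in> {1..q} then mu j else 0)" for j
  have "supp (P j) \<subseteq> param_over q" "mcoeff (P j) 0 = 0" for j
  proof -
    consider k where "j = k + 1" "k \<le> r" | "j \<notin> {1..r + 1}" "j \<in> {1..q}" | "j \<notin> {1..r + 1}" "j \<notin> {1..q}"
      by (cases j) auto
    then have "supp (P j) \<subseteq> param_over q \<and> mcoeff (P j) 0 = 0"
    proof cases
      case 1
      then show ?thesis
        using p'(2,3)[of k] by (simp add: P_def)
    next
      case 2
      then have "P j = mu j"
        unfolding P_def by (simp only: if_True if_False)
      then show ?thesis
        using supp_mu[OF 2(2)] by simp
    next
      case 3
      then show ?thesis
        unfolding P_def by (simp only: if_False mcoeff_simps supp_0 simp_thms)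
    qed
    then show "supp (P j) \<subseteq> param_over q" "mcoeff (P j) 0 = 0"
      by blast+
  qed
  moreover have "P j = 0" if "j \<notin> {1..q}" for j
    using that rq by (auto simp: P_def)
  ultimately have P: "P \<in> Pspace q"
    unfolding Pspace_iff by blast
  have "supp (P j - mu j) \<subseteq> ge_deg 2" if "j \<in> {1..q}" for j
    using that p'(1)[of "j - 1"] by (cases "j \<in> {1..r + 1}") (simp_all add: P_def)
  then obtain \<chi> where \<chi>: "reparametrization q \<chi>" "\<And>j. j \<in> {1..q} \<Longrightarrow> msubst (param_subst \<chi>) (P j) = mu j"
    using formal_inverse[OF P] by metis
  have \<chi>P: "\<chi> \<in> Pspace q"
    using \<chi>(1) by (simp add: reparametrization_def)
  note hom\<chi> = cont_hom_msubst[OF substitution_param[OF \<chi>P]]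
  have \<chi>p: "msubst (param_subst \<chi>) (p' k) = mu (k + 1)" if "k \<le> r" for k
    using \<chi>(2)[of "k + 1"] that rq by (simp add: P_def)
  have fixed: "msubst (param_subst \<xi>) \<beta> = \<beta>" for \<xi>
    by (rule msubst_ident[OF \<beta>]) auto
  have y: "msubst (param_subst \<xi>) yv = yv" for \<xi> :: "nat \<Rightarrow> 'a series"
    by simp
  have over: "supp (\<beta> + (\<Sum>k\<le>r. yv ^ k * F k)) \<subseteq> over (planar_vars q)" if "\<And>k. k \<le> r \<Longrightarrow> supp (F k) \<subseteq> param_over q" for F
  proof (intro supp_add supp_sum supp_mult_over supp_power_over supp_mvar_over)
    show "supp \<beta> \<subseteq> over (planar_vars q)"
      using \<beta> over_mono[of "{State X, State Y}" "planar_vars q"] by (auto simp: planar_vars_def)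
    show "supp (F k) \<subseteq> over (planar_vars q)" if "k \<in> {..r}" for k
      using \<open>\<And>k. k \<le> r \<Longrightarrow> supp (F k) \<subseteq> param_over q\<close>[of k] that over_mono[of "Param ` {1..q}" "planar_vars q"]
      by (auto simp: planar_vars_def param_over_def)
  qed (simp add: planar_vars_def)
  have step1: "elementary_step q (euler_field (emb (\<beta> + (\<Sum>k\<le>r. yv ^ k * p k))))
      (euler_field (emb (\<beta> + (\<Sum>k\<le>r. yv ^ k * p' k))))"
    using reparametrization_step[OF \<psi>(1) over, of p] p
    by (simp add: cont_hom_add[OF hom\<psi>] cont_hom_sum[OF hom\<psi>] cont_hom_mult[OF hom\<psi>] cont_hom_power[OF hom\<psi>] fixed p'_def)
  have "(\<Sum>k\<le>r. yv ^ k * msubst (param_subst \<chi>) (p' k)) = (\<Sum>k\<le>r. yv ^ k * mu (k + 1))"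
    by (rule sum.cong) (simp_all add: \<chi>p)
  then have step2: "elementary_step q (euler_field (emb (\<beta> + (\<Sum>k\<le>r. yv ^ k * p' k))))
      (euler_field (emb (\<beta> + (\<Sum>k\<le>r. yv ^ k * mu (k + 1)))))"
    using reparametrization_step[OF \<chi>(1) over, of p'] p'(2)
    by (simp add: cont_hom_add[OF hom\<chi>] cont_hom_sum[OF hom\<chi>] cont_hom_mult[OF hom\<chi>] cont_hom_power[OF hom\<chi>] fixed)
  show "(elementary_step q)\<^sup>*\<^sup>* (euler_field (emb (\<beta> + (\<Sum>k\<le>r. yv ^ k * p k))))
      (euler_field (emb (\<beta> + (\<Sum>k\<le>r. yv ^ k * mu (k + 1)))))"
    using step1 step2 by (meson r_into_rtranclp rtranclp.rtrancl_into_rtrancl)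
qed

text \<open>
  A vanishing combination of the new rows is one of the old rows with coefficients \<open>d = c t\<close>. The
  equations \<open>d = 0\<close> are solved for \<open>c\<close> from the last index downwards.
\<close>

lemma unipotent_rows_independent:
  fixes t H :: "nat \<Rightarrow> nat \<Rightarrow> 'a :: comm_ring_1"
  assumes t: "\<And>k. t k k = 1"
    and indep: "\<And>d. (\<And>j. j \<in> J \<Longrightarrow> (\<Sum>i\<le>r. d i * H i j) = 0) \<Longrightarrow> (\<And>i. i \<le> r \<Longrightarrow> d i = 0)"
    and c: "\<And>j. j \<in> J \<Longrightarrow> (\<Sum>k\<le>r. c k * (\<Sum>i\<le>k. t k i * H i j)) = 0" and k: "k \<le> r"
  shows "c k = 0"
proof -
  let ?t = "\<lambda>k i. if i \<le> k then t k i else 0"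
  define d where "d i = (\<Sum>k\<le>r. c k * ?t k i)" for i
  have "(\<Sum>i\<le>r. d i * H i j) = 0" if "j \<in> J" for j
  proof -
    have "(\<Sum>i\<le>k. t k i * H i j) = (\<Sum>i\<le>r. ?t k i * H i j)" if "k \<le> r" for k
      using that by (intro sum.mono_neutral_cong_left) auto
    then have "0 = (\<Sum>k\<le>r. c k * (\<Sum>i\<le>r. ?t k i * H i j))"
      using c[OF that] by simp
    also have "\<dots> = (\<Sum>k\<le>r. \<Sum>i\<le>r. c k * ?t k i * H i j)"
      by (simp add: sum_distrib_left mult.assoc)
    also have "\<dots> = (\<Sum>i\<le>r. d i * H i j)"
      unfolding d_def sum_distrib_right by (rule sum.swap)
    finally show ?thesis by simp
  qed
  then have d: "d i = 0" if "i \<le> r" for i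
    using indep that by blast
  show ?thesis
    using k
  proof (induction "r - k" arbitrary: k rule: less_induct)
    case less
    have "d k = (\<Sum>l\<in>{k}. c l * ?t l k)"
      unfolding d_def
    proof (rule sum.mono_neutral_right)
      show "\<forall>l\<in>{..r} - {k}. c l * ?t l k = 0"
        using less.hyps less.prems by (auto simp: not_le)
    qed (use less.prems in auto)
    then show ?case
      using d[OF less.prems] by (simp add: t)
  qed
qed

section \<open>Infinite level normal form\<close>

interpretation fields: vector_space "\<lambda>(c :: 'a :: field_char_0) (w :: 'a vfield). smult_fun (mconst c) w"
  by unfold_locales (auto simp: smult_fun_def plus_fun_def mconst_simps mconst_mult algebra_simps)

text \<open>
  A basis of \<open>B\<close> is extended by \<open>w\<close> and then to a basis of \<open>V\<close>; the vectors outside the basis of \<open>B\<close> span \<open>C\<close>.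
\<close>

lemma complement_containing:
  fixes V B :: "'a :: field_char_0 vfield set"
  assumes V: "fields.subspace V" and B: "fields.subspace B" "B \<subseteq> V" and w: "w \<in> V" "w \<in> B \<Longrightarrow> w = 0"
  obtains C where "complement_in V B C" "w \<in> C"
proof -
  obtain b where b: "b \<subseteq> B" "fields.independent b" "B \<subseteq> fields.span b"
    using fields.maximal_independent_subset_extend[of "{}" B] fields.independent_empty by auto
  have span_b: "fields.span b = B"
    using fields.span_minimal[OF b(1) B(1)] b(3) by blast
  define b' where "b' = (if w = 0 then b else insert w b)"
  have "w \<notin> fields.span b" if "w \<noteq> 0"
    using that w(2) unfolding span_b by blast
  then have "fields.independent b'"
    using fields.independent_insertI[of w b] b(2) by (simp add: b'_def)
  moreover have "b' \<subseteq> V"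
    using b(1) B(2) w(1) by (auto simp: b'_def)
  ultimately obtain d where d: "b' \<subseteq> d" "d \<subseteq> V" "fields.independent d" "V \<subseteq> fields.span d"
    using fields.maximal_independent_subset_extend by metis
  have bd: "b \<subseteq> d"
    using d(1) by (auto simp: b'_def split: if_splits)
  have span_d: "fields.span d = V"
    using fields.span_minimal[OF d(2) V] d(4) by blast
  define C where "C = fields.span (d - b)"
  have "B \<inter> C \<subseteq> {0}"
  proof
    fix x assume x: "x \<in> B \<inter> C"
    then have "fields.representation d x = fields.representation b x"
      "fields.representation d x = fields.representation (d - b) x"
      using fields.representation_extend[OF d(3), of x b] fields.representation_extend[OF d(3), of x "d - b"] bd
      by (auto simp: span_b C_def)
    then have zero: "fields.representation d x v = 0" for v
      using fields.representation_ne_zero[of b x v] fields.representation_ne_zero[of "d - b" x v] by auto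
    have "x \<in> fields.span d"
      using x B(2) span_d by blast
    then have "(\<Sum>v\<in>{v. fields.representation d x v \<noteq> 0}. smult_fun (mconst (fields.representation d x v)) v) = x"
      by (rule fields.sum_nonzero_representation_eq[OF d(3)])
    then show "x \<in> {0}"
      by (simp add: zero)
  qed
  then have "B \<inter> C = {0}"
    using fields.subspace_0[OF B(1)] fields.span_zero[of "d - b"] by (auto simp: C_def)
  moreover have "{x + y | x y. x \<in> B \<and> y \<in> C} = V"
  proof -
    have "b \<union> (d - b) = d"
      using bd by blast
    then show ?thesis
      using fields.span_Un[of b "d - b"] by (simp add: span_b span_d C_def)
  qed
  moreover have "w \<in> C"
  proof (cases "w = 0")
    case False
    then have "w \<in> d - b"
      using d(1) w(2) b(1) by (auto simp: b'_def)
    then show ?thesis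
      unfolding C_def by (rule fields.span_base)
  qed (simp add: C_def fields.span_zero)
  ultimately show thesis
    using that[of C] fields.subspace_span[of "d - b"] by (simp add: complement_in_def C_def)
qed

lemma euler_field_apply: "euler_field a s = a * Euler s"
  by (simp add: euler_field_def smult_fun_def)

lemma euler_field_add: "euler_field (a + b) = euler_field a + euler_field b"
  and euler_field_scale: "euler_field (mconst c * a) = smult_fun (mconst c) (euler_field a)"
  and euler_field_0: "euler_field 0 = 0"
  by (auto simp: euler_field_def smult_fun_def plus_fun_def algebra_simps)

lemma euler_field_emb_eqD: "euler_field a = euler_field b \<Longrightarrow> a = b"
proof -
  assume "euler_field a = euler_field b"
  then have "euler_field a X = euler_field b X"
    by simp
  then have "xv * a = xv * b"
    by (simp add: euler_field_apply mult.commute)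
  then show "a = b"
    by (rule mvar_mult_cancel)
qed

lemma planar_add: "f \<in> planar q M \<Longrightarrow> g \<in> planar q M \<Longrightarrow> f + g \<in> planar q M"
  and planar_scale: "f \<in> planar q M \<Longrightarrow> mconst c * f \<in> planar q M"
  and planar_0: "0 \<in> planar q M"
  by (simp_all add: planar_def supp_add supp_mconst_mult)

lemma planar_diff: "f \<in> planar q M \<Longrightarrow> g \<in> planar q M \<Longrightarrow> f - g \<in> planar q M"
  by (simp add: planar_def supp_diff)

lemma planar_sum: "(\<And>i. i \<in> I \<Longrightarrow> F i \<in> planar q M) \<Longrightarrow> (\<Sum>i\<in>I. F i) \<in> planar q M"
  by (induction I rule: infinite_finite_induct) (simp_all add: planar_0 planar_add)

lemma subspace_Sgrade: "fields.subspace (Sgrade q r n)"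
proof (rule fields.subspaceI)
  show "0 \<in> Sgrade q r n"
    unfolding Sgrade_eq using planar_0 by (intro image_eqI[of _ _ 0]) (simp_all add: emb_simps euler_field_0)
  show "x + y \<in> Sgrade q r n" if "x \<in> Sgrade q r n" "y \<in> Sgrade q r n" for x y :: "'a vfield"
    using that unfolding Sgrade_eq by (auto simp: euler_field_add[symmetric] emb_simps(3)[symmetric] intro!: imageI planar_add)
  show "smult_fun (mconst c) x \<in> Sgrade q r n" if "x \<in> Sgrade q r n" for c and x :: "'a vfield"
  proof -
    obtain g where g: "g \<in> planar q (eq_wt (grade_wt r) n)" "x = euler_field (emb g)"
      using \<open>x \<in> Sgrade q r n\<close> by (auto simp: Sgrade_eq)
    have "smult_fun (mconst c) x = euler_field (emb (mconst c * g))"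
      by (simp add: g emb_simps euler_field_scale)
    then show ?thesis
      unfolding Sgrade_eq using planar_scale[OF g(1)] by blast
  qed
qed

lemma emb_param: "supp p \<subseteq> param_over q \<Longrightarrow> emb p = p"
  unfolding emb_def param_over_def by (erule msubst_ident) (auto simp: emb_subst_def)

lemma pdiff_param_emb: "pdiff (Param j) (emb f) = emb (pdiff (Param j) f)"
  by (rule derivation_along_eq[OF cont_hom_emb derivation_along_compose_left[OF cont_hom_emb derivation_pdiff]
        derivation_along_compose_right[OF cont_hom_emb derivation_pdiff]],
      rename_tac v, case_tac v rule: var.exhaust, rename_tac s, case_tac s)
     (simp_all add: pdiff_mvar emb_simps power2_eq_square cont_linear_add[OF cont_linear_pdiff]
       cont_linear_0[OF cont_linear_pdiff] derivation_along_mult[OF derivation_pdiff])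

lemma lie_bracket_euler_field:
  "lie_bracket (euler_field a) (euler_field b) = euler_field (a * lie_deriv Euler b - b * lie_deriv Euler a)"
  by (rule ext) (simp add: lie_bracket_def lie_deriv_euler_field euler_field_apply lie_deriv_mult algebra_simps)

text \<open>
  The action of \<open>(a E, P, \<tau>)\<close> on \<open>b E\<close>, in terms of the coefficient \<open>b\<close>; the last summand comes from
  \<open>[a E, b E] = (a E b - b E a) E\<close>.
\<close>

definition act_coeff :: "nat \<Rightarrow> 'a :: field_char_0 series \<Rightarrow> (nat \<Rightarrow> 'a series) \<Rightarrow> 'a series \<Rightarrow> 'a series \<Rightarrow> 'a series" where
  "act_coeff q a P \<tau> b = (\<Sum>j=1..q. pdiff (Param j) b * P j) + \<tau> * b + (a * planar_euler b - b * planar_euler a)"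

lemma act_euler_field:
  fixes a b \<tau> :: "'a :: field_char_0 series"
  assumes P: "P \<in> Pspace q"
  shows "act q (euler_field (emb a), P, emb \<tau>) (euler_field (emb b)) = euler_field (emb (act_coeff q a P \<tau> b))"
proof
  fix s
  have "pdiff (Param j) (Euler s :: 'a series) = 0" for j
    by (cases s) (simp_all add: derivation_along_mult[OF derivation_pdiff] derivation_mconst[OF derivation_pdiff] pdiff_mvar)
  then have "pdiff (Param j) (emb b * Euler s) * P j = emb (pdiff (Param j) b * P j) * Euler s" for j
    using P emb_param[of "P j" q]
    by (simp add: Pspace_iff derivation_along_mult[OF derivation_pdiff] pdiff_param_emb emb_simps mult_ac)
  then have "(\<Sum>j=1..q. pdiff (Param j) (emb b * Euler s) * P j) = (\<Sum>j=1..q. emb (pdiff (Param j) b * P j)) * Euler s"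
    by (simp add: sum_distrib_right)
  then show "act q (euler_field (emb a), P, emb \<tau>) (euler_field (emb b)) s = euler_field (emb (act_coeff q a P \<tau> b)) s"
    by (simp add: lie_bracket_euler_field lie_deriv_emb)
       (simp add: plus_fun_def smult_fun_def euler_field_apply act_coeff_def emb_simps algebra_simps)
qed

lemma AgradeE:
  assumes "A \<in> Agrade q r n"
  obtains a P \<tau> where "A = (euler_field (emb a), P, emb \<tau>)" "a \<in> planar q (eq_wt (grade_wt r) n)"
    "\<tau> \<in> planar q (eq_wt (grade_wt r) n)" "P \<in> Pspace q" "\<And>j. supp (P j) \<subseteq> eq_wt (grade_wt r) (n + alpha r j)"
proof -
  obtain S P T where A: "A = (S, P, T)" by (cases A)
  obtain a where a: "S = euler_field (emb a)" "a \<in> planar q (eq_wt (grade_wt r) n)"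
    using assms by (auto simp: A Agrade_def Sgrade_eq)
  obtain \<tau> where \<tau>: "T = emb \<tau>" "\<tau> \<in> planar q (eq_wt (grade_wt r) n)"
    using assms by (auto simp: A Agrade_def Tgrade_eq)
  have P: "P \<in> Pspace q" and Pw: "\<And>j m. mcoeff (P j) m \<noteq> 0 \<Longrightarrow>
      (\<Sum>p=1..q. alpha r p * Poly_Mapping.lookup m (Param p)) = n + alpha r j"
    using assms by (auto simp: A Agrade_def Pgrade_def)
  have "supp (P j) \<subseteq> eq_wt (grade_wt r) (n + alpha r j)" for j
  proof (rule supp_subsetI)
    fix m assume m: "mcoeff (P j) m \<noteq> 0"
    then have "m \<in> param_over q"
      using P by (auto simp: Pspace_iff supp_def)
    then have "wt (grade_wt r) m = (\<Sum>v\<in>Param ` {1..q}. grade_wt r v * Poly_Mapping.lookup m v)"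
      by (intro wt_superset) (auto simp: param_over_def over_def)
    also have "\<dots> = (\<Sum>p=1..q. alpha r p * Poly_Mapping.lookup m (Param p))"
      by (simp add: sum.reindex[OF inj_on_subset[OF inj_Param]] grade_wt_def)
    finally show "m \<in> eq_wt (grade_wt r) (n + alpha r j)"
      using Pw[OF m] by (simp add: eq_wt_def)
  qed
  then show thesis
    using that A a \<tau> P by blast
qed

text \<open>
  All three parts of the action are additive in the grades; for the parameter part, \<open>\<partial>/\<partial>\<mu>\<^sub>j\<close> lowers the grade
  by \<open>\<alpha>\<^sub>j\<close>, which the convention for \<open>P\<^sub>j\<close> makes up for.
\<close>

lemma act_grade:
  assumes A: "A \<in> Agrade q r n" and w: "w \<in> Sgrade q r i"
  shows "act q A w \<in> Sgrade q r (n + i)"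
proof -
  let ?w = "grade_wt r"
  obtain a P \<tau> where A: "A = (euler_field (emb a), P, emb \<tau>)" "a \<in> planar q (eq_wt ?w n)"
    "\<tau> \<in> planar q (eq_wt ?w n)" "P \<in> Pspace q" "\<And>j. supp (P j) \<subseteq> eq_wt ?w (n + alpha r j)"
    using AgradeE[OF A] by metis
  obtain b where b: "w = euler_field (emb b)" "b \<in> planar q (eq_wt ?w i)"
    using w by (auto simp: Sgrade_eq)
  have prod: "f * g \<in> planar q (eq_wt ?w (n + i))"
    if "f \<in> planar q (eq_wt ?w n)" "supp g \<subseteq> over (planar_vars q)" "supp g \<subseteq> eq_wt ?w i" for f g :: "'a series"
    using that by (simp add: planar_def supp_mult_over supp_mult_eq)
  have b': "supp b \<subseteq> over (planar_vars q)" "supp b \<subseteq> eq_wt ?w i" and a': "supp (planar_euler a) \<subseteq> eq_wt ?w n"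
    and "planar_euler a \<in> planar q (eq_wt ?w n)"
    using A(2) b(2) by (simp_all add: planar_def supp_planar_euler)
  have dP: "pdiff (Param j) b * P j \<in> planar q (eq_wt ?w (n + i))" for j
  proof -
    have Pj: "supp (P j) \<subseteq> over (planar_vars q)" "mcoeff (P j) 0 = 0"
      using A(4) over_mono[of "Param ` {1..q}" "planar_vars q"] by (auto simp: Pspace_iff param_over_def planar_vars_def)
    have "supp (pdiff (Param j) b) \<subseteq> {m. wt ?w m + alpha r j = i}"
      by (rule supp_pdiff[OF b'(2)]) (simp add: eq_wt_def grade_wt_def)
    then have "supp (pdiff (Param j) b * P j) \<subseteq> eq_wt ?w (n + i)"
      by (rule supp_mult[OF _ A(5)]) (auto simp: eq_wt_def)
    then show ?thesis
      using Pj b'(1) by (simp add: planar_def supp_mult_over supp_pdiff_over)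
  qed
  have "b * planar_euler a \<in> planar q (eq_wt ?w (n + i))"
    using prod[OF \<open>planar_euler a \<in> _\<close> b'] by (simp add: mult.commute)
  then have "act_coeff q a P \<tau> b \<in> planar q (eq_wt ?w (n + i))"
    unfolding act_coeff_def
    by (intro planar_add planar_sum planar_diff dP prod[OF A(3) b'] prod[OF A(2)] supp_planar_euler b')
  then show ?thesis
    unfolding A(1) b(1) act_euler_field[OF A(4)] Sgrade_eq by (rule imageI)
qed

lemma act_zero: "act q A 0 = 0"
  by (cases A) (auto simp: fun_eq_iff zero_fun_def plus_fun_def smult_fun_def lie_bracket_def lie_deriv_def
      cont_linear_0[OF cont_linear_pdiff])

lemma ddom_nth:
  assumes "Ys \<in> ddom q r ws k n"
  shows "length Ys = k" "i < k \<Longrightarrow> Ys ! i \<in> Agrade q r (n - i)"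
  using assms
proof (induction k arbitrary: n Ys i)
  case (Suc k)
  {
    case 1
    then show ?case using Suc.IH(1) by auto
  next
    case 2
    then obtain V Ys' where Ys: "Ys = V # Ys'" "V \<in> Agrade q r n" "Ys' \<in> ddom q r ws k (n - 1)"
      by auto
    show ?case
    proof (cases i)
      case s: (Suc l)
      then have "Ys' ! l \<in> Agrade q r (n - 1 - l)"
        using Suc.IH(2)[OF _ Ys(3)] 2 by simp
      then show ?thesis
        by (simp add: s Ys(1) One_nat_def)
    qed (use Ys in simp)
  }
qed auto

lemma dmap_grade:
  assumes ws: "ws 0 = 0" "\<And>i. 1 \<le> i \<Longrightarrow> ws i \<in> Sgrade q r i" and Ys: "Ys \<in> ddom q r ws k n" and k: "k \<le> n"
  shows "dmap q ws Ys \<in> Sgrade q r n"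
  unfolding dmap_def
proof (rule fields.subspace_sum[OF subspace_Sgrade])
  fix i assume "i \<in> {..<length Ys}"
  then have i: "i < k" "Ys ! i \<in> Agrade q r (n - i)"
    using ddom_nth[OF Ys] by auto
  show "act q (Ys ! i) (ws i) \<in> Sgrade q r n"
  proof (cases "i = 0")
    case True
    then show ?thesis
      using ws(1) fields.subspace_0[OF subspace_Sgrade] by (simp add: act_zero)
  next
    case False
    then show ?thesis
      using act_grade[OF i(2) ws(2)[of i]] i(1) k by simp
  qed
qed

text \<open>
  The domains \<open>A\<^sub>n \<times> ker d\<^sup>n\<^sup>-\<^sup>1\<^sup>,\<^sup>k\<^sup>-\<^sup>1\<close> are closed under these combinations, entry by entry; hence the images of
  the maps \<open>d\<^sup>n\<^sup>,\<^sup>k\<close> are subspaces.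
\<close>

definition triple_comb :: "'a \<Rightarrow> 'a \<Rightarrow> 'a vfield \<times> (nat \<Rightarrow> 'a series) \<times> 'a series
    \<Rightarrow> 'a vfield \<times> (nat \<Rightarrow> 'a series) \<times> 'a series \<Rightarrow> 'a :: field_char_0 vfield \<times> (nat \<Rightarrow> 'a series) \<times> 'a series" where
  "triple_comb c d = (\<lambda>(S, P, T) (S', P', T').
     (smult_fun (mconst c) S + smult_fun (mconst d) S', (\<lambda>j. mconst c * P j + mconst d * P' j), mconst c * T + mconst d * T'))"

lemma act_comb: "act q (triple_comb c d A A') w = smult_fun (mconst c) (act q A w) + smult_fun (mconst d) (act q A' w)"
proof -
  obtain S P T S' P' T' where [simp]: "A = (S, P, T)" "A' = (S', P', T')"
    by (cases A; cases A')
  let ?S = "smult_fun (mconst c) S + smult_fun (mconst d) S'"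
  have "lie_deriv ?S f = mconst c * lie_deriv S f + mconst d * lie_deriv S' f" for f
    by (simp add: lie_deriv_def plus_fun_def smult_fun_def algebra_simps)
  moreover have "lie_deriv w (?S s) = mconst c * lie_deriv w (S s) + mconst d * lie_deriv w (S' s)" for s
    by (simp add: plus_fun_def smult_fun_def lie_deriv_linear)
  moreover have "(\<Sum>j=1..q. pdiff (Param j) (w s) * (mconst c * P j + mconst d * P' j))
      = mconst c * (\<Sum>j=1..q. pdiff (Param j) (w s) * P j) + mconst d * (\<Sum>j=1..q. pdiff (Param j) (w s) * P' j)" for s
    by (simp add: distrib_left sum.distrib sum_distrib_left mult.left_commute)
  ultimately show ?thesis
    by (intro ext) (simp add: triple_comb_def lie_bracket_def, simp add: plus_fun_def smult_fun_def algebra_simps)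
qed

lemma Agrade_comb:
  assumes "A \<in> Agrade q r n" "A' \<in> Agrade q r n"
  shows "triple_comb c d A A' \<in> Agrade q r n"
proof -
  obtain S P T S' P' T' where [simp]: "A = (S, P, T)" "A' = (S', P', T')"
    by (cases A; cases A')
  have "smult_fun (mconst c) S + smult_fun (mconst d) S' \<in> Sgrade q r n"
    by (intro fields.subspace_add[OF subspace_Sgrade] fields.subspace_scale[OF subspace_Sgrade])
       (use assms in \<open>simp_all add: Agrade_def\<close>)
  moreover have "mconst c * T + mconst d * T' \<in> Tgrade q r n"
  proof -
    obtain \<tau> \<tau>' where "T = emb \<tau>" "T' = emb \<tau>'" "\<tau> \<in> planar q (eq_wt (grade_wt r) n)" "\<tau>' \<in> planar q (eq_wt (grade_wt r) n)"
      using assms by (auto simp: Agrade_def Tgrade_eq)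
    moreover from this have "mconst c * T + mconst d * T' = emb (mconst c * \<tau> + mconst d * \<tau>')"
      by (simp add: emb_simps)
    ultimately show ?thesis
      unfolding Tgrade_eq by (metis image_eqI planar_add planar_scale)
  qed
  moreover have "(\<lambda>j. mconst c * P j + mconst d * P' j) \<in> Pgrade q r n"
  proof -
    have P: "P \<in> Pgrade q r n" "P' \<in> Pgrade q r n"
      using assms by (simp_all add: Agrade_def)
    then have "(\<lambda>j. mconst c * P j + mconst d * P' j) \<in> Pspace q"
      by (simp add: Pgrade_def Pspace_iff supp_add supp_mconst_mult)
    moreover have "(\<Sum>p=1..q. alpha r p * Poly_Mapping.lookup m (Param p)) = n + alpha r j"
      if "mcoeff (mconst c * P j + mconst d * P' j) m \<noteq> 0" for j m
    proof -
      have "mcoeff (P j) m \<noteq> 0 \<or> mcoeff (P' j) m \<noteq> 0"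
        using that by auto
      then show ?thesis
        using P by (auto simp: Pgrade_def)
    qed
    ultimately show ?thesis
      by (simp add: Pgrade_def)
  qed
  ultimately show ?thesis
    by (simp add: triple_comb_def Agrade_def)
qed

lemma dmap_map2_comb:
  assumes "length Ys = length Ys'"
  shows "dmap q ws (map2 (triple_comb c d) Ys Ys') = smult_fun (mconst c) (dmap q ws Ys) + smult_fun (mconst d) (dmap q ws Ys')"
  unfolding dmap_def
  by (simp add: assms act_comb sum.distrib fields.scale_sum_right cong: sum.cong_simp)

lemma ddom_comb:
  "Ys \<in> ddom q r ws k n \<Longrightarrow> Ys' \<in> ddom q r ws k n \<Longrightarrow> map2 (triple_comb c d) Ys Ys' \<in> ddom q r ws k n"
proof (induction k arbitrary: n Ys Ys')
  case (Suc k)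
  then obtain V Zs V' Zs' where Y: "Ys = V # Zs" "V \<in> Agrade q r n" "Zs \<in> ddom q r ws k (n - 1)" "dmap q ws Zs = 0"
    "Ys' = V' # Zs'" "V' \<in> Agrade q r n" "Zs' \<in> ddom q r ws k (n - 1)" "dmap q ws Zs' = 0"
    by auto
  have "length Zs = length Zs'"
    using ddom_nth(1)[OF Y(3)] ddom_nth(1)[OF Y(7)] by simp
  then have "dmap q ws (map2 (triple_comb c d) Zs Zs') = 0"
    by (simp add: dmap_map2_comb Y(4,8) smult_fun_def fun_eq_iff)
  then show ?case
    using Y Suc.IH[OF Y(3,7)] Agrade_comb[OF Y(2,6), of c d] by (cases "triple_comb c d V V'") auto
qed simp

lemma ddom_nonempty: "\<exists>Ys \<in> ddom q r ws k n. dmap q ws Ys = 0"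
proof (induction k arbitrary: n)
  case (Suc k)
  obtain Zs where Zs: "Zs \<in> ddom q r ws k (n - 1)" "dmap q ws Zs = 0"
    using Suc by blast
  have "(0, \<lambda>_. 0, 0) \<in> Agrade q r n"
    using fields.subspace_0[OF subspace_Sgrade] planar_0[of q "eq_wt (grade_wt r) n"]
    by (auto simp: Agrade_def Tgrade_eq Pgrade_def Pspace_def emb_simps intro!: image_eqI[of _ _ 0])
  then have mem: "(0, \<lambda>_. 0, 0) # Zs \<in> ddom q r ws (Suc k) n"
    using Zs by simp
  have "dmap q ws (map2 (triple_comb 0 0) Ys Ys) = 0" for Ys
    by (subst dmap_map2_comb) (simp_all add: fun_eq_iff smult_fun_def mconst_simps)
  with ddom_comb[OF mem mem, of 0 0] show ?case
    by blast
qed (simp add: dmap_def)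

lemma dimage_subspace: "fields.subspace (dimage q r ws n k)"
proof (rule fields.subspaceI)
  show "0 \<in> dimage q r ws n k"
    unfolding dimage_def using ddom_nonempty by (metis image_eqI)
  have comb: "smult_fun (mconst c) x + smult_fun (mconst d) y \<in> dimage q r ws n k"
    if xy: "x \<in> dimage q r ws n k" "y \<in> dimage q r ws n k" for c d and x y :: "'a vfield"
  proof -
    obtain Ys Ys' where Y: "Ys \<in> ddom q r ws (min k n) n" "Ys' \<in> ddom q r ws (min k n) n" "x = dmap q ws Ys" "y = dmap q ws Ys'"
      using xy by (auto simp: dimage_def)
    have "length Ys = length Ys'"
      using ddom_nth(1)[OF Y(1)] ddom_nth(1)[OF Y(2)] by simp
    then show ?thesis
      unfolding Y(3,4) dimage_def by (simp add: dmap_map2_comb[symmetric] ddom_comb[OF Y(1,2)])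
  qed
  show "x + y \<in> dimage q r ws n k" if "x \<in> dimage q r ws n k" "y \<in> dimage q r ws n k" for x y
    using comb[OF that, of 1 1] by (simp add: fields.scale_one)
  show "smult_fun (mconst c) x \<in> dimage q r ws n k" if "x \<in> dimage q r ws n k" for c x
    using comb[OF that that, of c 0] by (simp add: fields.scale_zero_left)
qed

text \<open>
  A normal form style is a free choice of complements, so the condition \<open>w\<^sub>n \<in> \<C>\<^sup>n\<^sup>,\<^sup>n\<close> can be met whenever
  \<open>w\<^sub>n\<close> is outside the image or zero.
\<close>

lemma infinite_level_nfI:
  assumes ws: "ws 0 = 0" "\<And>i. 1 \<le> i \<Longrightarrow> ws i \<in> Sgrade q r i" and w: "w = (\<lambda>s. formal_sum (\<lambda>i. ws i s))"
    and out: "\<And>n. 1 \<le> n \<Longrightarrow> ws n \<in> dimage q r ws n n \<Longrightarrow> ws n = 0"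
  shows "infinite_level_nf q r w"
proof -
  have sub: "dimage q r ws n k \<subseteq> Sgrade q r n" for n k
    unfolding dimage_def using dmap_grade[OF ws] by auto
  have "\<exists>C. complement_in (Sgrade q r n) (dimage q r ws n k) C \<and> (k = n \<longrightarrow> ws n \<in> C)" if "1 \<le> n" for n k
  proof (cases "k = n")
    case True
    then show ?thesis
      using complement_containing[OF subspace_Sgrade dimage_subspace sub ws(2)[OF that] out[OF that]] by metis
  next
    case False
    then show ?thesis
      using complement_containing[OF subspace_Sgrade dimage_subspace sub fields.subspace_0[OF subspace_Sgrade]] by metis
  qed
  then obtain C where "\<And>n k. 1 \<le> n \<Longrightarrow> complement_in (Sgrade q r n) (dimage q r ws n k) (C n k) \<and> (k = n \<longrightarrow> ws n \<in> C n k)"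
    by metis
  then have "\<forall>n\<ge>1. \<forall>k\<ge>1. complement_in (Sgrade q r n) (dimage q r ws n k) (C n k)" "\<forall>n\<ge>1. ws n \<in> C n n"
    by blast+
  then show ?thesis
    unfolding infinite_level_nf_def using ws w by blast
qed

text \<open>
  If \<open>E b = b\<close> and \<open>b\<close> is free of parameters, then \<open>a E b - b E a = b (a - E a)\<close>, so the multiplier is
  \<open>\<tau> + a - E a\<close> for all such \<open>b\<close>. Both \<open>x\<close> and \<open>\<beta>\<^sub>1 R\<close> are of this kind.
\<close>

lemma act_multiplier:
  assumes "A \<in> Agrade q r n"
  obtains c where "\<And>b. planar_euler b = b \<Longrightarrow> (\<And>j. pdiff (Param j) b = 0) \<Longrightarrow>
    act q A (euler_field (emb b)) = euler_field (emb (b * c))"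
proof -
  obtain a P \<tau> where A: "A = (euler_field (emb a), P, emb \<tau>)" "P \<in> Pspace q"
    using AgradeE[OF assms] by metis
  have "act_coeff q a P \<tau> b = b * (\<tau> + a - planar_euler a)"
    if "planar_euler b = b" "\<And>j. pdiff (Param j) b = 0" for b
    using that by (simp add: act_coeff_def algebra_simps)
  then show thesis
    using that[of "\<tau> + a - planar_euler a"] act_euler_field[OF A(2)] by (simp add: A(1))
qed

definition normal_form :: "nat \<Rightarrow> 'a :: field_char_0 \<Rightarrow> 'a \<Rightarrow> 'a series" where
  "normal_form r \<beta>\<^sub>1 \<beta>\<^sub>r = xv + mconst \<beta>\<^sub>1 * yv + mconst \<beta>\<^sub>r * yv ^ r + (\<Sum>k\<le>r. yv ^ k * mu (k + 1))"

text \<open>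
  The grade decomposition: by the choice of \<open>\<alpha>\<close>, each \<open>R\<^sup>k \<mu>\<^sub>k\<^sub>+\<^sub>1\<close> has the grade \<open>2 r\<close> of \<open>R\<^sup>r\<close>.
\<close>

definition normal_form_part :: "nat \<Rightarrow> 'a :: field_char_0 \<Rightarrow> 'a \<Rightarrow> nat \<Rightarrow> 'a series" where
  "normal_form_part r \<beta>\<^sub>1 \<beta>\<^sub>r i = (if i = 1 then xv else if i = 2 then mconst \<beta>\<^sub>1 * yv
     else if i = 2 * r then mconst \<beta>\<^sub>r * yv ^ r + (\<Sum>k\<le>r. yv ^ k * mu (k + 1)) else 0)"

lemma normal_form_part_grade:
  assumes r: "2 \<le> r" "r + 1 \<le> q"
  shows "normal_form_part r \<beta>\<^sub>1 \<beta>\<^sub>r i \<in> planar q (eq_wt (grade_wt r) i)"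
proof -
  let ?w = "grade_wt r"
  have x: "xv \<in> planar q (eq_wt ?w 1)"
    by (simp add: planar_def supp_mvar_over supp_mvar_eq planar_vars_def grade_wt_def)
  have y: "supp yv \<subseteq> over (planar_vars q)" "supp yv \<subseteq> eq_wt ?w 2"
    by (simp_all add: supp_mvar_over supp_mvar_eq planar_vars_def grade_wt_def)
  have yk: "supp (yv ^ k) \<subseteq> over (planar_vars q)" "supp (yv ^ k) \<subseteq> eq_wt ?w (k * 2)" for k
    by (rule supp_power_over[OF y(1)] supp_power_eq[OF y(2)])+
  have "yv ^ k * mu (k + 1) \<in> planar q (eq_wt ?w (2 * r))" if "k \<le> r" for k
  proof -
    have m: "supp (mu (k + 1)) \<subseteq> over (planar_vars q)" "supp (mu (k + 1)) \<subseteq> eq_wt ?w (2 * (r - k))"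
      using that r by (simp_all add: supp_mvar_over supp_mvar_eq planar_vars_def grade_wt_def alpha_def)
    have "k * 2 + 2 * (r - k) = 2 * r"
      using that by simp
    then show ?thesis
      using supp_mult_eq[OF yk(2)[of k] m(2)] supp_mult_over[OF yk(1)[of k] m(1)] by (simp add: planar_def)
  qed
  moreover have "yv ^ r \<in> planar q (eq_wt ?w (2 * r))"
    using yk[of r] r by (simp add: planar_def mult.commute)
  moreover have "yv \<in> planar q (eq_wt ?w 2)"
    using y by (simp add: planar_def)
  ultimately show ?thesis
    using x by (auto simp: normal_form_part_def planar_0 intro!: planar_add planar_scale planar_sum)
qed

lemma normal_form_parts_sum:
  assumes "2 \<le> r"
  shows "(\<lambda>s. formal_sum (\<lambda>i. euler_field (emb (normal_form_part r \<beta>\<^sub>1 \<beta>\<^sub>r i)) s)) = euler_field (emb (normal_form r \<beta>\<^sub>1 \<beta>\<^sub>r))"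
proof
  fix s
  have "formal_sum (\<lambda>i. euler_field (emb (normal_form_part r \<beta>\<^sub>1 \<beta>\<^sub>r i)) s)
      = (\<Sum>i\<in>{1, 2, 2 * r}. euler_field (emb (normal_form_part r \<beta>\<^sub>1 \<beta>\<^sub>r i)) s)"
    by (rule formal_sum_finite) (auto simp: normal_form_part_def emb_simps euler_field_0)
  also have "\<dots> = euler_field (emb (normal_form r \<beta>\<^sub>1 \<beta>\<^sub>r)) s"
    using assms by (simp add: normal_form_part_def normal_form_def emb_simps euler_field_apply algebra_simps)
  finally show "formal_sum (\<lambda>i. euler_field (emb (normal_form_part r \<beta>\<^sub>1 \<beta>\<^sub>r i)) s)
      = euler_field (emb (normal_form r \<beta>\<^sub>1 \<beta>\<^sub>r)) s" .
qed

text \<open>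
  A list of length \<open>n \<le> 2 r\<close> is paired with the components of grades less than \<open>n\<close>, so only \<open>x\<close> and \<open>\<beta>\<^sub>1 R\<close>
  take part. By induction, the kernel condition on the tail of the list reads
  \<open>x c = 0\<close>, where \<open>c\<close> is the multiplier of its entry at position \<open>1\<close>; so this entry acts as zero on
  \<open>\<beta>\<^sub>1 R\<close>, too. In the list itself it is at position \<open>2\<close>, where it would meet \<open>\<beta>\<^sub>1 R\<close>. Only the action on \<open>x\<close>
  of the entry at position \<open>1\<close> is left. For the induction, the third conjunct says that
  all entries from position \<open>2\<close> on have the multiplier zero.
\<close>

lemma normal_form_image:
  fixes \<beta>\<^sub>1 \<beta>\<^sub>r :: "'a :: field_char_0" and r :: nat
  defines "ws \<equiv> \<lambda>i. euler_field (emb (normal_form_part r \<beta>\<^sub>1 \<beta>\<^sub>r i))"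
  assumes r: "2 \<le> r"
  shows "n \<le> 2 * r \<Longrightarrow> Ys \<in> ddom q r ws n n \<Longrightarrow>
    (\<exists>c. dmap q ws Ys = euler_field (emb (xv * c))) \<and> (n \<le> 1 \<longrightarrow> dmap q ws Ys = 0) \<and>
    (\<forall>i b. 2 \<le> i \<longrightarrow> i < n \<longrightarrow> planar_euler b = b \<longrightarrow> (\<forall>j. pdiff (Param j) b = 0) \<longrightarrow>
      act q (Ys ! i) (euler_field (emb b)) = 0)"
proof (induction n arbitrary: Ys)
  case 0
  then show ?case
    by (auto simp: dmap_def emb_simps euler_field_0 intro!: exI[of _ 0])
next
  case (Suc n)
  have ws: "ws 0 = 0" "ws 1 = euler_field (emb xv)" "ws 2 = euler_field (emb (mconst \<beta>\<^sub>1 * yv))"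
    "\<And>i. 3 \<le> i \<Longrightarrow> i < 2 * r \<Longrightarrow> ws i = 0"
    using r by (auto simp: ws_def normal_form_part_def emb_simps euler_field_0)
  have good: "planar_euler xv = xv" "pdiff (Param j) xv = 0" "planar_euler (mconst \<beta>\<^sub>1 * yv) = mconst \<beta>\<^sub>1 * yv"
    "pdiff (Param j) (mconst \<beta>\<^sub>1 * yv) = 0" for j
    by (simp_all add: pdiff_mvar cont_linear_mconst[OF derivation_along_linear[OF derivation_planar_euler]]
        cont_linear_mconst[OF cont_linear_pdiff])
  obtain V Zs where Y: "Ys = V # Zs" "Zs \<in> ddom q r ws n n" "dmap q ws Zs = 0"
    using Suc.prems by auto
  have only_x: "dmap q ws As = act q (As ! 1) (ws 1)"
    if As: "length As = m" "2 \<le> m" "m \<le> 2 * r"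
      and kill: "\<And>i b. 2 \<le> i \<Longrightarrow> i < m \<Longrightarrow> planar_euler b = b \<Longrightarrow> (\<And>j. pdiff (Param j) b = 0) \<Longrightarrow>
        act q (As ! i) (euler_field (emb b)) = 0" for As m
  proof -
    have "dmap q ws As = (\<Sum>i<m. act q (As ! i) (ws i))"
      by (simp add: dmap_def As(1))
    also have "\<dots> = (\<Sum>i\<in>{1}. act q (As ! i) (ws i))"
    proof (rule sum.mono_neutral_right)
      show "\<forall>i\<in>{..<m} - {1}. act q (As ! i) (ws i) = 0"
      proof
        fix i assume i: "i \<in> {..<m} - {1}"
        then consider "i = 0" | "i = 2" | "3 \<le> i"
          by fastforce
        then show "act q (As ! i) (ws i) = 0"
        proof cases
          case 2
          then show ?thesis
            using i unfolding 2 ws(3) by (intro kill good) auto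
        next
          case 3
          then have "ws i = 0"
            using i As(3) by (intro ws(4)) auto
          then show ?thesis
            by (simp add: act_zero)
        qed (simp add: ws(1) act_zero)
      qed
    qed (use As in auto)
    finally show ?thesis
      by simp
  qed
  note IH = Suc.IH[OF Suc_leD[OF Suc.prems(1)] Y(2)]
  have kill: "act q (Ys ! i) (euler_field (emb b)) = 0"
    if i: "2 \<le> i" "i < Suc n" and b: "planar_euler b = b" "\<And>j. pdiff (Param j) b = 0" for i b
  proof -
    define l where "l = i - 1"
    have l: "i = Suc l" "1 \<le> l" "l < n"
      using i by (auto simp: l_def)
    show ?thesis
    proof (cases "l = 1")
      case True
      then have n: "2 \<le> n"
        using l by simp
      have A: "Zs ! 1 \<in> Agrade q r (n - 1)" and len: "length Zs = n"
        using ddom_nth[OF Y(2)] n by auto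
      obtain c where c: "\<And>b. planar_euler b = b \<Longrightarrow> (\<And>j. pdiff (Param j) b = 0) \<Longrightarrow>
          act q (Zs ! 1) (euler_field (emb b)) = euler_field (emb (b * c))"
        using act_multiplier[OF A] by metis
      have "dmap q ws Zs = act q (Zs ! 1) (ws 1)"
      proof (rule only_x[OF len n])
        show "n \<le> 2 * r"
          using Suc.prems(1) by simp
      qed (use IH in blast)
      then have "euler_field (emb (xv * c)) = dmap q ws Zs"
        unfolding ws(2) c[OF good(1,2)] by (rule sym)
      then have "euler_field (emb (xv * c)) = euler_field 0"
        by (simp add: Y(3) euler_field_0)
      then have "xv * emb c = xv * 0"
        by (auto dest!: euler_field_emb_eqD simp: emb_simps)
      then have "emb c = 0"
        by (rule mvar_mult_cancel)
      then show ?thesis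
        using c[OF b] by (simp add: Y(1) l(1) True emb_simps euler_field_0 One_nat_def)
    next
      case False
      then have "2 \<le> l"
        using l by simp
      then have "act q (Zs ! l) (euler_field (emb b)) = 0"
        using IH b l by blast
      then show ?thesis
        by (simp add: Y(1) l(1))
    qed
  qed
  have len: "length Ys = Suc n" and A: "1 < Suc n \<Longrightarrow> Ys ! 1 \<in> Agrade q r (Suc n - 1)"
    using ddom_nth(1)[OF Suc.prems(2)] ddom_nth(2)[OF Suc.prems(2), of 1] by simp_all
  have zero: "dmap q ws Ys = 0" if "n = 0"
    using len that by (simp add: dmap_def ws(1) act_zero)
  have "\<exists>c. dmap q ws Ys = euler_field (emb (xv * c))"
  proof (cases "n = 0")
    case True
    then show ?thesis
      using zero by (intro exI[of _ 0]) (simp add: emb_simps euler_field_0)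
  next
    case False
    then have A1: "Ys ! 1 \<in> Agrade q r (Suc n - 1)"
      by (intro A) simp
    obtain c where "\<And>b. planar_euler b = b \<Longrightarrow> (\<And>j. pdiff (Param j) b = 0) \<Longrightarrow>
        act q (Ys ! 1) (euler_field (emb b)) = euler_field (emb (b * c))"
      using act_multiplier[OF A1] by metis
    from this[OF good(1,2)] have "act q (Ys ! 1) (ws 1) = euler_field (emb (xv * c))"
      unfolding ws(2) .
    moreover have "dmap q ws Ys = act q (Ys ! 1) (ws 1)"
      by (rule only_x[OF len _ Suc.prems(1) kill]) (use False in auto)
    ultimately show ?thesis
      by metis
  qed
  then show ?case
    using zero kill by auto
qed

lemma mvar_power_neq_0: "mvar v ^ k \<noteq> (0 :: ('v, 'b :: comm_ring_1) mfps)"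
proof
  assume "mvar v ^ k = (0 :: ('v, 'b) mfps)"
  then have "mcoeff (monomial (Poly_Mapping.single v k) :: ('v, 'b) mfps) (Poly_Mapping.single v k) = 0"
    by (simp add: monomial_single)
  then show False
    by (simp add: mcoeff_monomial)
qed

lemma normal_form_infinite_level:
  fixes \<beta>\<^sub>1 \<beta>\<^sub>r :: "'a :: field_char_0"
  assumes r: "2 \<le> r" "r + 1 \<le> q" and \<beta>\<^sub>r: "\<beta>\<^sub>r \<noteq> 0"
  shows "infinite_level_nf q r (euler_field (emb (normal_form r \<beta>\<^sub>1 \<beta>\<^sub>r)))"
proof (rule infinite_level_nfI)
  let ?part = "normal_form_part r \<beta>\<^sub>1 \<beta>\<^sub>r"
  let ?ws = "\<lambda>i. euler_field (emb (?part i))"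
  show "?ws 0 = 0"
    using r by (simp add: normal_form_part_def emb_simps euler_field_0)
  show "?ws i \<in> Sgrade q r i" if "1 \<le> i" for i
    unfolding Sgrade_eq by (intro imageI normal_form_part_grade r)
  show "euler_field (emb (normal_form r \<beta>\<^sub>1 \<beta>\<^sub>r)) = (\<lambda>s. formal_sum (\<lambda>i. ?ws i s))"
    by (rule normal_form_parts_sum[OF r(1), symmetric])
  fix n :: nat assume n: "1 \<le> n" and im: "?ws n \<in> dimage q r ?ws n n"
  \<comment> \<open>Setting \<open>x = z = \<mu> = 0\<close> kills the image but not the pure powers of \<open>R\<close>.\<close>
  let ?\<kappa> = "\<lambda>v. if v = State Y then yv else (0 :: 'a series)"
  have "{v. ?\<kappa> v \<noteq> 0 \<and> ?\<kappa> v \<noteq> mvar v} = {}"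
    by auto
  then have hom: "cont_hom (msubst ?\<kappa>)"
    by (intro cont_hom_msubst) (simp add: substitution_def)
  show "?ws n = 0"
  proof (cases "n \<in> {1, 2, 2 * r}")
    case True
    then have "n \<le> 2 * r"
      using r by auto
    obtain Ys where Ys: "Ys \<in> ddom q r ?ws n n" "?ws n = dmap q ?ws Ys"
      using im by (auto simp: dimage_def)
    note img = normal_form_image[OF r(1) \<open>n \<le> 2 * r\<close> Ys(1)]
    show ?thesis
    proof (cases "n = 1")
      case True
      then show ?thesis
        using img Ys(2) by simp
    next
      case False
      obtain c where "?ws n = euler_field (emb (xv * c))"
        using img Ys(2) by metis
      then have "emb (?part n) = xv * emb c"
        by (auto dest!: euler_field_emb_eqD simp: emb_simps)
      then have zero: "msubst ?\<kappa> (emb (?part n)) = 0"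
        by (simp add: cont_hom_simps[OF hom])
      show ?thesis
      proof (cases "n = 2")
        case True
        then have "mconst \<beta>\<^sub>1 * (yv * yv) = (0 :: 'a series)"
          using zero by (simp add: normal_form_part_def emb_simps cont_hom_simps[OF hom] power2_eq_square)
        then have "\<beta>\<^sub>1 = 0"
          using mvar_power_neq_0[where v = "State Y" and k = 2 and 'b = 'a]
          by (simp add: mconst_mult_eq_0_iff power2_eq_square)
        then show ?thesis
          using True by (simp add: normal_form_part_def mconst_simps emb_simps euler_field_0)
      next
        case False
        then have "n = 2 * r"
          using True \<open>n \<noteq> 1\<close> by simp
        then have "mconst \<beta>\<^sub>r * (yv * yv) ^ r = (0 :: 'a series)"
          using zero r by (simp add: normal_form_part_def emb_simps cont_hom_simps[OF hom] power2_eq_square)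
        then have "(yv * yv) ^ r = (0 :: 'a series)"
          using \<beta>\<^sub>r by (simp add: mconst_mult_eq_0_iff)
        then show ?thesis
          using mvar_power_neq_0[where v = "State Y" and k = "2 * r" and 'b = 'a]
          by (simp add: power_mult power2_eq_square)
      qed
    qed
  qed (auto simp: normal_form_part_def emb_simps euler_field_0)
qed

section \<open>The parametric normal form\<close>

lemma weight_le_wt: "v \<in> Poly_Mapping.keys n \<Longrightarrow> c v \<le> wt c n"
proof -
  assume v: "v \<in> Poly_Mapping.keys n"
  have "c v * 1 \<le> c v * Poly_Mapping.lookup n v"
    using v by (intro mult_left_mono) (simp_all add: in_keys_nat_iff)
  also have "\<dots> \<le> wt c n"
    unfolding wt_def using v by (intro member_le_sum) simp_all
  finally show ?thesis
    by simp
qed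

lemma planar_monomial_radius:
  "planar_monomial k 0 0 = radius_pow k"
  "planar_monomial k 0 (Poly_Mapping.single j 1) = radius_pow k + param_var j"
  "planar_monomial 1 1 0 = Poly_Mapping.single (State X) 1"
  by (simp_all add: planar_monomial_def)

text \<open>
  At the second level the only monomial with \<open>x\<close> is \<open>x\<close> itself.
\<close>

lemma second_level_series:
  fixes \<beta> :: "'a :: field_char_0 coeffs"
  assumes \<beta>: "second_level q \<beta>"
  obtains h where "Esum \<beta> = euler_field (emb (xv + h))" "supp h \<subseteq> over (base_vars q)" "mcoeff h 0 = 0"
    "\<And>k. mcoeff h (radius_pow k) = \<beta> k 0 0"
    "\<And>k j. mcoeff h (radius_pow k + param_var j) = \<beta> k 0 (Poly_Mapping.single j 1)"
proof
  let ?g = "planar_series \<beta>" and ?X = "Poly_Mapping.single (State X) 1 :: var \<Rightarrow>\<^sub>0 nat"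
  let ?h = "?g - xv"
  have adm: "\<beta> \<in> admissible q" and \<beta>1: "\<beta> 1 1 0 = 1"
    and other: "\<And>k l m. l \<noteq> 0 \<Longrightarrow> (k, l, m) \<noteq> (1, 1, 0) \<Longrightarrow> \<beta> k l m = 0"
    using \<beta> unfolding second_level_def by blast+
  have le: "\<And>k l m. \<beta> k l m \<noteq> 0 \<Longrightarrow> l \<le> k"
    using adm by (auto simp: admissible_def)
  have co: "mcoeff ?g (planar_monomial k l m) = \<beta> k l m" if "l \<le> k" for k l m
    by (rule planar_series(2)[OF le that])
  have g: "?g \<in> planar q UNIV"
    unfolding planar_eq_series using adm by auto
  show "Esum \<beta> = euler_field (emb (xv + ?h))"
    using planar_series(5)[of \<beta>, OF le] by simp
  show "mcoeff ?h 0 = 0"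
    using g by (simp add: planar_def)
  have neqX: "radius_pow k \<noteq> ?X" "radius_pow k + param_var j \<noteq> ?X" for k j
  proof -
    have "Poly_Mapping.lookup (radius_pow k) (State X) = 0" "Poly_Mapping.lookup (radius_pow k + param_var j) (State X) = 0"
      by (simp_all add: lookup_add lookup_single when_def)
    then show "radius_pow k \<noteq> ?X" "radius_pow k + param_var j \<noteq> ?X"
      by (metis lookup_single_eq zero_neq_one)+
  qed
  show "mcoeff ?h (radius_pow k) = \<beta> k 0 0" for k
    using co[of 0 k 0] neqX(1)[of k] by (simp add: planar_monomial_radius mvar_eq_monomial mcoeff_monomial)
  show "mcoeff ?h (radius_pow k + param_var j) = \<beta> k 0 (Poly_Mapping.single j 1)" for k j
    using co[of 0 k "Poly_Mapping.single j 1"] neqX(2)[of k j]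
    by (simp add: planar_monomial_radius mvar_eq_monomial mcoeff_monomial)
  show "supp ?h \<subseteq> over (base_vars q)"
  proof (rule supp_subsetI)
    fix n assume n: "mcoeff ?h n \<noteq> 0"
    have "supp ?h \<subseteq> over (planar_vars q)"
      using g by (simp add: planar_def supp_diff supp_mvar_over planar_vars_def)
    then have np: "n \<in> over (planar_vars q)"
      using n by (auto simp: supp_def)
    let ?x = "Poly_Mapping.lookup n (State X)" and ?y = "Poly_Mapping.lookup n (State Y)"
    let ?m = "Poly_Mapping.map_key Param n"
    note inv = planar_monomial_inverse[OF np]
    have "mcoeff ?g n = \<beta> (?x + ?y) ?x ?m"
      using co[of ?x "?x + ?y" ?m] unfolding inv by simp
    moreover have "?x = 0"
    proof (rule ccontr)
      assume x: "?x \<noteq> 0"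
      show False
      proof (cases "(?x + ?y, ?x, ?m) = (1, 1, 0)")
        case True
        then have "?x = 1" "?y = 0" "?m = 0"
          by auto
        then have "n = ?X"
          using inv planar_monomial_radius(3) by simp
        then show False
          using n co[of 1 1 0] by (simp add: planar_monomial_radius \<beta>1 mvar_eq_monomial mcoeff_monomial)
      next
        case False
        then have "mcoeff ?g n = 0"
          using \<open>mcoeff ?g n = _\<close> other[OF x] by simp
        moreover have "n \<noteq> ?X"
        proof
          assume "n = ?X"
          then have "(?x + ?y, ?x, ?m) = (1, 1, 0)"
            using planar_monomial_eqD[OF planar_monomial_radius(3), of] by simp
          with False show False by blast
        qed
        ultimately show False
          using n by (simp add: mvar_eq_monomial mcoeff_monomial)
      qed
    qed
    then have "State X \<notin> Poly_Mapping.keys n"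
      by (simp add: in_keys_nat_iff)
    then show "n \<in> over (base_vars q)"
      using np by (auto simp: over_def base_vars_def planar_vars_def)
  qed
qed

lemma linear_part_rows:
  fixes \<beta> :: "'a :: field_char_0 coeffs"
  assumes rank: "vec_space.rank (r + 1) (linear_part q r \<beta>) = r + 1"
    and c: "\<And>j. j \<in> {1..q} \<Longrightarrow> (\<Sum>k\<le>r. c k * \<beta> k 0 (Poly_Mapping.single j 1)) = 0" and k: "k \<le> r"
  shows "c k = 0"
proof -
  have "vec (r + 1) c = 0\<^sub>v (r + 1)"
  proof (rule full_rank_rows_independent[OF _ rank])
    show "linear_part q r \<beta> \<in> carrier_mat (r + 1) q"
      by (simp add: linear_part_def)
    fix j assume j: "j < q"
    have "vec (r + 1) c \<bullet> col (linear_part q r \<beta>) j = (\<Sum>k = 0..<r + 1. c k * \<beta> k 0 (Poly_Mapping.single (j + 1) 1))"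
      unfolding scalar_prod_def using j by (intro sum.cong) (simp_all add: linear_part_def)
    also have "{0..<r + 1} = {..r}"
      by auto
    also have "(\<Sum>k\<le>r. c k * \<beta> k 0 (Poly_Mapping.single (j + 1) 1)) = 0"
      using j by (intro c) simp
    finally show "vec (r + 1) c \<bullet> col (linear_part q r \<beta>) j = 0" .
  qed simp
  then have "vec (r + 1) c $ k = 0\<^sub>v (r + 1) $ k"
    by simp
  then show ?thesis
    using k by simp
qed

text \<open>
  The scaling that removes the powers \<open>R\<^sup>k\<close> with \<open>k > r\<close>, followed by the change of parameters. The
  minimality of \<open>r\<close> gives the weight condition on \<open>h - \<beta>\<^sub>1 R - \<beta>\<^sub>r R\<^sup>r\<close>: a monomial of weight at most \<open>r\<close>
  contains no parameter and is therefore a power \<open>R\<^sup>k\<close> with \<open>k \<le> r\<close>.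
\<close>

lemma second_level_normal_form:
  fixes \<beta> :: "'a :: field_char_0 coeffs"
  assumes \<beta>: "second_level q \<beta>" and r: "2 \<le> r" "\<beta> r 0 0 \<noteq> 0" "\<And>k. 1 < k \<Longrightarrow> k < r \<Longrightarrow> \<beta> k 0 0 = 0"
    and rank: "vec_space.rank (r + 1) (linear_part q r \<beta>) = r + 1"
  shows "(elementary_step q)\<^sup>*\<^sup>* (Esum \<beta>) (euler_field (emb (normal_form r (\<beta> 1 0 0) (\<beta> r 0 0))))"
    and "r + 1 \<le> q"
proof -
  let ?\<beta>\<^sub>1 = "\<beta> 1 0 0" and ?\<beta>\<^sub>r = "\<beta> r 0 0"
  obtain h where h: "Esum \<beta> = euler_field (emb (xv + h))" "supp h \<subseteq> over (base_vars q)" "mcoeff h 0 = 0"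
    "\<And>k. mcoeff h (radius_pow k) = \<beta> k 0 0"
    "\<And>k j. mcoeff h (radius_pow k + param_var j) = \<beta> k 0 (Poly_Mapping.single j 1)"
    using second_level_series[OF \<beta>] by metis
  have \<beta>0: "\<beta> 0 0 0 = 0"
    using h(3) h(4)[of 0] by simp
  let ?l = "mconst ?\<beta>\<^sub>1 * yv + mconst ?\<beta>\<^sub>r * yv ^ r :: 'a series"
  have l: "?l = mconst ?\<beta>\<^sub>1 * monomial (radius_pow 1) + mconst ?\<beta>\<^sub>r * monomial (radius_pow r)"
    by (simp add: monomial_single)
  define h' where "h' = h - ?l"
  have h': "supp h' \<subseteq> ge_wt (unfolding_wt r) (Suc r)"
  proof (rule supp_subsetI, rule ccontr)
    fix n assume n: "mcoeff h' n \<noteq> 0" "n \<notin> ge_wt (unfolding_wt r) (Suc r)"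
    have "supp h' \<subseteq> over (base_vars q)"
      unfolding h'_def by (intro supp_diff supp_add supp_mconst_mult supp_power_over supp_mvar_over h) (simp_all add: base_vars_def)
    then have nb: "n \<in> over (base_vars q)"
      using n(1) by (auto simp: supp_def)
    have "Param j \<notin> Poly_Mapping.keys n" for j
      using weight_le_wt[of "Param j" n "unfolding_wt r"] n(2) by (auto simp: ge_wt_def unfolding_wt_def)
    then have "Poly_Mapping.keys n \<subseteq> {State Y}"
      using nb by (auto simp: over_def base_vars_def)
    then have n_eq: "n = radius_pow (Poly_Mapping.lookup n (State Y))" (is "_ = radius_pow ?k")
      by (intro poly_mapping_eqI) (auto simp: lookup_single when_def not_in_keys_iff_lookup_eq_zero[symmetric])
    have "wt (unfolding_wt r) n = ?k"
      by (subst n_eq) (simp add: unfolding_wt_def)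
    then have k: "?k \<le> r"
      using n(2) by (simp add: ge_wt_def)
    have "radius_pow i = 0 \<longleftrightarrow> i = 0" for i
      using radius_pow_eq_iff[of i 0] by simp
    then have "mcoeff h' (radius_pow ?k) = 0"
      using r(1,3) k h(3) unfolding h'_def l
      by (cases "?k = 0"; cases "?k = 1"; cases "?k = r") (simp_all add: h(4) mcoeff_monomial radius_pow_eq_iff)
    with n(1) show False
      using n_eq by simp
  qed
  have h_split: "h = mconst ?\<beta>\<^sub>1 * yv + mconst ?\<beta>\<^sub>r * yv ^ r + h'"
    by (simp add: h'_def)
  obtain f where f: "supp f \<subseteq> over (base_vars q)" "supp f \<subseteq> ge_wt radius_wt 1"
    "\<And>n. r < Poly_Mapping.lookup n (State Y) \<Longrightarrow> mcoeff (scaled f h) n = 0"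
    using exists_scaling[OF h_split h(2) h' r(1,2)] by metis
  have f0: "mcoeff f 0 = 0"
    by (rule ge_wt_1_mcoeff_0[OF f(2)])
  obtain V where V: "stretch f 1 * V = 1" "\<And>h. scaled f h = V * msubst (radius_subst (stretch f 1)) h"
    "\<And>A. supp f \<subseteq> over A \<Longrightarrow> supp V \<subseteq> over A"
    using scaled_inverse[OF f0] by metis
  have step1: "(elementary_step q)\<^sup>*\<^sup>* (Esum \<beta>) (euler_field (emb (xv + scaled f h)))"
    unfolding h(1) V(2) by (rule scaling_step[OF f(1) f0 h(2,3) V(1)])
  let ?h1 = "scaled f h"
  have low: "mcoeff h (radius_pow i) = 0" if "i \<le> r" "i \<noteq> 1" "i \<noteq> r" for i
    using that r(3)[of i] h(3) by (cases "i = 0") (simp_all add: h(4))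
  obtain t where t: "\<And>k. t k k = 1" "\<And>k. k \<le> r \<Longrightarrow> mcoeff ?h1 (radius_pow k) = mcoeff h (radius_pow k)"
    "\<And>k j. k \<le> r \<Longrightarrow> mcoeff ?h1 (radius_pow k + param_var j) = (\<Sum>i\<le>k. t k i * mcoeff h (radius_pow i + param_var j))"
  proof (rule scaled_coefficients[OF f(2) r(1), of h])
    show "mcoeff h (radius_pow i) = 0" if "i \<le> r" "i \<noteq> 1" "i \<noteq> r" for i
      by (rule low[OF that])
  qed (rule that)
  have h1: "supp ?h1 \<subseteq> over (base_vars q)"
  proof -
    have "supp (radius_subst (stretch f 1) v) \<subseteq> over (base_vars q)" if "v \<in> base_vars q" for v
      using that supp_mult_over[OF supp_mvar_over[of "State Y"] supp_stretch_over[OF f(1)]]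
      by (cases "v = State Y") (simp_all add: radius_subst_def supp_mvar_over)
    then show ?thesis
      unfolding V(2) by (intro supp_mult_over supp_msubst_over[OF h(2)] V(3)[OF f(1)])
  qed
  \<comment> \<open>The coefficient of \<open>R\<^sup>k\<close>, split into its constant \<open>c k\<close> and the part \<open>p k\<close> to be made a parameter.\<close>
  define c where "c k = mcoeff ?h1 (radius_pow k)" for k
  define p where "p k = slice k ?h1 - mconst (c k)" for k
  have p: "supp (p k) \<subseteq> param_over q \<and> mcoeff (p k) 0 = 0" for k
    by (simp add: p_def c_def supp_diff supp_slice[OF h1] mcoeff_slice param_over_def)
       (use supp_slice[OF h1] in \<open>simp add: param_over_def supp_diff\<close>)
  have p_lin: "mcoeff (p k) (param_var j) = (\<Sum>i\<le>k. t k i * \<beta> i 0 (Poly_Mapping.single j 1))" if "k \<le> r" for k j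
    using that param_var_eq_0[of j] t(3)[OF that, of j]
    by (simp add: p_def mcoeff_slice mcoeff_mconst lookup_single when_def h(5))
  have "?h1 = (\<Sum>k\<le>r. yv ^ k * slice k ?h1)"
    by (rule slice_expansion[OF f(3)])
  also have "\<dots> = (\<Sum>k\<le>r. mconst (c k) * yv ^ k) + (\<Sum>k\<le>r. yv ^ k * p k)"
    unfolding p_def sum.distrib[symmetric] by (rule sum.cong) (simp_all add: algebra_simps)
  also have "(\<Sum>k\<le>r. mconst (c k) * yv ^ k) = (\<Sum>k\<in>{1, r}. mconst (c k) * yv ^ k :: 'a series)"
  proof (rule sum.mono_neutral_right)
    show "\<forall>k\<in>{..r} - {1, r}. mconst (c k) * yv ^ k = (0 :: 'a series)"
    proof
      fix k assume k: "k \<in> {..r} - {1, r}"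
      then have "c k = 0"
        using low[of k] t(2)[of k] by (simp add: c_def)
      then show "mconst (c k) * yv ^ k = (0 :: 'a series)"
        by (simp add: mconst_simps)
    qed
  qed (use r(1) in auto)
  also have "\<dots> = ?l"
    using r(1) t(2)[of 1] t(2)[of r] by (simp add: c_def h(4))
  finally have h1_eq: "xv + ?h1 = (xv + ?l) + (\<Sum>k\<le>r. yv ^ k * p k)"
    by (simp add: add.assoc)
  have rows: "d k = 0" if "\<And>j. j \<in> {1..q} \<Longrightarrow> (\<Sum>k\<le>r. d k * mcoeff (p k) (param_var j)) = 0" "k \<le> r" for d k
  proof (rule unipotent_rows_independent[where J = "{1..q}" and H = "\<lambda>i j. \<beta> i 0 (Poly_Mapping.single j 1)" and t = t])
    show "e i = 0" if "\<And>j. j \<in> {1..q} \<Longrightarrow> (\<Sum>i\<le>r. e i * \<beta> i 0 (Poly_Mapping.single j 1)) = 0" "i \<le> r" for e i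
      by (rule linear_part_rows[OF rank that])
    show "(\<Sum>k\<le>r. d k * (\<Sum>i\<le>k. t k i * \<beta> i 0 (Poly_Mapping.single j 1))) = 0" if "j \<in> {1..q}" for j
      using \<open>\<And>j. j \<in> {1..q} \<Longrightarrow> (\<Sum>k\<le>r. d k * mcoeff (p k) (param_var j)) = 0\<close>[OF that] by (simp add: p_lin)
  qed (use t(1) that(2) in auto)
  have xl: "supp (xv + ?l) \<subseteq> over {State X, State Y}"
    by (intro supp_add supp_mconst_mult supp_power_over supp_mvar_over) simp_all
  have step2: "(elementary_step q)\<^sup>*\<^sup>* (euler_field (emb ((xv + ?l) + (\<Sum>k\<le>r. yv ^ k * p k))))
      (euler_field (emb ((xv + ?l) + (\<Sum>k\<le>r. yv ^ k * mu (k + 1)))))"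
  proof (rule parameters_from_coefficients(1))
    show "d k = 0" if "\<And>j. j \<in> {1..q} \<Longrightarrow> (\<Sum>k\<le>r. d k * mcoeff (p k) (param_var j)) = 0" "k \<le> r" for d k
      by (rule rows[OF that])
  qed (rule p xl)+
  show "r + 1 \<le> q"
  proof (rule parameters_from_coefficients(2))
    show "d k = 0" if "\<And>j. j \<in> {1..q} \<Longrightarrow> (\<Sum>k\<le>r. d k * mcoeff (p k) (param_var j)) = 0" "k \<le> r" for d k
      by (rule rows[OF that])
  qed (rule p xl)+
  have "normal_form r ?\<beta>\<^sub>1 ?\<beta>\<^sub>r = (xv + ?l) + (\<Sum>k\<le>r. yv ^ k * mu (k + 1))"
    by (simp add: normal_form_def add.assoc)
  then show "(elementary_step q)\<^sup>*\<^sup>* (Esum \<beta>) (euler_field (emb (normal_form r ?\<beta>\<^sub>1 ?\<beta>\<^sub>r)))"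
    using rtranclp_trans[OF step1[unfolded h1_eq] step2] by simp
qed

lemma normal_form_cylindrical:
  "change_of_coords cylindrical (Theta + euler_field (emb (normal_form r \<beta>\<^sub>1 \<beta>\<^sub>r)))
    (cylindrical_system (xv + mconst \<beta>\<^sub>1 * rho\<^sup>2 + (\<Sum>k=0..r. rho ^ (2 * k) * mu (k + 1)) + mconst \<beta>\<^sub>r * rho ^ (2 * r)))"
proof (rule change_to_cylindrical)
  let ?L = "msubst (state_subst (cylindrical :: 'a :: field_char_0 vfield))"
  note hom = cont_hom_simps[OF cont_hom_cylindrical]
  have "?L xv = xv" "?L (mu j) = mu j" for j
    by (simp_all add: state_subst_def)
  then have gen: "?L (xv + mconst \<beta>\<^sub>1 * R + mconst \<beta>\<^sub>r * R ^ r + (\<Sum>k\<le>r. R ^ k * mu (k + 1)))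
      = xv + mconst \<beta>\<^sub>1 * ?L R + mconst \<beta>\<^sub>r * ?L R ^ r + (\<Sum>k\<le>r. ?L R ^ k * mu (k + 1))" for R
    by (simp add: hom del: msubst_mvar)
  have "emb (normal_form r \<beta>\<^sub>1 \<beta>\<^sub>r) = xv + mconst \<beta>\<^sub>1 * (yv\<^sup>2 + zv\<^sup>2) + mconst \<beta>\<^sub>r * (yv\<^sup>2 + zv\<^sup>2) ^ r
      + (\<Sum>k\<le>r. (yv\<^sup>2 + zv\<^sup>2) ^ k * mu (k + 1))"
    by (simp add: normal_form_def emb_simps)
  then show "?L (emb (normal_form r \<beta>\<^sub>1 \<beta>\<^sub>r))
      = xv + mconst \<beta>\<^sub>1 * rho\<^sup>2 + (\<Sum>k=0..r. rho ^ (2 * k) * mu (k + 1)) + mconst \<beta>\<^sub>r * rho ^ (2 * r)"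
    using gen[of "yv\<^sup>2 + zv\<^sup>2"] by (simp add: cylindrical_radius power_mult atMost_atLeast0 add_ac)
qed

theorem theorem5p3:
  fixes w v :: "'a :: field_char_0 vfield" and q :: nat and f :: "nat \<Rightarrow> nat \<Rightarrow> 'a"
  assumes v: "v = Theta +
      formal_sum (\<lambda>(i, j). mconst (f i j) * xv ^ i * (yv\<^sup>2 + zv\<^sup>2) ^ j) \<cdot>\<^sub>v Euler"
    and f: "f 0 0 = 0" "f 1 0 \<noteq> 0"
    and w: "perturbation q w v"
    and nondegenerate: "nondegenerate q w"
  shows "\<exists>r\<ge>2. nondegenerate_of_order q r w \<and>
    (\<exists>w' u' \<beta>\<^sub>1 \<beta>\<^sub>r. permissible q w w' \<and> remove_rotation w' u' \<and> infinite_level_nf q r u' \<and>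
       \<beta>\<^sub>r \<noteq> 0 \<and>
       change_of_coords cylindrical w' (cylindrical_system
         (xv + mconst \<beta>\<^sub>1 * rho\<^sup>2 + (\<Sum>k=0..r. rho ^ (2 * k) * mu (k + 1)) + mconst \<beta>\<^sub>r * rho ^ (2 * r))))"
proof -
  obtain r where nd: "nondegenerate_of_order q r w"
    using nondegenerate by (auto simp: nondegenerate_def)
  then obtain u \<beta> where u: "u \<in> Sspace q" "remove_rotation w u" "(elementary_step q)\<^sup>*\<^sup>* u (Esum \<beta>)"
    and \<beta>: "second_level q \<beta>" "\<exists>k>1. \<beta> k 0 0 \<noteq> 0" "r = (LEAST k. k > 1 \<and> \<beta> k 0 0 \<noteq> 0)"
    and rank: "vec_space.rank (r + 1) (linear_part q r \<beta>) = r + 1"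
    unfolding nondegenerate_of_order_def by blast
  have r: "1 < r \<and> \<beta> r 0 0 \<noteq> 0"
    unfolding \<beta>(3) by (rule LeastI_ex) (use \<beta>(2) in blast)
  then have r2: "2 \<le> r"
    by simp
  have least: "\<beta> k 0 0 = 0" if "1 < k" "k < r" for k
    using not_less_Least[of k "\<lambda>k. k > 1 \<and> \<beta> k 0 0 \<noteq> 0"] that unfolding \<beta>(3) by blast
  let ?G = "normal_form r (\<beta> 1 0 0) (\<beta> r 0 0)"
  let ?u = "euler_field (emb ?G)"
  note red = second_level_normal_form[OF \<beta>(1) r2 conjunct2[OF r] least rank]
  have "?G \<in> planar q UNIV"
  proof -
    have "normal_form_part r (\<beta> 1 0 0) (\<beta> r 0 0) i \<in> planar q UNIV" for i
      using normal_form_part_grade[OF r2 red(2), of "\<beta> 1 0 0" "\<beta> r 0 0" i] by (simp add: planar_def)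
    from planar_add[OF planar_add[OF this[of 1] this[of 2]] this[of "2 * r"]] show ?thesis
      using r2 by (simp add: normal_form_part_def normal_form_def add.assoc)
  qed
  then have "?u \<in> Sspace q"
    by (rule euler_field_in_Sspace)
  moreover have "(elementary_step q)\<^sup>*\<^sup>* u ?u"
    using u(3) red(1) by (rule rtranclp_trans)
  ultimately have "permissible q w (Theta + ?u)"
    unfolding permissible_def using u(1,2) restore_rotation by blast
  moreover have "infinite_level_nf q r ?u"
    using normal_form_infinite_level[OF r2 red(2)] r by blast
  ultimately show ?thesis
    using r2 nd r remove_rotation normal_form_cylindrical by blast
qed

end
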